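(* Let $k$ be an algebraically closed field of characteristic $p\geq 3$, and let $B$ be a Borel subgroup of $SL_2$ over $k$, with first Frobenius kernel $B_1$. Then, as a $k$-algebra and as a $T/T_1$-module, $$\operatorname{HH}^{\bullet}(B_{1})\cong S^{\bullet}(\mathfrak{u}^{*})^{(1)}\otimes\Lambda^{\bullet}(x),$$ where the generators consisting of elements of $\mathfrak{u}^{*}$ are in degree $2$, and $x$ has degree $1$ and weight $0$.
   Context: $SL_2$ is regarded as defined over $\mathbb{F}_p$ with Frobenius morphism $F$. $T$ is a maximal torus, $B=T\ltimes U$ is the Borel subgroup corresponding to the negative root, $U$ is its unipotent radical, $\mathfrak{u}=\operatorname{Lie} U$ (one-dimensional), and $\mathfrak{u}^*$ has as its $T$-weight the positive root. $B_1$ and $T_1$ are the kernels of $F$ on $B$ and $T$. $\operatorname{HH}^{\bullet}(B_1)$ denotes the Hochschild cohomology ring of the distribution algebra $\operatorname{Dist}(B_1)$ (isomorphic to the restricted enveloping algebra of $\operatorname{Lie} B$) with coefficients in itself; it is isomorphic to $\operatorname{H}^{\bullet}(B_1,\operatorname{Dist}(B_1)_{\operatorname{ad}})$, where $\operatorname{Dist}(B_1)_{\operatorname{ad}}$ is $\operatorname{Dist}(B_1)$ with the adjoint action. $T$ acts on it through the adjoint action, with $T_1$ acting trivially. $S^{\bullet}$ is the symmetric algebra, $\Lambda^{\bullet}(x)$ is the exterior algebra on one generator $x$, and the superscript $(1)$ denotes the Frobenius twist (composition of the action with $F$). *)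

theory Defs
  imports
    "HOL-Analysis.Determinants"
    "HOL-Computational_Algebra.Polynomial"
    "HOL-Algebra.QuotRing"
    "HOL-Algebra.Module"
begin

section \<open>Hochschild cohomology of an algebra\<close>

text \<open>
  A \<open>k\<close>-algebra is a record of type \<open>('k, 'a) module\<close>, with \<open>k\<close> the type \<open>'k\<close>.
  An element of the direct sum \<open>C\<^sup>0 \<oplus> C\<^sup>1 \<oplus> \<dots>\<close> of the spaces of multilinear maps
  \<open>A\<^sup>n \<rightarrow> A\<close> is encoded as one function on lists: its component of degree \<open>n\<close> is the restriction
  to lists of length \<open>n\<close>, and it is zero on all sufficiently long lists. Cochains take the
  value zero on lists that leave the carrier, so that equal cochains are equal functions.
\<close>

definition hoch_cochains :: "('k::field, 'a) module \<Rightarrow> ('a list \<Rightarrow> 'a) set" where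
  "hoch_cochains A = {f.
     (\<forall>as. set as \<subseteq> carrier A \<longrightarrow> f as \<in> carrier A) \<and>
     (\<forall>as. \<not> set as \<subseteq> carrier A \<longrightarrow> f as = \<zero>\<^bsub>A\<^esub>) \<and>
     (\<forall>as bs. \<forall>x\<in>carrier A. \<forall>y\<in>carrier A. set as \<subseteq> carrier A \<longrightarrow> set bs \<subseteq> carrier A \<longrightarrow>
        f (as @ (x \<oplus>\<^bsub>A\<^esub> y) # bs) = f (as @ x # bs) \<oplus>\<^bsub>A\<^esub> f (as @ y # bs)) \<and>
     (\<forall>as bs c. \<forall>x\<in>carrier A. set as \<subseteq> carrier A \<longrightarrow> set bs \<subseteq> carrier A \<longrightarrow>
        f (as @ (c \<odot>\<^bsub>A\<^esub> x) # bs) = c \<odot>\<^bsub>A\<^esub> f (as @ x # bs)) \<and>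
     (\<exists>N. \<forall>as. N \<le> length as \<longrightarrow> f as = \<zero>\<^bsub>A\<^esub>)}"

text \<open>
  For \<open>as = [a\<^sub>1, \<dots>, a\<^sub>m]\<close> with \<open>m = n + 1\<close>, this is the bar differential
  \<open>a\<^sub>1 f(a\<^sub>2, \<dots>, a\<^sub>m) + (\<Sum>i = 1..n. (-1)\<^sup>i f(\<dots>, a\<^sub>i a\<^sub>i\<^sub>+\<^sub>1, \<dots>)) + (-1)\<^sup>m f(a\<^sub>1, \<dots>, a\<^sub>n) a\<^sub>m\<close>.
\<close>

definition hoch_d :: "('k::field, 'a) module \<Rightarrow> ('a list \<Rightarrow> 'a) \<Rightarrow> 'a list \<Rightarrow> 'a" where
  "hoch_d A f as =
     (if set as \<subseteq> carrier A \<and> as \<noteq> [] then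
        (hd as \<otimes>\<^bsub>A\<^esub> f (tl as))
        \<oplus>\<^bsub>A\<^esub> (\<Oplus>\<^bsub>A\<^esub>i\<in>{1..<length as}.
              ((-1) ^ i) \<odot>\<^bsub>A\<^esub> f (take (i - 1) as @ (as ! (i - 1) \<otimes>\<^bsub>A\<^esub> as ! i) # drop (i + 1) as))
        \<oplus>\<^bsub>A\<^esub> (((-1) ^ length as) \<odot>\<^bsub>A\<^esub> (f (butlast as) \<otimes>\<^bsub>A\<^esub> last as))
      else \<zero>\<^bsub>A\<^esub>)"

definition hoch_cocycles :: "('k::field, 'a) module \<Rightarrow> ('a list \<Rightarrow> 'a) set" where
  "hoch_cocycles A = {f \<in> hoch_cochains A. \<forall>as. hoch_d A f as = \<zero>\<^bsub>A\<^esub>}"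

definition hoch_coboundaries :: "('k::field, 'a) module \<Rightarrow> ('a list \<Rightarrow> 'a) set" where
  "hoch_coboundaries A = hoch_d A ` hoch_cochains A"

definition hoch_cup ::
    "('k::field, 'a) module \<Rightarrow> ('a list \<Rightarrow> 'a) \<Rightarrow> ('a list \<Rightarrow> 'a) \<Rightarrow> 'a list \<Rightarrow> 'a" where
  "hoch_cup A f g as =
     (if set as \<subseteq> carrier A
      then \<Oplus>\<^bsub>A\<^esub>i\<in>{0..length as}. f (take i as) \<otimes>\<^bsub>A\<^esub> g (drop i as) else \<zero>\<^bsub>A\<^esub>)"

definition hoch_cocycle_algebra :: "('k::field, 'a) module \<Rightarrow> ('k, 'a list \<Rightarrow> 'a) module" where
  "hoch_cocycle_algebra A =
     \<lparr>carrier = hoch_cocycles A, mult = hoch_cup A,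
      one = (\<lambda>as. if as = [] then \<one>\<^bsub>A\<^esub> else \<zero>\<^bsub>A\<^esub>),
      zero = (\<lambda>as. \<zero>\<^bsub>A\<^esub>), add = (\<lambda>f g as. f as \<oplus>\<^bsub>A\<^esub> g as),
      smult = (\<lambda>c f as. c \<odot>\<^bsub>A\<^esub> f as)\<rparr>"

definition hoch_class :: "('k::field, 'a) module \<Rightarrow> ('a list \<Rightarrow> 'a) \<Rightarrow> ('a list \<Rightarrow> 'a) set" where
  "hoch_class A z = hoch_coboundaries A +>\<^bsub>hoch_cocycle_algebra A\<^esub> z"

text \<open>The map induced on classes by an operation on cocycles that respects coboundaries.\<close>

definition hoch_induced ::
    "('k::field, 'a) module \<Rightarrow> (('a list \<Rightarrow> 'a) \<Rightarrow> ('a list \<Rightarrow> 'a)) \<Rightarrow>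
     ('a list \<Rightarrow> 'a) set \<Rightarrow> ('a list \<Rightarrow> 'a) set" where
  "hoch_induced A op \<xi> = (\<Union>z\<in>\<xi>. hoch_class A (op z))"

definition HH :: "('k::field, 'a) module \<Rightarrow> ('k, ('a list \<Rightarrow> 'a) set) module" where
  "HH A = ring.extend (hoch_cocycle_algebra A Quot hoch_coboundaries A)
     (module.fields (\<lambda>c. hoch_induced A (\<lambda>z as. c \<odot>\<^bsub>A\<^esub> z as)))"

definition HH_degree :: "('k::field, 'a) module \<Rightarrow> nat \<Rightarrow> ('a list \<Rightarrow> 'a) set set" where
  "HH_degree A n =
     hoch_class A ` {z \<in> hoch_cocycles A. \<forall>as. length as \<noteq> n \<longrightarrow> z as = \<zero>\<^bsub>A\<^esub>}"

text \<open>The action on cochains of an automorphism \<open>\<alpha>\<close> of \<open>A\<close> with inverse \<open>\<beta>\<close>.\<close>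

definition hoch_conj ::
    "('k::field, 'a) module \<Rightarrow> ('a \<Rightarrow> 'a) \<Rightarrow> ('a \<Rightarrow> 'a) \<Rightarrow> ('a list \<Rightarrow> 'a) \<Rightarrow> 'a list \<Rightarrow> 'a" where
  "hoch_conj A \<alpha> \<beta> f as =
     (if set as \<subseteq> carrier A then \<alpha> (f (map \<beta> as)) else \<zero>\<^bsub>A\<^esub>)"

definition algebra_iso :: "('k, 'a) module \<Rightarrow> ('k, 'b) module \<Rightarrow> ('a \<Rightarrow> 'b) set" where
  "algebra_iso R S =
     {\<phi> \<in> ring_iso R S. \<forall>c. \<forall>x\<in>carrier R. \<phi> (c \<odot>\<^bsub>R\<^esub> x) = c \<odot>\<^bsub>S\<^esub> \<phi> x}"


section \<open>Algebras of functions and linear functionals\<close>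

text \<open>
  A function on a subset \<open>D\<close> of a type is encoded as a function on the type that vanishes
  outside \<open>D\<close>.
\<close>

definition restr :: "'d set \<Rightarrow> ('d \<Rightarrow> 'k) \<Rightarrow> 'd \<Rightarrow> 'k::field" where
  "restr D f = (\<lambda>x. if x \<in> D then f x else 0)"

inductive_set function_algebra :: "'d set \<Rightarrow> ('d \<Rightarrow> 'k::field) set \<Rightarrow> ('d \<Rightarrow> 'k) set"
  for D :: "'d set" and E :: "('d \<Rightarrow> 'k) set" where
  const: "restr D (\<lambda>_. c) \<in> function_algebra D E"
| gen: "f \<in> E \<Longrightarrow> restr D f \<in> function_algebra D E"
| add: "f \<in> function_algebra D E \<Longrightarrow> g \<in> function_algebra D E \<Longrightarrow>
    (\<lambda>x. f x + g x) \<in> function_algebra D E"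
| mult: "f \<in> function_algebra D E \<Longrightarrow> g \<in> function_algebra D E \<Longrightarrow>
    (\<lambda>x. f x * g x) \<in> function_algebra D E"

text \<open>The dual of a vector space \<open>V\<close> of functions with the pointwise operations.\<close>

definition dual_space :: "('d \<Rightarrow> 'k::field) set \<Rightarrow> (('d \<Rightarrow> 'k) \<Rightarrow> 'k) set" where
  "dual_space V = {\<xi>.
     (\<forall>f. f \<notin> V \<longrightarrow> \<xi> f = 0) \<and>
     (\<forall>f\<in>V. \<forall>g\<in>V. \<xi> (\<lambda>x. f x + g x) = \<xi> f + \<xi> g) \<and>
     (\<forall>c. \<forall>f\<in>V. \<xi> (\<lambda>x. c * f x) = c * \<xi> f)}"


section \<open>Subgroups of SL2, Frobenius kernels, distributions\<close>

text \<open>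
  Over an algebraically closed field a reduced closed subgroup of SL2 is given by its set \<open>H\<close>
  of \<open>k\<close>-points, and its coordinate ring \<open>k[H]\<close> is the ring of restrictions to \<open>H\<close> of
  polynomials in the matrix entries. (The determinant being 1, its inverse is not needed.)
\<close>

definition coord_ring :: "('k::field ^ 2 ^ 2) set \<Rightarrow> ('k ^ 2 ^ 2 \<Rightarrow> 'k) set" where
  "coord_ring H = function_algebra H {f. \<exists>i j. f = (\<lambda>x. x $ i $ j)}"

definition frobenius :: "'k::field ^ 2 ^ 2 \<Rightarrow> 'k ^ 2 ^ 2" where
  "frobenius x = (\<chi> i j. (x $ i $ j) ^ CHAR('k))"

text \<open>
  For \<open>H\<close> stable under the Frobenius morphism \<open>F\<close>, the scheme-theoretic kernel \<open>H\<^sub>1\<close> of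
  \<open>F : H \<rightarrow> H\<close> is the closed subscheme of \<open>H\<close> defined by the ideal of \<open>k[H]\<close> generated
  by the functions \<open>g \<circ> F\<close>, where \<open>g\<close> runs over the augmentation ideal of \<open>k[H]\<close>.
\<close>

inductive_set frob_kernel_ideal :: "('k::field ^ 2 ^ 2) set \<Rightarrow> ('k ^ 2 ^ 2 \<Rightarrow> 'k) set"
  for H :: "('k ^ 2 ^ 2) set" where
  gen: "g \<in> coord_ring H \<Longrightarrow> g (mat 1) = 0 \<Longrightarrow> h \<in> coord_ring H \<Longrightarrow>
    (\<lambda>x. h x * g (frobenius x)) \<in> frob_kernel_ideal H"
| add: "f \<in> frob_kernel_ideal H \<Longrightarrow> g \<in> frob_kernel_ideal H \<Longrightarrow>
    (\<lambda>x. f x + g x) \<in> frob_kernel_ideal H"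

text \<open>
  \<open>Dist(H\<^sub>1)\<close> is the dual of \<open>k[H\<^sub>1] = k[H] / I\<close>, that is, the space of the linear functionals on
  \<open>k[H]\<close> that vanish on \<open>I\<close>. The product of \<open>\<mu>\<close> and \<open>\<nu>\<close> is \<open>(\<mu> \<otimes> \<nu>) \<circ> \<Delta>\<close>, where the
  comultiplication of \<open>k[H]\<close> is given by \<open>\<Delta> f (x, y) = f (x y)\<close>.
\<close>

definition dist_frob_kernel ::
    "('k::field ^ 2 ^ 2) set \<Rightarrow> ('k, ('k ^ 2 ^ 2 \<Rightarrow> 'k) \<Rightarrow> 'k) module" where
  "dist_frob_kernel H =
     \<lparr>carrier = {\<mu> \<in> dual_space (coord_ring H). \<forall>f\<in>frob_kernel_ideal H. \<mu> f = 0},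
      mult = (\<lambda>\<mu> \<nu>. restr (coord_ring H)
        (\<lambda>f. \<mu> (restr H (\<lambda>x. \<nu> (restr H (\<lambda>y. f (x ** y))))))),
      one = restr (coord_ring H) (\<lambda>f. f (mat 1)),
      zero = (\<lambda>f. 0), add = (\<lambda>\<mu> \<nu> f. \<mu> f + \<nu> f),
      smult = (\<lambda>c \<mu> f. c * \<mu> f)\<rparr>"

text \<open>
  Push-forward of functionals on \<open>k[H]\<close> along \<open>x \<mapsto> t x t\<^sup>-\<^sup>1\<close>; this is the adjoint action of \<open>t\<close>
  both on \<open>Dist(H\<^sub>1)\<close> and on the Lie algebra of \<open>H\<close>.
\<close>

definition adjoint_action ::
    "('k::field ^ 2 ^ 2) set \<Rightarrow> 'k ^ 2 ^ 2 \<Rightarrow> (('k ^ 2 ^ 2 \<Rightarrow> 'k) \<Rightarrow> 'k) \<Rightarrow> (('k ^ 2 ^ 2 \<Rightarrow> 'k) \<Rightarrow> 'k)" where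
  "adjoint_action H t \<mu> =
     restr (coord_ring H) (\<lambda>f. \<mu> (restr H (\<lambda>x. f (t ** x ** matrix_inv t))))"

definition lie_algebra :: "('k::field ^ 2 ^ 2) set \<Rightarrow> (('k ^ 2 ^ 2 \<Rightarrow> 'k) \<Rightarrow> 'k) set" where
  "lie_algebra H = {\<delta> \<in> dual_space (coord_ring H). \<forall>f\<in>coord_ring H. \<forall>g\<in>coord_ring H.
     \<delta> (\<lambda>x. f x * g x) = \<delta> f * g (mat 1) + f (mat 1) * \<delta> g}"

text \<open>
  \<open>(T, U, B)\<close> consists of a maximal torus, the unipotent radical of a Borel subgroup containing
  it, and this Borel subgroup: the images of the diagonal, lower unitriangular and lower
  triangular matrices under an inner automorphism of SL2. The action of \<open>diag(s, s\<^sup>-\<^sup>1)\<close> on the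
  Lie algebra of the lower unitriangular group is by \<open>s\<^sup>-\<^sup>2\<close>, the negative root.
\<close>

definition borel_triple ::
    "('k::field ^ 2 ^ 2) set \<Rightarrow> ('k ^ 2 ^ 2) set \<Rightarrow> ('k ^ 2 ^ 2) set \<Rightarrow> bool" where
  "borel_triple T U B \<longleftrightarrow> (\<exists>g. det g = 1 \<and>
     T = (\<lambda>x. g ** x ** matrix_inv g) ` {x. det x = 1 \<and> x $ 1 $ 2 = 0 \<and> x $ 2 $ 1 = 0} \<and>
     U = (\<lambda>x. g ** x ** matrix_inv g) ` {x. x $ 1 $ 1 = 1 \<and> x $ 2 $ 2 = 1 \<and> x $ 1 $ 2 = 0} \<and>
     B = (\<lambda>x. g ** x ** matrix_inv g) ` {x. det x = 1 \<and> x $ 1 $ 2 = 0})"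


section \<open>Actions on the Hochschild cohomology of a Frobenius kernel\<close>

definition cochain_action ::
    "('k::field ^ 2 ^ 2) set \<Rightarrow> 'k ^ 2 ^ 2 \<Rightarrow>
     ((('k ^ 2 ^ 2 \<Rightarrow> 'k) \<Rightarrow> 'k) list \<Rightarrow> (('k ^ 2 ^ 2 \<Rightarrow> 'k) \<Rightarrow> 'k)) \<Rightarrow>
     ((('k ^ 2 ^ 2 \<Rightarrow> 'k) \<Rightarrow> 'k) list \<Rightarrow> (('k ^ 2 ^ 2 \<Rightarrow> 'k) \<Rightarrow> 'k))" where
  "cochain_action B t =
     hoch_conj (dist_frob_kernel B) (adjoint_action B t) (adjoint_action B (matrix_inv t))"

text \<open>
  A distribution \<open>\<tau>\<close> on \<open>T\<close> acts on a rational \<open>T\<close>-module by \<open>\<tau> m = (id \<otimes> \<tau>)(\<Delta> m)\<close>, i.e. by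
  applying \<open>\<tau>\<close> to the matrix coefficients \<open>t \<mapsto> \<lambda>(t m)\<close>. The infinitesimal group scheme \<open>T\<^sub>1\<close>
  acts trivially if and only if every \<open>\<tau>\<close> in \<open>Dist(T\<^sub>1)\<close> acts by the scalar \<open>\<tau>(1)\<close>.
\<close>

definition cochain_dist_action ::
    "('k::field ^ 2 ^ 2) set \<Rightarrow> ('k ^ 2 ^ 2) set \<Rightarrow> (('k ^ 2 ^ 2 \<Rightarrow> 'k) \<Rightarrow> 'k) \<Rightarrow>
     ((('k ^ 2 ^ 2 \<Rightarrow> 'k) \<Rightarrow> 'k) list \<Rightarrow> (('k ^ 2 ^ 2 \<Rightarrow> 'k) \<Rightarrow> 'k)) \<Rightarrow>
     ((('k ^ 2 ^ 2 \<Rightarrow> 'k) \<Rightarrow> 'k) list \<Rightarrow> (('k ^ 2 ^ 2 \<Rightarrow> 'k) \<Rightarrow> 'k))" where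
  "cochain_dist_action T B \<tau> z as f = \<tau> (restr T (\<lambda>t. cochain_action B t z as f))"

definition HH_action ::
    "('k::field ^ 2 ^ 2) set \<Rightarrow> 'k ^ 2 ^ 2 \<Rightarrow>
     ((('k ^ 2 ^ 2 \<Rightarrow> 'k) \<Rightarrow> 'k) list \<Rightarrow> (('k ^ 2 ^ 2 \<Rightarrow> 'k) \<Rightarrow> 'k)) set \<Rightarrow>
     ((('k ^ 2 ^ 2 \<Rightarrow> 'k) \<Rightarrow> 'k) list \<Rightarrow> (('k ^ 2 ^ 2 \<Rightarrow> 'k) \<Rightarrow> 'k)) set" where
  "HH_action B t = hoch_induced (dist_frob_kernel B) (cochain_action B t)"

definition frob_kernel_acts_trivially ::
    "('k::field ^ 2 ^ 2) set \<Rightarrow> ('k ^ 2 ^ 2) set \<Rightarrow> bool" where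
  "frob_kernel_acts_trivially T B \<longleftrightarrow>
     (\<forall>\<tau>\<in>carrier (dist_frob_kernel T). \<forall>\<xi>\<in>carrier (HH (dist_frob_kernel B)).
        hoch_induced (dist_frob_kernel B) (cochain_dist_action T B \<tau>) \<xi>
          = \<tau> (restr T (\<lambda>_. 1)) \<odot>\<^bsub>HH (dist_frob_kernel B)\<^esub> \<xi>)"


section \<open>The symmetric algebra of a dual space, tensored with an exterior algebra\<close>

text \<open>
  For a finite-dimensional \<open>V\<close> over an infinite field, the symmetric algebra \<open>S(V\<^sup>*)\<close> is the
  algebra of polynomial functions on \<open>V\<close>, the algebra of functions on \<open>V\<close> generated by \<open>V\<^sup>*\<close>.
\<close>

definition sym_dual :: "('d \<Rightarrow> 'k::field) set \<Rightarrow> (('d \<Rightarrow> 'k) \<Rightarrow> 'k) set" where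
  "sym_dual V = function_algebra V (dual_space V)"

definition sym_dual_degree :: "('d \<Rightarrow> 'k::field) set \<Rightarrow> nat \<Rightarrow> (('d \<Rightarrow> 'k) \<Rightarrow> 'k) set" where
  "sym_dual_degree V n = {P \<in> sym_dual V. \<forall>c. \<forall>X\<in>V. P (\<lambda>d. c * X d) = c ^ n * P X}"

text \<open>
  \<open>S(V\<^sup>*) \<otimes> \<Lambda>(x)\<close> is a free \<open>S(V\<^sup>*)\<close>-module with basis \<open>1, x\<close>, and \<open>x\<^sup>2 = 0\<close>; the pair \<open>(P, Q)\<close>
  stands for \<open>P \<otimes> 1 + Q \<otimes> x\<close>. As \<open>S(V\<^sup>*)\<close> sits in even degrees, the product has no signs.
\<close>

definition sym_ext ::
    "('d \<Rightarrow> 'k::field) set \<Rightarrow> ('k, (('d \<Rightarrow> 'k) \<Rightarrow> 'k) \<times> (('d \<Rightarrow> 'k) \<Rightarrow> 'k)) module" where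
  "sym_ext V =
     \<lparr>carrier = sym_dual V \<times> sym_dual V,
      mult = (\<lambda>(P, Q) (P', Q'). (\<lambda>X. P X * P' X, \<lambda>X. P X * Q' X + Q X * P' X)),
      one = (restr V (\<lambda>_. 1), \<lambda>_. 0),
      zero = (\<lambda>_. 0, \<lambda>_. 0),
      add = (\<lambda>(P, Q) (P', Q'). (\<lambda>X. P X + P' X, \<lambda>X. Q X + Q' X)),
      smult = (\<lambda>c (P, Q). (\<lambda>X. c * P X, \<lambda>X. c * Q X))\<rparr>"

text \<open>The grading with \<open>V\<^sup>*\<close> in degree 2 and \<open>x\<close> in degree 1.\<close>

definition sym_ext_degree ::
    "('d \<Rightarrow> 'k::field) set \<Rightarrow> nat \<Rightarrow> ((('d \<Rightarrow> 'k) \<Rightarrow> 'k) \<times> (('d \<Rightarrow> 'k) \<Rightarrow> 'k)) set" where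
  "sym_ext_degree V n =
     (if even n then sym_dual_degree V (n div 2) \<times> {\<lambda>_. 0}
      else {\<lambda>_. 0} \<times> sym_dual_degree V (n div 2))"

text \<open>
  The action on \<open>S(u\<^sup>*) \<otimes> \<Lambda>(x)\<close>, with \<open>u\<close> the Lie algebra of \<open>U\<close> and \<open>x\<close> of weight 0. The
  Frobenius twist of this action is obtained by inserting \<open>F(t)\<close> for \<open>t\<close>.
\<close>

definition sym_ext_action ::
    "('k::field ^ 2 ^ 2) set \<Rightarrow> 'k ^ 2 ^ 2 \<Rightarrow>
     ((('k ^ 2 ^ 2 \<Rightarrow> 'k) \<Rightarrow> 'k) \<Rightarrow> 'k) \<times> ((('k ^ 2 ^ 2 \<Rightarrow> 'k) \<Rightarrow> 'k) \<Rightarrow> 'k) \<Rightarrow>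
     ((('k ^ 2 ^ 2 \<Rightarrow> 'k) \<Rightarrow> 'k) \<Rightarrow> 'k) \<times> ((('k ^ 2 ^ 2 \<Rightarrow> 'k) \<Rightarrow> 'k) \<Rightarrow> 'k)" where
  "sym_ext_action U t = (\<lambda>(P, Q).
     (restr (lie_algebra U) (\<lambda>X. P (adjoint_action U (matrix_inv t) X)),
      restr (lie_algebra U) (\<lambda>X. Q (adjoint_action U (matrix_inv t) X))))"

end

theory Submission
  imports Defs "HOL-Number_Theory.Cong"
begin

text \<open>
  Write an element of \<open>B\<close> as a lower triangular matrix with entries \<open>a\<close>, \<open>c\<close>, \<open>a\<^sup>-\<^sup>1\<close>. The dual of
  \<open>k[B\<^sub>1] = k[a, c] / (a\<^sup>p - 1, c\<^sup>p)\<close> is the path algebra of the cyclic quiver with \<open>p\<close> vertices, truncated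
  at paths of length \<open>p\<close>: the vertices are the idempotents of \<open>Dist(T\<^sub>1)\<close>, and the arrows come from
  \<open>Lie U\<close>. As the closed paths of length \<open>p\<close> are central in the path algebra without relations, the
  Hochschild complex is periodic: for a cocycle \<open>f\<close> there are explicit \<open>b\<close> and \<open>\<Theta> f\<close>, the latter of
  degree lower by 2, with \<open>f = db + w \<union> \<Theta> f\<close> in degrees at least 2, where \<open>w\<close> is the cocycle of the
  extension by the paths of length between \<open>p\<close> and \<open>2 p\<close>. In degree 0 only the scalars remain and in
  degree 1 only the multiples of the derivation \<open>x\<close> that counts the passages through one fixed arrow,
  so the classes of \<open>w\<^sup>m\<close> and \<open>w\<^sup>m \<union> x\<close> form a basis. The cocycle \<open>w\<close> lowers the path length by \<open>p\<close>,
  hence the torus acts on it through the Frobenius twist of the positive root; \<open>x\<close> has weight 0.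
\<close>

section \<open>The bar differential and the cup product\<close>

text \<open>What makes the periodicity computable is that \<open>period\<close> is a chain map and a
  strict left inverse of the product with w. A class can thus be read off without comparing
  resolutions: iterate \<open>period\<close>, apply the functionals \<open>chi0\<close> and
  \<open>chi1\<close>, and collect the values as coefficients of two polynomials, one for 1 and one
  for x. The product formula then needs an induction on the left factor only. Triviality of the
  T_1-action is a statement about representatives, since a distribution is applied to the matrix
  coefficients of a cochain. The torus action is therefore expanded into powers of r, the weight of
  an arrow. A distribution on T_1 has a known value on the powers r^(-p m); a cocycle involving only
  these differs from the given one by a coboundary, and the other powers stay inside coboundaries.
  The conjugating matrix g need not be fixed by Frobenius. Stability of T and B under F leaves a
  nonzero constant \<open>\<kappa>\<close> in the formula for F, which is harmless because it only
  rescales c^p, and c^p is zero on B_1. An arrow changes the weight by 2, so the numbering of the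
  idempotents of T_1 by vertices uses that 2 is invertible modulo p.\<close>

fun merge_head :: "('a::ring list \<Rightarrow> 'a) \<Rightarrow> 'a \<Rightarrow> 'a list \<Rightarrow> 'a" where
  "merge_head f a [] = f [] * a"
| "merge_head f a (b # l) = f (a * b # l)"

text \<open>The bar differential without its first term, that is, the differential for the zero left
  action. In this form its properties follow by recursion on the list.\<close>

fun right_diff :: "('a::ring list \<Rightarrow> 'a) \<Rightarrow> 'a list \<Rightarrow> 'a" where
  "right_diff f [] = 0"
| "right_diff f (a # l) = - merge_head f a l - right_diff (\<lambda>l. f (a # l)) l"

fun left_diff :: "('a::ring list \<Rightarrow> 'a) \<Rightarrow> 'a list \<Rightarrow> 'a" where
  "left_diff f [] = 0"
| "left_diff f (a # l) = a * f l"

definition bar_diff :: "('a::ring list \<Rightarrow> 'a) \<Rightarrow> 'a list \<Rightarrow> 'a" where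
  "bar_diff f l = left_diff f l + right_diff f l"

fun cup :: "('a::ring list \<Rightarrow> 'a) \<Rightarrow> ('a list \<Rightarrow> 'a) \<Rightarrow> 'a list \<Rightarrow> 'a" where
  "cup f g [] = f [] * g []"
| "cup f g (a # l) = f [] * g (a # l) + cup (\<lambda>l. f (a # l)) g l"

text \<open>The Koszul sign of the Leibniz rule. Cochains are not homogeneous, so the sign is taken
  separately on lists of each length.\<close>

definition sgn_twist :: "('a::ring list \<Rightarrow> 'a) \<Rightarrow> 'a list \<Rightarrow> 'a" where
  "sgn_twist f l = (if even (length l) then f l else - f l)"

lemma bar_diff_Nil [simp]: "bar_diff f [] = 0"
  by (simp add: bar_diff_def)

lemma bar_diff_Cons:
  "bar_diff f (a # l) = a * f l - merge_head f a l - right_diff (\<lambda>l. f (a # l)) l"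
  by (simp add: bar_diff_def)

lemma merge_head_add: "merge_head (\<lambda>l. f l + g l) a l = merge_head f a l + merge_head g a l"
  by (cases l) (auto simp: algebra_simps)

lemma merge_head_minus: "merge_head (\<lambda>l. - f l) a l = - merge_head f a l"
  by (cases l) auto

lemma merge_head_mult: "merge_head (\<lambda>l. c * f l) a l = c * merge_head f a l"
  by (cases l) (auto simp: mult.assoc)

lemma right_diff_add: "right_diff (\<lambda>l. f l + g l) l = right_diff f l + right_diff g l"
  by (induction l arbitrary: f g) (auto simp: merge_head_add)

lemma right_diff_minus: "right_diff (\<lambda>l. - f l) l = - right_diff f l"
  by (induction l arbitrary: f) (auto simp: merge_head_minus)

lemma right_diff_diff: "right_diff (\<lambda>l. f l - g l) l = right_diff f l - right_diff g l"
  using right_diff_add[of f "\<lambda>l. - g l" l] by (simp add: right_diff_minus)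

lemma right_diff_mult: "right_diff (\<lambda>l. c * f l) l = c * right_diff f l"
  by (induction l arbitrary: f) (auto simp: merge_head_mult algebra_simps)

lemma right_diff_zero [simp]: "right_diff (\<lambda>l. 0) l = 0"
  using right_diff_add[of "\<lambda>l. 0" "\<lambda>l. 0" l] by simp

lemma right_diff_sum: "right_diff (\<lambda>l. \<Sum>i\<in>I. f i l) l = (\<Sum>i\<in>I. right_diff (f i) l)"
  by (induction I rule: infinite_finite_induct) (auto simp: right_diff_add)

lemma bar_diff_add: "bar_diff (\<lambda>l. f l + g l) l = bar_diff f l + bar_diff g l"
  by (cases l) (auto simp: bar_diff_def right_diff_add merge_head_add algebra_simps)

lemma bar_diff_minus: "bar_diff (\<lambda>l. - f l) l = - bar_diff f l"
  by (cases l) (auto simp: bar_diff_def right_diff_minus merge_head_minus algebra_simps)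

lemma bar_diff_diff: "bar_diff (\<lambda>l. f l - g l) l = bar_diff f l - bar_diff g l"
  using bar_diff_add[of f "\<lambda>l. - g l" l] by (simp add: bar_diff_minus)

lemma bar_diff_zero [simp]: "bar_diff (\<lambda>l. 0) l = 0"
  using bar_diff_add[of "\<lambda>l. 0" "\<lambda>l. 0" l] by simp

lemma bar_diff_sum: "bar_diff (\<lambda>l. \<Sum>i\<in>I. f i l) l = (\<Sum>i\<in>I. bar_diff (f i) l)"
  by (induction I rule: infinite_finite_induct) (auto simp: bar_diff_add)

text \<open>Associativity of the product: whether \<open>a\<close> is fused with \<open>b\<close>
  before or after the next fusion makes no difference.\<close>

lemma right_diff_merge_head:
  "right_diff (merge_head f a) (b # l) = right_diff f (a * b # l)"
  by (cases l) (auto simp: mult.assoc)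

text \<open>Peeling off the head \<open>a\<close> leaves the double differential of
  \<open>f (a # _)\<close>, zero by induction, and two terms in which \<open>a\<close> is fused with
  its neighbour. The latter cancel by \<open>right_diff_merge_head\<close>.\<close>

lemma right_diff_right_diff: "right_diff (right_diff f) l = 0"
proof (induction l arbitrary: f)
  case (Cons a l)
  have "right_diff (\<lambda>l. right_diff f (a # l)) l = - right_diff (merge_head f a) l"
    using Cons by (simp add: right_diff_diff right_diff_minus)
  then show ?case
    by (cases l) (simp_all add: right_diff_merge_head del: right_diff.simps(2), simp_all)
qed simp

text \<open>The mixed terms of the squared differential: they cancel because the left action
  satisfies (a b) f = a (b f).\<close>

lemma right_diff_left_diff:
  "right_diff (left_diff f) l + left_diff (left_diff f) l + left_diff (right_diff f) l = 0"
proof (cases l)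
  case (Cons a m)
  then show ?thesis
    by (cases m) (simp_all add: right_diff_mult mult.assoc del: right_diff.simps(2),
      simp_all add: right_diff_mult mult.assoc)
qed simp

lemma bar_diff_bar_diff: "bar_diff (bar_diff f) l = 0"
proof -
  have "right_diff (bar_diff f) l = right_diff (left_diff f) l"
    using right_diff_add[of "left_diff f" "right_diff f" l]
    by (simp add: bar_diff_def[abs_def] right_diff_right_diff)
  moreover have "left_diff (bar_diff f) l = left_diff (left_diff f) l + left_diff (right_diff f) l"
    by (cases l) (auto simp: bar_diff_def algebra_simps)
  ultimately show ?thesis
    using right_diff_left_diff[of f l] unfolding bar_diff_def[of "bar_diff f"]
    by (simp add: algebra_simps)
qed

section \<open>The Leibniz rule for the cup product\<close>

lemma cup_add_left: "cup (\<lambda>l. f l + f' l) g l = cup f g l + cup f' g l"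
  by (induction l arbitrary: f f') (auto simp: algebra_simps)

lemma cup_minus_left: "cup (\<lambda>l. - f l) g l = - cup f g l"
  by (induction l arbitrary: f) (auto simp: algebra_simps)

lemma cup_diff_left: "cup (\<lambda>l. f l - f' l) g l = cup f g l - cup f' g l"
  using cup_add_left[of f "\<lambda>l. - f' l" g l] by (simp add: cup_minus_left)

lemma cup_mult_left: "cup (\<lambda>l. c * f l) g l = c * cup f g l"
  by (induction l arbitrary: f) (auto simp: algebra_simps)

lemma cup_zero_left [simp]: "cup (\<lambda>l. 0) g l = 0"
  by (induction l) auto

lemma cup_zero_right [simp]: "cup f (\<lambda>l. 0) l = 0"
  by (induction l arbitrary: f) auto

text \<open>At the cut between prefix and suffix an element can be absorbed by the value of
  \<open>f\<close> from the right, or act on the value of \<open>g\<close> from the left. These two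
  terms cancel, which is why the full \<open>bar_diff\<close> of \<open>g\<close> appears next to a
  mere \<open>right_diff\<close> of \<open>f\<close>.\<close>

lemma right_diff_cup:
  "right_diff (cup f g) l = cup (right_diff f) g l + cup (sgn_twist f) (bar_diff g) l"
proof (induction l arbitrary: f)
  case Nil
  then show ?case by (simp add: sgn_twist_def)
next
  case (Cons a l)
  have tw: "(\<lambda>l. sgn_twist f (a # l)) = (\<lambda>l. - sgn_twist (\<lambda>l. f (a # l)) l)"
    by (auto simp: sgn_twist_def)
  have mh: "merge_head (cup f g) a l = cup (merge_head f a) g l - f [] * a * g l + f [] * merge_head g a l"
    by (cases l) (auto simp: algebra_simps)
  show ?case
    using Cons[of "\<lambda>l. f (a # l)"]
    by (simp add: tw mh right_diff_add right_diff_mult cup_diff_left cup_minus_left bar_diff_Cons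
        sgn_twist_def[of f "[]"] algebra_simps)
qed

lemma bar_diff_cup:
  "bar_diff (cup f g) l = cup (bar_diff f) g l + cup (sgn_twist f) (bar_diff g) l"
proof -
  have bar_diff_eq: "(\<lambda>l. left_diff f l + right_diff f l) = bar_diff f"
    by (auto simp: bar_diff_def)
  have "left_diff (cup f g) l = cup (left_diff f) g l"
    by (cases l) (auto simp: cup_mult_left)
  then show ?thesis
    by (simp add: bar_diff_def[of "cup f g"] right_diff_cup cup_add_left add.assoc flip: bar_diff_eq)
qed

section \<open>Multilinear cochains\<close>

locale scaled_ring =
  fixes sc :: "'k::field \<Rightarrow> 'a::{ring, monoid_mult} \<Rightarrow> 'a"
  assumes sc_add_right: "sc c (x + y) = sc c x + sc c y"
    and sc_add_left: "sc (c + d) x = sc c x + sc d x"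
    and sc_sc: "sc c (sc d x) = sc (c * d) x"
    and sc_one [simp]: "sc 1 x = x"
    and sc_mult_left: "sc c x * y = sc c (x * y)"
    and sc_mult_right: "x * sc c y = sc c (x * y)"
begin

lemma sc_zero_left [simp]: "sc 0 x = 0"
  using sc_add_left[of 0 0 x] by simp

lemma sc_zero_right [simp]: "sc c 0 = 0"
  using sc_add_right[of c 0 0] by simp

lemma sc_minus_right: "sc c (- x) = - sc c x"
  using sc_add_right[of c x "- x"] by (simp add: minus_unique)

lemma sc_minus_left: "sc (- c) x = - sc c x"
  using sc_add_left[of c "- c" x] by (simp add: minus_unique)

lemma sc_diff_right: "sc c (x - y) = sc c x - sc c y"
  using sc_add_right[of c x "- y"] by (simp add: sc_minus_right)

lemma sc_diff_left: "sc (c - d) x = sc c x - sc d x"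
  using sc_add_left[of c "- d" x] by (simp add: sc_minus_left)

lemma sc_sum_right: "sc c (\<Sum>i\<in>I. f i) = (\<Sum>i\<in>I. sc c (f i))"
  by (induction I rule: infinite_finite_induct) (auto simp: sc_add_right)

lemma sc_sum_left: "sc (\<Sum>i\<in>I. f i) x = (\<Sum>i\<in>I. sc (f i) x)"
  by (induction I rule: infinite_finite_induct) (auto simp: sc_add_left)

definition lin :: "('a \<Rightarrow> 'a) \<Rightarrow> bool" where
  "lin \<phi> \<longleftrightarrow> (\<forall>x y. \<phi> (x + y) = \<phi> x + \<phi> y) \<and> (\<forall>c x. \<phi> (sc c x) = sc c (\<phi> x))"

lemma linI:
  assumes "\<And>x y. \<phi> (x + y) = \<phi> x + \<phi> y" and "\<And>c x. \<phi> (sc c x) = sc c (\<phi> x)"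
  shows "lin \<phi>"
  using assms by (simp add: lin_def)

lemma lin_add: "lin \<phi> \<Longrightarrow> \<phi> (x + y) = \<phi> x + \<phi> y"
  and lin_sc: "lin \<phi> \<Longrightarrow> \<phi> (sc c x) = sc c (\<phi> x)"
  by (auto simp: lin_def)

lemma lin_zero: "lin \<phi> \<Longrightarrow> \<phi> 0 = 0"
  using lin_add[of \<phi> 0 0] by simp

lemma lin_sum: "lin \<phi> \<Longrightarrow> \<phi> (\<Sum>i\<in>I. f i) = (\<Sum>i\<in>I. \<phi> (f i))"
  by (induction I rule: infinite_finite_induct) (auto simp: lin_add lin_zero)

definition multilin :: "('a list \<Rightarrow> 'a) \<Rightarrow> bool" where
  "multilin f \<longleftrightarrow> (\<forall>as bs. lin (\<lambda>x. f (as @ x # bs)))"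

definition bounded_len :: "nat \<Rightarrow> ('a list \<Rightarrow> 'a) \<Rightarrow> bool" where
  "bounded_len N f \<longleftrightarrow> (\<forall>as. N \<le> length as \<longrightarrow> f as = 0)"

definition cochain :: "('a list \<Rightarrow> 'a) \<Rightarrow> bool" where
  "cochain f \<longleftrightarrow> multilin f \<and> (\<exists>N. bounded_len N f)"

definition cocycle :: "('a list \<Rightarrow> 'a) \<Rightarrow> bool" where
  "cocycle f \<longleftrightarrow> cochain f \<and> (\<forall>as. bar_diff f as = 0)"

definition coboundary :: "('a list \<Rightarrow> 'a) \<Rightarrow> bool" where
  "coboundary f \<longleftrightarrow> (\<exists>g. cochain g \<and> f = bar_diff g)"

lemma multilinD: "multilin f \<Longrightarrow> lin (\<lambda>x. f (as @ x # bs))"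
  by (simp add: multilin_def)

lemma multilin_head: "multilin f \<Longrightarrow> lin (\<lambda>x. f (x # l))"
  using multilinD[of f "[]" l] by simp

lemma multilin_Cons_add: "multilin f \<Longrightarrow> f ((x + y) # l) = f (x # l) + f (y # l)"
  and multilin_Cons_sc: "multilin f \<Longrightarrow> f (sc c x # l) = sc c (f (x # l))"
  using multilin_head[of f l] by (auto simp: lin_def)

lemma multilin_snd: "multilin f \<Longrightarrow> lin (\<lambda>x. f (a # x # l))"
  using multilinD[of f "[a]" l] by simp

lemma multilin_Cons: "multilin f \<Longrightarrow> multilin (\<lambda>l. f (a # l))"
  using multilinD[of f "a # as" for as] by (simp add: multilin_def)

lemma multilinI:
  assumes "\<And>l. lin (\<lambda>x. f (x # l))" and "\<And>a. multilin (\<lambda>l. f (a # l))"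
  shows "multilin f"
  unfolding multilin_def
proof (intro allI)
  fix as bs show "lin (\<lambda>x. f (as @ x # bs))"
    using assms by (cases as) (auto simp: multilin_def)
qed

lemma lin_zero_fun: "lin (\<lambda>x. 0)"
  and lin_plus: "lin \<phi> \<Longrightarrow> lin \<psi> \<Longrightarrow> lin (\<lambda>x. \<phi> x + \<psi> x)"
  and lin_uminus: "lin \<phi> \<Longrightarrow> lin (\<lambda>x. - \<phi> x)"
  and lin_minus: "lin \<phi> \<Longrightarrow> lin \<psi> \<Longrightarrow> lin (\<lambda>x. \<phi> x - \<psi> x)"
  and lin_scale: "lin \<phi> \<Longrightarrow> lin (\<lambda>x. sc c (\<phi> x))"
  and lin_mult_left: "lin \<phi> \<Longrightarrow> lin (\<lambda>x. a * \<phi> x)"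
  and lin_mult_right: "lin \<phi> \<Longrightarrow> lin (\<lambda>x. \<phi> x * a)"
  and lin_id: "lin (\<lambda>x. x)"
  by (auto simp: lin_def sc_add_right sc_sc sc_mult_left sc_mult_right sc_minus_right
      sc_diff_right algebra_simps)

lemma lin_compose: "lin \<phi> \<Longrightarrow> lin \<psi> \<Longrightarrow> lin (\<lambda>x. \<phi> (\<psi> x))"
  by (auto simp: lin_def)

lemma lin_Sum: "(\<And>i. i \<in> I \<Longrightarrow> lin (\<phi> i)) \<Longrightarrow> lin (\<lambda>x. \<Sum>i\<in>I. \<phi> i x)"
  by (induction I rule: infinite_finite_induct) (auto intro: lin_zero_fun lin_plus)

lemmas lin_intros = lin_zero_fun lin_plus lin_uminus lin_minus lin_scale lin_mult_left
  lin_mult_right lin_id lin_Sum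

lemma multilin_zero: "multilin (\<lambda>l. 0)"
  and multilin_plus: "multilin f \<Longrightarrow> multilin g \<Longrightarrow> multilin (\<lambda>l. f l + g l)"
  and multilin_uminus: "multilin f \<Longrightarrow> multilin (\<lambda>l. - f l)"
  and multilin_minus: "multilin f \<Longrightarrow> multilin g \<Longrightarrow> multilin (\<lambda>l. f l - g l)"
  and multilin_scale: "multilin f \<Longrightarrow> multilin (\<lambda>l. sc c (f l))"
  and multilin_mult_left: "multilin f \<Longrightarrow> multilin (\<lambda>l. a * f l)"
  and multilin_mult_right: "multilin f \<Longrightarrow> multilin (\<lambda>l. f l * a)"
  by (auto simp: multilin_def intro!: lin_intros)

lemma multilin_Sum: "(\<And>i. i \<in> I \<Longrightarrow> multilin (f i)) \<Longrightarrow> multilin (\<lambda>l. \<Sum>i\<in>I. f i l)"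
  by (auto simp: multilin_def intro!: lin_intros)

lemmas multilin_intros = multilin_zero multilin_plus multilin_uminus multilin_minus
  multilin_scale multilin_mult_left multilin_mult_right multilin_Sum

lemma multilin_merge_head: "multilin f \<Longrightarrow> multilin (merge_head f a)"
  by (rule multilinI)
    (auto intro: lin_compose[OF multilin_head lin_mult_left[OF lin_id]] multilin_Cons)

lemma lin_merge_head: "multilin f \<Longrightarrow> lin (\<lambda>x. merge_head f x l)"
  by (cases l) (auto intro!: lin_intros lin_compose[OF multilin_head lin_mult_right[OF lin_id]])

lemma sc_right_diff: "right_diff (\<lambda>l. sc c (f l)) l = sc c (right_diff f l)"
proof (induction l arbitrary: f)
  case (Cons a l)
  have "merge_head (\<lambda>l. sc c (f l)) a l = sc c (merge_head f a l)"
    by (cases l) (auto simp: sc_mult_left)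
  then show ?case using Cons by (simp add: sc_diff_right sc_minus_right)
qed simp

lemma sc_bar_diff: "bar_diff (\<lambda>l. sc c (f l)) l = sc c (bar_diff f l)"
  by (cases l) (auto simp: bar_diff_def sc_right_diff sc_mult_right sc_add_right
      simp del: right_diff.simps(2))

lemma multilin_right_diff:
  assumes "multilin f" shows "multilin (right_diff f)"
  unfolding multilin_def
proof (intro allI)
  fix as bs show "lin (\<lambda>x. right_diff f (as @ x # bs))"
    using assms
  proof (induction as arbitrary: f)
    case Nil
    have "lin (\<lambda>x. right_diff (\<lambda>l. f (x # l)) bs)"
      by (intro linI) (simp_all add: multilin_Cons_add[OF Nil] multilin_Cons_sc[OF Nil]
          right_diff_add sc_right_diff)
    then show ?case using Nil by (auto intro!: lin_intros lin_merge_head)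
  next
    case (Cons a as)
    have "lin (\<lambda>x. merge_head f a (as @ x # bs))"
      using multilin_merge_head[OF Cons.prems] by (simp add: multilin_def)
    then show ?case
      using Cons multilin_Cons[OF Cons.prems] by (auto intro!: lin_intros)
  qed
qed

lemma multilin_left_diff: "multilin f \<Longrightarrow> multilin (left_diff f)"
  by (rule multilinI) (auto intro: lin_intros multilin_intros)

lemma multilin_bar_diff: "multilin f \<Longrightarrow> multilin (bar_diff f)"
  unfolding bar_diff_def[abs_def] by (intro multilin_plus multilin_left_diff multilin_right_diff)

lemma sc_cup_left: "cup (\<lambda>l. sc c (f l)) g l = sc c (cup f g l)"
  by (induction l arbitrary: f) (auto simp: sc_add_right sc_mult_left)

lemma multilin_cup:
  assumes "multilin f" and g: "multilin g" shows "multilin (cup f g)"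
  unfolding multilin_def
proof (intro allI)
  fix as bs show "lin (\<lambda>x. cup f g (as @ x # bs))"
    using assms(1)
  proof (induction as arbitrary: f)
    case Nil
    have "lin (\<lambda>x. cup (\<lambda>l. f (x # l)) g bs)"
      by (intro linI) (simp_all add: multilin_Cons_add[OF Nil] multilin_Cons_sc[OF Nil]
          cup_add_left sc_cup_left)
    then show ?case using multilin_head[OF g] by (auto intro!: lin_intros)
  next
    case (Cons a as)
    then show ?case
      using multilin_Cons[OF Cons.prems] g multilin_Cons[OF g, of a, unfolded multilin_def]
      by (auto intro!: lin_intros)
  qed
qed

lemma bounded_len_Cons: "bounded_len N f \<Longrightarrow> bounded_len (N - 1) (\<lambda>l. f (a # l))"
  by (auto simp: bounded_len_def)

lemma bounded_len_right_diff: "bounded_len N f \<Longrightarrow> bounded_len (Suc N) (right_diff f)"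
  unfolding bounded_len_def[of "Suc N"]
proof (intro allI impI)
  fix l :: "'a list" assume "bounded_len N f" "Suc N \<le> length l"
  then show "right_diff f l = 0"
  proof (induction l arbitrary: f N)
    case (Cons a l)
    have "right_diff (\<lambda>l. f (a # l)) l = 0"
    proof (cases l)
      case (Cons b m)
      show ?thesis
        by (rule Cons.IH[OF bounded_len_Cons[OF Cons.prems(1)]]) (use Cons Cons.prems in auto)
    qed simp
    moreover have "merge_head f a l = 0"
      using Cons.prems by (cases l) (auto simp: bounded_len_def)
    ultimately show ?case by simp
  qed simp
qed

lemma bounded_len_left_diff: "bounded_len N f \<Longrightarrow> bounded_len (Suc N) (left_diff f)"
  unfolding bounded_len_def
proof (intro allI impI)
  fix l :: "'a list" assume "\<forall>as. N \<le> length as \<longrightarrow> f as = 0" "Suc N \<le> length l"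
  then show "left_diff f l = 0" by (cases l) auto
qed

lemma bounded_len_bar_diff: "bounded_len N f \<Longrightarrow> bounded_len (Suc N) (bar_diff f)"
  using bounded_len_left_diff[of N f] bounded_len_right_diff[of N f]
  by (auto simp: bounded_len_def bar_diff_def)

lemma bounded_len_cup:
  assumes "bounded_len N f" and "bounded_len M g" shows "bounded_len (N + M) (cup f g)"
  unfolding bounded_len_def
proof (intro allI impI)
  fix l :: "'a list" assume "N + M \<le> length l"
  then show "cup f g l = 0"
    using assms(1)
  proof (induction l arbitrary: f N)
    case Nil
    then show ?case using assms by (auto simp: bounded_len_def)
  next
    case (Cons a l)
    have "f [] * g (a # l) = 0"
      using Cons.prems assms(2) by (cases N) (auto simp: bounded_len_def)
    moreover have "cup (\<lambda>l. f (a # l)) g l = 0"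
    proof (cases N)
      case 0
      then have "(\<lambda>l. f (a # l)) = (\<lambda>l. 0)" using Cons.prems by (auto simp: bounded_len_def)
      then show ?thesis by simp
    next
      case (Suc n)
      show ?thesis
        by (rule Cons.IH[OF _ bounded_len_Cons[OF Cons.prems(2)]]) (use Suc Cons.prems in auto)
    qed
    ultimately show ?case by simp
  qed
qed

lemma cochain_zero: "cochain (\<lambda>l. 0)"
  by (auto simp: cochain_def multilin_zero bounded_len_def)

lemma cochain_plus: "cochain f \<Longrightarrow> cochain g \<Longrightarrow> cochain (\<lambda>l. f l + g l)"
proof -
  assume "cochain f" "cochain g"
  then obtain N M where "multilin f" "multilin g" "bounded_len N f" "bounded_len M g"
    by (auto simp: cochain_def)
  then have "bounded_len (max N M) (\<lambda>l. f l + g l)" "multilin (\<lambda>l. f l + g l)"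
    by (auto simp: bounded_len_def multilin_plus)
  then show ?thesis by (auto simp: cochain_def)
qed

lemma cochain_uminus: "cochain f \<Longrightarrow> cochain (\<lambda>l. - f l)"
  by (auto simp: cochain_def multilin_uminus bounded_len_def)

lemma cochain_minus: "cochain f \<Longrightarrow> cochain g \<Longrightarrow> cochain (\<lambda>l. f l - g l)"
  using cochain_plus[of f "\<lambda>l. - g l"] by (simp add: cochain_uminus)

lemma cochain_scale: "cochain f \<Longrightarrow> cochain (\<lambda>l. sc c (f l))"
  by (auto simp: cochain_def multilin_scale bounded_len_def) (metis sc_zero_right)

lemma cochain_Sum: "(\<And>i. i \<in> I \<Longrightarrow> cochain (f i)) \<Longrightarrow> cochain (\<lambda>l. \<Sum>i\<in>I. f i l)"
  by (induction I rule: infinite_finite_induct) (auto intro: cochain_zero cochain_plus)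

lemma cochain_bar_diff: "cochain f \<Longrightarrow> cochain (bar_diff f)"
  by (auto simp: cochain_def intro: multilin_bar_diff bounded_len_bar_diff)

lemma cochain_cup: "cochain f \<Longrightarrow> cochain g \<Longrightarrow> cochain (cup f g)"
  by (auto simp: cochain_def intro: multilin_cup bounded_len_cup)

section \<open>Cocycles and coboundaries\<close>

lemma cocycle_zero: "cocycle (\<lambda>l. 0)"
  and cocycle_plus: "cocycle f \<Longrightarrow> cocycle g \<Longrightarrow> cocycle (\<lambda>l. f l + g l)"
  and cocycle_minus: "cocycle f \<Longrightarrow> cocycle g \<Longrightarrow> cocycle (\<lambda>l. f l - g l)"
  and cocycle_scale: "cocycle f \<Longrightarrow> cocycle (\<lambda>l. sc c (f l))"
  by (auto simp: cocycle_def cochain_zero cochain_plus cochain_minus cochain_scale bar_diff_add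
      bar_diff_diff sc_bar_diff)

lemma coboundary_cocycle: "coboundary f \<Longrightarrow> cocycle f"
  by (auto simp: coboundary_def cocycle_def cochain_bar_diff bar_diff_bar_diff)

lemma coboundary_bar_diff: "cochain b \<Longrightarrow> coboundary (bar_diff b)"
  by (auto simp: coboundary_def)

lemma coboundary_zero: "coboundary (\<lambda>l. 0)"
  unfolding coboundary_def by (rule exI[of _ "\<lambda>l. 0"]) (auto simp: cochain_zero)

lemma coboundary_plus: "coboundary f \<Longrightarrow> coboundary g \<Longrightarrow> coboundary (\<lambda>l. f l + g l)"
proof -
  assume "coboundary f" "coboundary g"
  then obtain b c where "cochain b" "cochain c" "f = bar_diff b" "g = bar_diff c"
    by (auto simp: coboundary_def)
  then show ?thesis
    unfolding coboundary_def
    by (intro exI[of _ "\<lambda>l. b l + c l"]) (auto simp: cochain_plus bar_diff_add)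
qed

lemma coboundary_scale: "coboundary f \<Longrightarrow> coboundary (\<lambda>l. sc c (f l))"
proof -
  assume "coboundary f"
  then obtain b where "cochain b" "f = bar_diff b"
    by (auto simp: coboundary_def)
  then show ?thesis
    unfolding coboundary_def
    by (intro exI[of _ "\<lambda>l. sc c (b l)"]) (auto simp: cochain_scale sc_bar_diff)
qed

lemma coboundary_minus: "coboundary f \<Longrightarrow> coboundary g \<Longrightarrow> coboundary (\<lambda>l. f l - g l)"
  using coboundary_plus[of f "\<lambda>l. sc (- 1) (g l)"] coboundary_scale[of g "- 1"]
  by (simp add: sc_minus_left)

lemma cocycle_cup:
  assumes "cocycle f" and "cocycle g" shows "cocycle (cup f g)"
proof -
  have "bar_diff f = (\<lambda>l. 0)" "bar_diff g = (\<lambda>l. 0)"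
    using assms by (auto simp: cocycle_def)
  then show ?thesis
    using assms by (auto simp: cocycle_def cochain_cup bar_diff_cup)
qed

text \<open>Coboundaries absorb cocycles from the right. The absorption from the left is obtained
  later from the multiplicativity of the class polynomials.\<close>

lemma cup_bar_diff_left:
  assumes "cocycle g" shows "cup (bar_diff b) g l = bar_diff (cup b g) l"
proof -
  have "bar_diff g = (\<lambda>l. 0)" using assms by (auto simp: cocycle_def)
  then show ?thesis by (simp add: bar_diff_cup)
qed

end

section \<open>Truncated path algebras of the cyclic quiver\<close>

text \<open>\<open>P u j\<close> is the path of length \<open>j\<close> that starts at the vertex \<open>u\<close> of the cyclic quiver with
  \<open>p\<close> vertices, and \<open>co x u j\<close> is the coefficient of this path in \<open>x\<close>. Vertices matter modulo \<open>p\<close>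
  only, and the paths of length at least \<open>p\<close> are zero.\<close>

locale cyclic_path_algebra = scaled_ring sc
  for sc :: "'k::field \<Rightarrow> 'a::{ring, monoid_mult} \<Rightarrow> 'a" +
  fixes p :: nat and P :: "nat \<Rightarrow> nat \<Rightarrow> 'a" and co :: "'a \<Rightarrow> nat \<Rightarrow> nat \<Rightarrow> 'k"
  assumes p_ge_2: "2 \<le> p"
    and P_mod: "P (u mod p) j = P u j"
    and P_ge: "p \<le> j \<Longrightarrow> P u j = 0"
    and P_mult: "P u j * P v l = (if (u + j) mod p = v mod p then P u (j + l) else 0)"
    and sum_P_0: "(\<Sum>u<p. P u 0) = 1"
    and co_add: "co (x + y) u j = co x u j + co y u j"
    and co_sc: "co (sc c x) u j = c * co x u j"
    and co_P: "u < p \<Longrightarrow> j < p \<Longrightarrow> co (P v l) u j = (if v mod p = u \<and> l = j then 1 else 0)"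
    and co_expand: "x = (\<Sum>u<p. \<Sum>j<p. sc (co x u j) (P u j))"
begin

lemma p_pos: "0 < p"
  using p_ge_2 by simp

lemma P_cong: "u mod p = v mod p \<Longrightarrow> P u j = P v j"
  by (metis P_mod)

lemma co_zero [simp]: "co 0 u j = 0"
  using co_sc[of 0 0 u j] by simp

lemma co_minus: "co (- x) u j = - co x u j"
  using co_sc[of "- 1" x u j] by (simp add: sc_minus_left)

lemma co_diff: "co (x - y) u j = co x u j - co y u j"
  using co_add[of x "- y" u j] by (simp add: co_minus)

lemma co_sum: "co (\<Sum>i\<in>I. f i) u j = (\<Sum>i\<in>I. co (f i) u j)"
  by (induction I rule: infinite_finite_induct) (auto simp: co_add)

lemma lin_eqI:
  assumes "lin \<phi>" and "lin \<psi>" and "\<And>u j. u < p \<Longrightarrow> j < p \<Longrightarrow> \<phi> (P u j) = \<psi> (P u j)"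
  shows "\<phi> x = \<psi> x"
proof -
  have "\<phi> x = (\<Sum>u<p. \<Sum>j<p. sc (co x u j) (\<phi> (P u j)))"
    by (subst co_expand) (simp add: lin_sum[OF assms(1)] lin_sc[OF assms(1)])
  also have "\<dots> = (\<Sum>u<p. \<Sum>j<p. sc (co x u j) (\<psi> (P u j)))"
    using assms(3) by simp
  also have "\<dots> = \<psi> x"
    by (subst (3) co_expand) (simp add: lin_sum[OF assms(2)] lin_sc[OF assms(2)])
  finally show ?thesis .
qed

definition lin_ext :: "(nat \<Rightarrow> nat \<Rightarrow> 'a) \<Rightarrow> 'a \<Rightarrow> 'a" where
  "lin_ext G x = (\<Sum>u<p. \<Sum>j<p. sc (co x u j) (G u j))"

lemma lin_lin_ext: "lin (lin_ext G)"
  unfolding lin_ext_def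
  by (rule linI) (auto simp: co_add co_sc sc_add_left sum.distrib sc_sum_right sc_sc)

lemma lin_ext_P: "lin_ext G (P u j) = (if j < p then G (u mod p) j else 0)"
proof (cases "j < p")
  case True
  have "lin_ext G (P u j) = (\<Sum>v<p. \<Sum>l<p. if u mod p = v \<and> j = l then G v l else 0)"
    unfolding lin_ext_def by (intro sum.cong refl) (auto simp: co_P)
  also have "\<dots> = (\<Sum>v<p. if v = u mod p then G v j else 0)"
    using True by (intro sum.cong refl) (auto simp: sum.delta')
  also have "\<dots> = G (u mod p) j"
    using p_pos by simp
  finally show ?thesis using True by simp
next
  case False
  then show ?thesis using lin_zero[OF lin_lin_ext] by (simp add: P_ge)
qed

section \<open>Corners between two vertices\<close>

lemma mod_add_left_cancel: "(u + l) mod p = (u + j) mod p \<longleftrightarrow> l mod p = j mod p"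
  using cong_add_lcancel_nat[of u l j p] by (simp add: cong_def)

lemma P_0_mult_P: "P u 0 * P u j = P u j"
  by (simp add: P_mult)

lemma P_mult_P_0: "P u j * P (u + j) 0 = P u j"
  by (simp add: P_mult)

text \<open>The end of a path from \<open>u\<close> determines its length modulo \<open>p\<close>,
  and nonzero paths are shorter than \<open>p\<close>. So the corner between two vertices is
  one-dimensional.\<close>

lemma P_corner:
  assumes "u < p" and "j < p"
  shows "P u 0 * x * P (u + j) 0 = sc (co x u j) (P u j)"
proof (rule lin_eqI[where \<phi> = "\<lambda>x. P u 0 * x * P (u + j) 0"])
  show "lin (\<lambda>x. P u 0 * x * P (u + j) 0)" by (intro lin_intros)
  show "lin (\<lambda>x. sc (co x u j) (P u j))"
    by (rule linI) (auto simp: co_add co_sc sc_add_left sc_sc)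
  fix v l assume vl: "v < p" "l < p"
  have "u = v \<Longrightarrow> (u + l) mod p = (u + j) mod p \<longleftrightarrow> l = j"
    using vl assms by (simp add: mod_add_left_cancel)
  then show "P u 0 * P v l * P (u + j) 0 = sc (co (P v l) u j) (P u j)"
    using assms vl by (auto simp: P_mult co_P)
qed


text \<open>Squeezed between the idempotents at its ends, the product becomes a scalar times one
  path. The bound \<open>j + l < p\<close> makes this path nonzero, so that the scalars can be
  compared.\<close>

lemma co_mult_left:
  assumes "u < p" and "j + l < p"
  shows "co (P u j * x) u (j + l) = co x ((u + j) mod p) l"
proof -
  have "P u (j + l) = P u j * P ((u + j) mod p) l" by (simp add: P_mult)
  then have "sc (co (P u j * x) u (j + l)) (P u (j + l)) = P u 0 * (P u j * x) * P (u + (j + l)) 0"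
    using P_corner[of u "j + l" "P u j * x"] assms by simp
  also have "\<dots> = P u j * (P ((u + j) mod p) 0 * x * P ((u + j) mod p + l) 0)"
  proof -
    have "P u 0 * P u j = P u j * P ((u + j) mod p) 0" by (simp add: P_mult)
    moreover have "P (u + (j + l)) 0 = P ((u + j) mod p + l) 0"
      by (rule P_cong) (simp add: mod_add_left_eq add.assoc)
    ultimately show ?thesis by (metis mult.assoc)
  qed
  also have "\<dots> = sc (co x ((u + j) mod p) l) (P u (j + l))"
    using P_corner[of "(u + j) mod p" l x] assms p_pos by (simp add: sc_mult_right P_mult)
  finally have "co (sc (co (P u j * x) u (j + l)) (P u (j + l))) u (j + l)
      = co (sc (co x ((u + j) mod p) l) (P u (j + l))) u (j + l)" by simp
  then show ?thesis using assms by (simp add: co_sc co_P)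
qed

lemma co_mult_right:
  assumes "u < p" and "j + l < p"
  shows "co (x * P (u + j) l) u (j + l) = co x u j"
proof -
  have "sc (co (x * P (u + j) l) u (j + l)) (P u (j + l)) = P u 0 * (x * P (u + j) l) * P (u + (j + l)) 0"
    using P_corner[of u "j + l"] assms by simp
  also have "\<dots> = (P u 0 * x * P (u + j) 0) * P (u + j) l"
    using P_mult_P_0[of "u + j" l] P_0_mult_P[of "u + j" l] by (simp add: mult.assoc add.assoc)
  also have "\<dots> = sc (co x u j) (P u (j + l))"
    using P_corner[of u j x] assms by (simp add: sc_mult_left P_mult)
  finally have "co (sc (co (x * P (u + j) l) u (j + l)) (P u (j + l))) u (j + l)
      = co (sc (co x u j) (P u (j + l))) u (j + l)" by simp
  then show ?thesis using assms by (simp add: co_sc co_P)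
qed

text \<open>The path of length \<open>m\<close> from \<open>u\<close> is cut at each of its arrows:
  the part before acts from the left, the arrow and the part after it become the first two
  arguments. This is a Fox derivative, the contracting homotopy of the path algebra without
  relations. Lengths \<open>m \<ge> p\<close> are meaningful, although the path itself is then
  zero.\<close>

definition path_sum :: "('a list \<Rightarrow> 'a) \<Rightarrow> nat \<Rightarrow> nat \<Rightarrow> 'a list \<Rightarrow> 'a" where
  "path_sum f u m R = (\<Sum>k<m. P u k * f (P (u + k) 1 # P (u + k + 1) (m - 1 - k) # R))"

text \<open>Evaluation on the closed paths of length \<open>p\<close>, each split as \<open>k + 1 + (p - 1 - k)\<close>: a chain map of
  degree \<open>-2\<close> which turns out to be inverse, on classes, to the product with the generator of
  degree 2.\<close>

definition period :: "('a list \<Rightarrow> 'a) \<Rightarrow> 'a list \<Rightarrow> 'a" where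
  "period f R = (\<Sum>v<p. path_sum f v p R)"

lemma path_sum_cong: "u mod p = v mod p \<Longrightarrow> path_sum f u m R = path_sum f v m R"
proof -
  assume uv: "u mod p = v mod p"
  then have "P u k = P v k" "P (u + k) 1 = P (v + k) 1" "P (u + k + 1) n = P (v + k + 1) n" for k n
    using mod_add_cong[OF uv, of k k] mod_add_cong[OF uv, of "k + 1" "k + 1"]
    by (auto intro!: P_cong)
  then show ?thesis by (simp add: path_sum_def)
qed

lemma P_mult_path_sum:
  "P u j * path_sum f v m R = (if (u + j) mod p = v mod p
     then \<Sum>k<m. P u (j + k) * f (P (v + k) 1 # P (v + k + 1) (m - 1 - k) # R) else 0)"
  by (auto simp: path_sum_def sum_distrib_left P_mult mult.assoc[symmetric])

text \<open>A cut whose remaining part has length at least \<open>p\<close> contributes nothing, so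
  only the last \<open>p\<close> of the \<open>m + p\<close> cuts survive. All of these have the
  first \<open>m\<close> arrows in front.\<close>

lemma path_sum_add_p:
  assumes f: "multilin f"
  shows "path_sum f u (m + p) R = P u m * path_sum f (u + m) p R"
proof -
  have z: "f (P a 1 # P b n # R) = 0" if "p \<le> n" for a b n
    using lin_zero[OF multilin_snd[OF f]] that by (simp add: P_ge)
  have "path_sum f u (m + p) R =
      (\<Sum>k\<in>{m..<m + p}. P u k * f (P (u + k) 1 # P (u + k + 1) (m + p - 1 - k) # R))"
    unfolding path_sum_def by (rule sum.mono_neutral_right) (auto simp: z[simplified])
  also have "\<dots> = (\<Sum>k<p. P u (m + k) * f (P (u + m + k) 1 # P (u + m + k + 1) (p - 1 - k) # R))"
    by (rule sum.reindex_bij_witness[of _ "\<lambda>k. m + k" "\<lambda>k. k - m"]) (auto simp: add.commute[of p m])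
  also have "\<dots> = P u m * path_sum f (u + m) p R"
    by (simp add: P_mult_path_sum)
  finally show ?thesis .
qed

text \<open>Multiplication by a path selects the closed path based at its end. The result is a
  splitting of the path prolonged by \<open>p\<close>, which forms the link between
  \<open>period\<close>, left multiplication and \<open>wind\<close>.\<close>

lemma P_mult_period:
  assumes f: "multilin f"
  shows "P u j * period f R = path_sum f u (j + p) R"
proof -
  have "P u j * period f R = (\<Sum>v<p. if v = (u + j) mod p then P u j * path_sum f v p R else 0)"
    unfolding period_def sum_distrib_left
    by (intro sum.cong refl) (auto simp: P_mult_path_sum)
  also have "\<dots> = P u j * path_sum f ((u + j) mod p) p R"
    using p_pos by simp
  also have "\<dots> = path_sum f u (j + p) R"
    by (simp add: path_sum_add_p[OF f] path_sum_cong[of "(u + j) mod p" "u + j"])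
  finally show ?thesis .
qed

lemma multilin_path_sum: "multilin f \<Longrightarrow> multilin (path_sum f u m)"
  unfolding path_sum_def[abs_def]
  by (intro multilin_intros) (intro multilin_Cons)

lemma multilin_period: "multilin f \<Longrightarrow> multilin (period f)"
  unfolding period_def[abs_def] by (intro multilin_intros multilin_path_sum)

lemma bounded_len_period: "bounded_len N f \<Longrightarrow> bounded_len (N - 2) (period f)"
  by (auto simp: bounded_len_def period_def path_sum_def intro!: sum.neutral)

lemma cochain_period: "cochain f \<Longrightarrow> cochain (period f)"
  by (auto simp: cochain_def intro: multilin_period bounded_len_period)

lemma period_add: "period (\<lambda>l. f l + g l) R = period f R + period g R"
  by (simp add: period_def path_sum_def distrib_left sum.distrib)

lemma period_scale: "period (\<lambda>l. sc c (f l)) R = sc c (period f R)"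
  by (simp add: period_def path_sum_def sc_mult_right sc_sum_right)

text \<open>Neighbouring cuts share a term: moving one arrow from the argument of \<phi> to the
  prefix gives the next cut.\<close>

lemma telescope_path:
  "(\<Sum>k<m. P u (k + 1) * \<phi> (P (u + k + 1) (m - 1 - k)) - P u k * \<phi> (P (u + k) (m - k)))
     = P u m * \<phi> (P (u + m) 0) - P u 0 * \<phi> (P u m)"
proof -
  have "(\<Sum>k<m. P u (k + 1) * \<phi> (P (u + k + 1) (m - 1 - k)) - P u k * \<phi> (P (u + k) (m - k)))
    = (\<Sum>k<m. P u (Suc k) * \<phi> (P (u + Suc k) (m - Suc k)) - P u k * \<phi> (P (u + k) (m - k)))"
    by simp
  also have "\<dots> = P u m * \<phi> (P (u + m) 0) - P u 0 * \<phi> (P u m)"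
    by (subst sum_lessThan_telescope) simp
  finally show ?thesis .
qed

text \<open>Centrality of the closed paths: fusing the tail of a closed path with the next argument
  \<open>r\<close> prolongs the path by \<open>r\<close>, and by \<open>P_mult_period\<close> the
  splittings of the prolonged path are also obtained by multiplying with \<open>r\<close> from the
  left.\<close>

lemma period_merge_head:
  assumes f: "multilin f"
  shows "(\<Sum>v<p. \<Sum>k<p. P v k * merge_head (\<lambda>l. f (P (v + k) 1 # l)) (P (v + k + 1) (p - 1 - k)) R)
    = left_diff (period f) R"
proof (cases R)
  case Nil
  \<comment> \<open>With no further argument the tail multiplies the value of \<open>f\<close>. Only
    the corner component of this value counts, a multiple of the arrow itself, so the product is a
    multiple of a closed path of length \<open>p\<close>, that is, zero.\<close>
  have "P v k * (f [P (v + k) 1] * P (v + k + 1) (p - 1 - k)) = 0" if "v < p" "k < p" for v k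
  proof -
    define w where "w = (v + k) mod p"
    define x where "x = f [P (v + k) 1]"
    have w: "w < p" "w mod p = (v + k) mod p" using p_pos by (auto simp: w_def)
    have "P v k = P v k * P w 0" "P (w + 1) 0 * P (v + k + 1) (p - 1 - k) = P (v + k + 1) (p - 1 - k)"
      using w mod_add_cong[of w p "v + k" 1 1] by (auto simp: P_mult w_def intro: P_cong)
    then have "P v k * (x * P (v + k + 1) (p - 1 - k))
        = P v k * (P w 0 * x * P (w + 1) 0) * P (v + k + 1) (p - 1 - k)"
      by (metis mult.assoc)
    also have "\<dots> = sc (co x w 1) (P v k * P w 1 * P (v + k + 1) (p - 1 - k))"
      using P_corner[of w 1 x] w p_ge_2 by (simp add: sc_mult_left sc_mult_right)
    also have "\<dots> = 0"
      using that w by (simp add: P_mult P_ge)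
    finally show ?thesis by (simp add: x_def)
  qed
  then show ?thesis using Nil by simp
next
  case (Cons r R')
  have "(\<Sum>v<p. \<Sum>k<p. P v k * f (P (v + k) 1 # P (v + k + 1) (p - 1 - k) * r # R')) = r * period f R'"
  proof (rule lin_eqI[where x = r])
    show "lin (\<lambda>r. \<Sum>v<p. \<Sum>k<p. P v k * f (P (v + k) 1 # P (v + k + 1) (p - 1 - k) * r # R'))"
      using f by (intro lin_intros) (intro lin_compose[OF multilin_snd] lin_intros)
    show "lin (\<lambda>r. r * period f R')" by (intro lin_intros)
    fix a l assume a: "a < p" "l < p"
    have "(\<Sum>k<p. P v k * f (P (v + k) 1 # P (v + k + 1) (p - 1 - k) * P a l # R'))
      = (if v = a then path_sum f a (l + p) R' else 0)" if "v < p" for v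
    proof (cases "v = a")
      case True
      have "(\<Sum>k<p. P v k * f (P (v + k) 1 # P (v + k + 1) (p - 1 - k) * P a l # R'))
        = (\<Sum>k<p. P v k * f (P (v + k) 1 # P (v + k + 1) (l + p - 1 - k) # R'))"
        using True by (intro sum.cong refl) (auto simp: P_mult add_ac intro!: arg_cong2[where f="(*)"] arg_cong[where f=f] arg_cong2[where f=P])
      \<comment> \<open>The additional cuts \<open>k \<ge> p\<close> vanish, their prefix being too
        long.\<close>
      also have "\<dots> = path_sum f a (l + p) R'"
        unfolding path_sum_def True by (intro sum.mono_neutral_left) (auto simp: P_ge)
      finally show ?thesis using True by simp
    next
      case False
      have "f (P (v + k) 1 # P (v + k + 1) (p - 1 - k) * P a l # R') = 0" if "k < p" for k
      proof -
        have "v + k + 1 + (p - 1 - k) = v + p" using that by simp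
        then have "P (v + k + 1) (p - 1 - k) * P a l = 0"
          using False \<open>v < p\<close> a by (simp add: P_mult)
        then show ?thesis using lin_zero[OF multilin_snd[OF f]] by simp
      qed
      then show ?thesis using False by simp
    qed
    then have "(\<Sum>v<p. \<Sum>k<p. P v k * f (P (v + k) 1 # P (v + k + 1) (p - 1 - k) * P a l # R'))
      = path_sum f a (l + p) R'"
      using a by simp
    then show "(\<Sum>v<p. \<Sum>k<p. P v k * f (P (v + k) 1 # P (v + k + 1) (p - 1 - k) * P a l # R'))
      = P a l * period f R'"
      by (simp add: P_mult_period[OF f])
  qed
  then show ?thesis using Cons by simp
qed

text \<open>The terms that multiply by the arrow or fuse it with its tail telescope to values at
  paths of length \<open>p\<close>, hence to zero. Fusing the tail with the next argument yields the
  left action by \<open>period_merge_head\<close>. The other terms form the right differential,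
  without a sign because two arguments have been used up.\<close>

theorem period_bar_diff:
  assumes f: "multilin f"
  shows "period (bar_diff f) R = bar_diff (period f) R"
proof -
  let ?b = "\<lambda>v k. P (v + k) 1" and ?c = "\<lambda>v k. P (v + k + 1) (p - 1 - k)"
  have e: "bar_diff f (b # c # R) = b * f (c # R) - f (b * c # R)
      + merge_head (\<lambda>l. f (b # l)) c R + right_diff (\<lambda>l. f (b # c # l)) R" for b c
    by (simp add: bar_diff_Cons)
  have bc: "?b v k * ?c v k = P (v + k) (p - k)" if "k < p" for v k
    using that by (simp add: P_mult Suc_diff_Suc)
  have "(\<Sum>k<p. P v k * (?b v k * f (?c v k # R) - f (?b v k * ?c v k # R))) = 0" for v
  proof -
    have "(\<Sum>k<p. P v k * (?b v k * f (?c v k # R) - f (?b v k * ?c v k # R)))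
      = (\<Sum>k<p. P v (k + 1) * f (?c v k # R) - P v k * f (P (v + k) (p - k) # R))"
      by (intro sum.cong refl) (simp add: bc right_diff_distrib mult.assoc[symmetric] P_mult Suc_diff_Suc)
    also have "\<dots> = 0"
      using telescope_path[of v "\<lambda>x. f (x # R)" p] lin_zero[OF multilin_head[OF f]]
      by (simp add: P_ge)
    finally show ?thesis .
  qed
  moreover have "period (bar_diff f) R
     = (\<Sum>v<p. \<Sum>k<p. P v k * (?b v k * f (?c v k # R) - f (?b v k * ?c v k # R)))
     + (\<Sum>v<p. \<Sum>k<p. P v k * merge_head (\<lambda>l. f (?b v k # l)) (?c v k) R)
     + (\<Sum>v<p. \<Sum>k<p. P v k * right_diff (\<lambda>l. f (?b v k # ?c v k # l)) R)"
    unfolding period_def path_sum_def e by (simp add: distrib_left sum.distrib)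
  moreover have "right_diff (period f) R
     = (\<Sum>v<p. \<Sum>k<p. P v k * right_diff (\<lambda>l. f (?b v k # ?c v k # l)) R)"
    unfolding period_def[abs_def] path_sum_def[abs_def] by (simp add: right_diff_sum right_diff_mult)
  ultimately show ?thesis
    using period_merge_head[OF f, of R] by (simp add: bar_diff_def)
qed

end

section \<open>Cocycles generating the cohomology in degrees 1 and 2\<close>

context cyclic_path_algebra
begin

lemma lin_ext_compose: "(\<And>u j. lin (\<phi> u j)) \<Longrightarrow> lin (\<lambda>b. lin_ext (\<lambda>u j. \<phi> u j b) a)"
  unfolding lin_ext_def by (intro lin_intros)

text \<open>The 2-cocycle of the extension of the algebra by itself in which the paths of length less than
  \<open>2 p\<close> survive.\<close>

definition wind :: "'a \<Rightarrow> 'a \<Rightarrow> 'a" where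
  "wind a b = lin_ext (\<lambda>u j. lin_ext (\<lambda>v l.
     if (u + j) mod p = v \<and> p \<le> j + l then P u (j + l - p) else 0) b) a"

lemma lin_wind_left: "lin (\<lambda>a. wind a b)"
  unfolding wind_def by (rule lin_lin_ext)

lemma lin_wind_right: "lin (\<lambda>b. wind a b)"
  unfolding wind_def by (intro lin_ext_compose lin_lin_ext)

lemma wind_P:
  "wind (P u j) (P v l) =
     (if j < p \<and> l < p \<and> (u + j) mod p = v mod p \<and> p \<le> j + l then P u (j + l - p) else 0)"
  by (auto simp: wind_def lin_ext_P mod_add_left_eq P_mod)

text \<open>This is associativity of the extension in which paths of length between \<open>p\<close>
  and \<open>2 * p\<close> survive. It is checked on triples of paths and extended linearly one
  argument at a time.\<close>

lemma wind_cocycle: "a * wind b c - wind (a * b) c + wind a (b * c) = wind a b * c"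
proof -
  have *: "a * wind b c - wind (a * b) c + wind a (b * c) = wind a b * c"
    if a: "a = P u j" "j < p" and b: "b = P v l" "l < p" and c: "c = P w m" "m < p" for a b c u j v l w m
  proof -
    have w0: "wind 0 x = 0" "wind x 0 = 0" for x
      using lin_zero[OF lin_wind_left] lin_zero[OF lin_wind_right] by auto
    \<comment> \<open>Deleting \<open>p\<close> arrows does not move the end of a path, vertices
      being counted modulo \<open>p\<close>.\<close>
    have u: "(u + (j + l - p)) mod p = (u + j + l) mod p" if "p \<le> j + l"
      using that by (metis add.assoc le_add_diff_inverse2 mod_add_self2)
    have v: "(v + (l + m - p)) mod p = (v + l + m) mod p" if "p \<le> l + m"
      using that by (metis add.assoc le_add_diff_inverse2 mod_add_self2)
    consider "(u + j) mod p \<noteq> v mod p" | "(v + l) mod p \<noteq> w mod p"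
      | "(u + j) mod p = v mod p" "(v + l) mod p = w mod p" by blast
    then show ?thesis
    proof cases
      case 1
      then show ?thesis
        by (auto simp: a b c wind_P P_mult w0)
    next
      case 2
      have "(u + j + l) mod p \<noteq> w mod p" if "(u + j) mod p = v mod p"
        using 2 mod_add_cong[OF that, of l l] by simp
      then show ?thesis using 2 u
        by (auto simp: a b c wind_P P_mult w0 add.assoc)
    next
      case 3
      have uw: "(u + j + l) mod p = w mod p"
        using 3 mod_add_cong[OF 3(1), of l l] by simp
      then show ?thesis
        using 3 u a(2) b(2) c(2)
        by (auto simp: a(1) b(1) c(1) wind_P P_mult w0 add.assoc P_ge not_less not_le)
    qed
  qed
  have "a * wind b c - wind (a * b) c + wind a (b * c) = wind a b * c"
    if a: "a = P u j" "j < p" and b: "b = P v l" "l < p" for a b u j v l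
    by (rule lin_eqI[where x = c])
      (auto intro!: lin_intros lin_wind_right lin_compose[OF lin_wind_right[of a]] *[OF a b])
  then have "a * wind b c - wind (a * b) c + wind a (b * c) = wind a b * c"
    if a: "a = P u j" "j < p" for a u j
    by (rule_tac lin_eqI[where x = b])
      (use a in \<open>auto intro!: lin_intros lin_wind_right lin_wind_left lin_compose[OF lin_wind_right[of "P u j"]]
        lin_compose[OF lin_wind_left[of c]]\<close>)
  then show ?thesis
    by (rule_tac lin_eqI[where x = a])
      (auto intro!: lin_intros lin_wind_left lin_compose[OF lin_wind_left[of c]])
qed

text \<open>The generator of degree 1 counts how often a path uses the arrow from \<open>p - 1\<close> to \<open>0\<close>. The
  derivation \<open>P u j \<mapsto> j P u j\<close> would not do: it takes the value \<open>p = 0\<close> on a closed path, so it is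
  inner.\<close>

definition cross :: "nat \<Rightarrow> nat \<Rightarrow> 'k" where
  "cross u j = (\<Sum>k<j. of_bool ((u + k) mod p = p - 1))"

lemma cross_add: "cross u (j + l) = cross u j + cross (u + j) l"
proof -
  have "cross u (j + l) = cross u j + (\<Sum>k\<in>{j..<j + l}. of_bool ((u + k) mod p = p - 1))"
    unfolding cross_def by (metis (no_types, lifting) atLeast0LessThan le_add1 sum.atLeastLessThan_concat zero_le)
  also have "(\<Sum>k\<in>{j..<j + l}. of_bool ((u + k) mod p = p - 1)) = cross (u + j) l"
    unfolding cross_def
    by (rule sum.reindex_bij_witness[of _ "\<lambda>k. j + k" "\<lambda>k. k - j"]) (auto simp: add.assoc)
  finally show ?thesis .
qed

lemma cross_cong: "u mod p = v mod p \<Longrightarrow> cross u j = cross v j"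
  unfolding cross_def by (metis (no_types, lifting) mod_add_left_eq)

definition xd :: "'a \<Rightarrow> 'a" where
  "xd = lin_ext (\<lambda>u j. sc (cross u j) (P u j))"

lemma lin_xd: "lin xd"
  unfolding xd_def by (rule lin_lin_ext)

lemma xd_P: "xd (P u j) = sc (cross u j) (P u j)"
  by (auto simp: xd_def lin_ext_P P_mod P_ge cross_cong[of "u mod p" u])

lemma xd_mult: "xd (a * b) = xd a * b + a * xd b"
proof -
  have *: "xd (P u j * b) = xd (P u j) * b + P u j * xd b" for u j
  proof (rule lin_eqI[where x = b])
    fix v l assume "v < p" "l < p"
    show "xd (P u j * P v l) = xd (P u j) * P v l + P u j * xd (P v l)"
      using lin_zero[OF lin_xd] cross_cong[of "u + j" v]
      by (auto simp: P_mult xd_P sc_mult_left sc_mult_right cross_add sc_add_left)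
  qed (auto intro!: lin_intros lin_compose[OF lin_xd] lin_xd)
  show ?thesis
    by (rule lin_eqI[where x = a]) (auto intro!: lin_intros lin_compose[OF lin_xd] lin_xd *)
qed

text \<open>\<open>wcup h\<close> and \<open>xcup h\<close> are the cup products of w and x with
  \<open>h\<close>. As the left factor is homogeneous, a single cut of the list contributes, and
  pattern matching expresses it.\<close>

fun wcup :: "('a list \<Rightarrow> 'a) \<Rightarrow> 'a list \<Rightarrow> 'a" where
  "wcup h (a # b # l) = wind a b * h l"
| "wcup h _ = 0"

fun xcup :: "('a list \<Rightarrow> 'a) \<Rightarrow> 'a list \<Rightarrow> 'a" where
  "xcup h (a # l) = xd a * h l"
| "xcup h [] = 0"

definition unit_cochain :: "'a list \<Rightarrow> 'a" where
  "unit_cochain l = (if l = [] then 1 else 0)"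

lemma multilin_wcup: assumes "multilin h" shows "multilin (wcup h)"
proof (rule multilinI)
  show "lin (\<lambda>x. wcup h (x # l))" for l
    by (cases l) (auto intro!: lin_intros lin_wind_left)
  show "multilin (\<lambda>l. wcup h (a # l))" for a
  proof (rule multilinI)
    show "lin (\<lambda>x. wcup h (a # x # l))" for l
      by (auto intro!: lin_intros lin_wind_right)
    show "multilin (\<lambda>l. wcup h (a # b # l))" for b
      using assms by (auto intro!: multilin_intros)
  qed
qed

lemma multilin_xcup: "multilin h \<Longrightarrow> multilin (xcup h)"
  by (rule multilinI) (auto intro!: lin_intros lin_xd multilin_intros)

lemma bounded_len_wcup: "bounded_len N h \<Longrightarrow> bounded_len (N + 2) (wcup h)"
  unfolding bounded_len_def
proof (intro allI impI)
  fix l :: "'a list" assume "\<forall>as. N \<le> length as \<longrightarrow> h as = 0" "N + 2 \<le> length l"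
  then show "wcup h l = 0" by (cases "(h, l)" rule: wcup.cases) auto
qed

lemma bounded_len_xcup: "bounded_len N h \<Longrightarrow> bounded_len (N + 1) (xcup h)"
  unfolding bounded_len_def
proof (intro allI impI)
  fix l :: "'a list" assume "\<forall>as. N \<le> length as \<longrightarrow> h as = 0" "N + 1 \<le> length l"
  then show "xcup h l = 0" by (cases l) auto
qed

lemma cochain_wcup: "cochain h \<Longrightarrow> cochain (wcup h)"
  by (auto simp: cochain_def intro: multilin_wcup bounded_len_wcup)

lemma cochain_xcup: "cochain h \<Longrightarrow> cochain (xcup h)"
  by (auto simp: cochain_def intro: multilin_xcup bounded_len_xcup)

lemma cochain_unit: "cochain unit_cochain"
proof -
  have "multilin unit_cochain"
    by (rule multilinI) (auto simp: unit_cochain_def intro: lin_zero_fun multilin_zero)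
  moreover have "bounded_len 1 unit_cochain"
    by (auto simp: bounded_len_def unit_cochain_def)
  ultimately show ?thesis by (auto simp: cochain_def)
qed

lemma bar_diff_unit: "bar_diff unit_cochain l = 0"
proof (cases l)
  case (Cons a m)
  then show ?thesis
    by (cases m) (auto simp: bar_diff_Cons unit_cochain_def simp del: right_diff.simps(2))
qed simp

text \<open>The derivation rule \<open>xd_mult\<close> makes x a cocycle; the sign is the cost of
  passing a factor of odd degree.\<close>

lemma bar_diff_xcup: "bar_diff (xcup h) l = - xcup (bar_diff h) l"
proof (cases l)
  case (Cons a m)
  then show ?thesis
    by (cases m) (auto simp: bar_diff_Cons right_diff_mult merge_head_mult xd_mult algebra_simps)
qed simp

lemma bar_diff_wcup: "bar_diff (wcup h) l = wcup (bar_diff h) l"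
proof -
  consider "l = []" | a where "l = [a]" | a b where "l = [a, b]" | a b c m where "l = a # b # c # m"
    by (metis list.exhaust)
  then show ?thesis
  proof cases
    case 4
    have "bar_diff (wcup h) l = a * (wind b c * h m) - wind (a * b) c * h m + wind a (b * c) * h m
        + right_diff (\<lambda>l. wind a b * h l) (c # m)"
      by (simp add: 4 bar_diff_Cons del: right_diff.simps(2)) simp
    also have "\<dots> = (a * wind b c - wind (a * b) c + wind a (b * c)) * h m
        + wind a b * right_diff h (c # m)"
      by (simp add: right_diff_mult algebra_simps del: right_diff.simps(2))
    also have "\<dots> = wind a b * c * h m + wind a b * right_diff h (c # m)"
      by (simp only: wind_cocycle)
    also have "\<dots> = wcup (bar_diff h) l"
      by (simp add: 4 bar_diff_def algebra_simps del: right_diff.simps(2))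
    finally show ?thesis .
  qed (auto simp: bar_diff_Cons)
qed

lemma cocycle_unit: "cocycle unit_cochain"
  and cocycle_xcup: "cocycle h \<Longrightarrow> cocycle (xcup h)"
  and cocycle_wcup: "cocycle h \<Longrightarrow> cocycle (wcup h)"
proof -
  show "cocycle unit_cochain" by (simp add: cocycle_def cochain_unit bar_diff_unit)
  assume h: "cocycle h"
  then have z: "bar_diff h = (\<lambda>l. 0)" by (auto simp: cocycle_def)
  have "xcup (\<lambda>l. 0) l = 0" for l by (cases l) auto
  then show "cocycle (xcup h)"
    using h by (simp add: cocycle_def cochain_xcup bar_diff_xcup z)
  have "wcup (\<lambda>l. 0) l = 0" for l by (cases "(h, l)" rule: wcup.cases) auto
  then show "cocycle (wcup h)"
    using h by (simp add: cocycle_def cochain_wcup bar_diff_wcup z)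
qed

lemma cup_unit: "cup unit_cochain h l = h l"
  by (cases l) (auto simp: unit_cochain_def)

lemma cup_xcup: "cup (xcup z) h l = xcup (cup z h) l"
  by (cases l) (auto simp: cup_mult_left)

lemma cup_wcup: "cup (wcup z) h l = wcup (cup z h) l"
  by (cases "(z, l)" rule: wcup.cases) (auto simp: cup_mult_left)

lemma xcup_add: "xcup (\<lambda>l. f l + g l) l = xcup f l + xcup g l"
  by (cases l) (auto simp: distrib_left)

lemma xcup_scale: "xcup (\<lambda>l. sc c (f l)) l = sc c (xcup f l)"
  by (cases l) (auto simp: sc_mult_right)

text \<open>An arrow and the tail of a closed path have total length \<open>p - k\<close>, which
  reaches \<open>p\<close> only for \<open>k = 0\<close>. There \<open>wind\<close> returns the
  vertex, and the vertices add up to 1.\<close>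

lemma period_wcup: "period (wcup g) R = g R"
proof -
  have "path_sum (wcup g) v p R = P v 0 * g R" for v
  proof -
    have "path_sum (wcup g) v p R = (\<Sum>k<p. if k = 0 then P v 0 * g R else 0)"
      unfolding path_sum_def
      using p_ge_2 by (intro sum.cong refl) (auto simp: wind_P P_mult mult.assoc[symmetric])
    then show ?thesis using p_pos by simp
  qed
  then show ?thesis
    by (simp add: period_def sum_distrib_right[symmetric] sum_P_0)
qed

text \<open>Since \<open>xd\<close> merely rescales paths, the three pieces of a closed path still
  multiply to a path of length \<open>p\<close>, which is zero. Together with the vanishing of
  \<open>chi0\<close> and \<open>chi1\<close> this gives x^2 = 0 in cohomology.\<close>

lemma period_xcup_xcup: "period (xcup (xcup h)) R = 0"
proof -
  have "P v k * (xd (P (v + k) 1) * (xd (P (v + k + 1) (p - 1 - k)) * x)) = 0" if "k < p" for v k x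
    using that by (simp add: xd_P sc_mult_left sc_mult_right mult.assoc[symmetric] P_mult P_ge)
  then show ?thesis by (simp add: period_def path_sum_def)
qed

text \<open>This moves x past w. For \<open>r\<close> a path of length \<open>l\<close>,
  \<open>wind\<close> of the tail and \<open>r\<close> is nonzero exactly for \<open>k < l\<close>;
  the remaining pieces then multiply to \<open>r\<close> again. The factors from \<open>xd\<close>
  on the single arrows add up to the number of crossings of \<open>r\<close>.\<close>

lemma period_xcup_wcup:
  "period (xcup (wcup g)) R = xcup g R"
proof (cases R)
  case Nil
  then show ?thesis by (simp add: period_def path_sum_def)
next
  case (Cons r R')
  have "(\<Sum>v<p. \<Sum>k<p. P v k * (xd (P (v + k) 1) * wind (P (v + k + 1) (p - 1 - k)) r)) = xd r"
  proof (rule lin_eqI[where x = r])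
    fix a l assume a: "a < p" "l < p"
    have "(\<Sum>k<p. P v k * (xd (P (v + k) 1) * wind (P (v + k + 1) (p - 1 - k)) (P a l)))
      = (if v = a then sc (cross a l) (P a l) else 0)" if v: "v < p" for v
    proof -
      have e: "(v + k + 1 + (p - 1 - k)) mod p = v" if "k < p" for k
      proof -
        have "v + k + 1 + (p - 1 - k) = v + p" using that by simp
        then show ?thesis using v by simp
      qed
      have "P v k * (xd (P (v + k) 1) * wind (P (v + k + 1) (p - 1 - k)) (P a l))
        = (if v = a \<and> k < l then sc (of_bool ((a + k) mod p = p - 1)) (P a l) else 0)" if k: "k < p" for k
        using e[OF k] a k
        by (auto simp: wind_P xd_P sc_mult_left sc_mult_right mult.assoc[symmetric] P_mult cross_def)
      then have "(\<Sum>k<p. P v k * (xd (P (v + k) 1) * wind (P (v + k + 1) (p - 1 - k)) (P a l)))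
        = (\<Sum>k<p. if v = a \<and> k < l then sc (of_bool ((a + k) mod p = p - 1)) (P a l) else 0)"
        by (intro sum.cong) auto
      also have "\<dots> = (if v = a then (\<Sum>k<l. sc (of_bool ((a + k) mod p = p - 1)) (P a l)) else 0)"
        using a by (auto intro!: sum.mono_neutral_cong_right split: if_splits)
      also have "\<dots> = (if v = a then sc (cross a l) (P a l) else 0)"
        by (simp only: cross_def sc_sum_left)
      finally show ?thesis .
    qed
    then have "(\<Sum>v<p. \<Sum>k<p. P v k * (xd (P (v + k) 1) * wind (P (v + k + 1) (p - 1 - k)) (P a l)))
      = sc (cross a l) (P a l)"
      using a by simp
    then show "(\<Sum>v<p. \<Sum>k<p. P v k * (xd (P (v + k) 1) * wind (P (v + k + 1) (p - 1 - k)) (P a l)))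
      = xd (P a l)"
      by (simp add: xd_P)
  qed (auto intro!: lin_intros lin_wind_right lin_xd)
  then have "(\<Sum>v<p. \<Sum>k<p. P v k * (xd (P (v + k) 1) * wind (P (v + k + 1) (p - 1 - k)) r)) * g R'
    = xd r * g R'" by simp
  then show ?thesis
    by (simp add: Cons period_def path_sum_def sum_distrib_right mult.assoc)
qed

lemma period_unit: "period unit_cochain R = 0"
  by (simp add: period_def path_sum_def unit_cochain_def)

lemma period_xcup_unit: "period (xcup unit_cochain) R = 0"
  by (simp add: period_def path_sum_def unit_cochain_def)

end

section \<open>Two-periodicity\<close>

context cyclic_path_algebra
begin

text \<open>The contracting homotopy given by the separability idempotent of the span of the vertices,
  applied to the first argument only.\<close>

definition left_avg :: "('a list \<Rightarrow> 'a) \<Rightarrow> 'a list \<Rightarrow> 'a" where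
  "left_avg f R = (\<Sum>i<p. P i 0 * f (P i 0 # R))"

lemma cochain_left_avg: "cochain f \<Longrightarrow> cochain (left_avg f)"
proof -
  assume "cochain f"
  then obtain N where f: "multilin f" "bounded_len N f" by (auto simp: cochain_def)
  have "multilin (left_avg f)"
    unfolding left_avg_def[abs_def] by (intro multilin_intros multilin_Cons f)
  moreover have "bounded_len N (left_avg f)"
    using f(2) by (auto simp: bounded_len_def left_avg_def intro!: sum.neutral)
  ultimately show ?thesis by (auto simp: cochain_def)
qed

lemma sum_P_delta: "(\<Sum>i<p. P u j * (P i 0 * x i)) = P u j * x ((u + j) mod p)"
proof -
  have "(\<Sum>i<p. P u j * (P i 0 * x i)) = (\<Sum>i<p. if i = (u + j) mod p then P u j * x i else 0)"
    by (intro sum.cong refl) (auto simp: P_mult mult.assoc[symmetric])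
  then show ?thesis using p_pos by simp
qed

text \<open>The cocycle condition with a vertex put in front evaluates the inner differential. The
  two error terms are also the ends of the telescoping sum in \<open>bar_diff_split_first\<close>,
  so they disappear when the two homotopies are subtracted.\<close>

lemma bar_diff_left_avg:
  assumes f: "cocycle f" and u: "u < p"
  shows "bar_diff (left_avg f) (P u j # R) =
    f (P u j # R) + P u j * f (P (u + j) 0 # R) - P u 0 * f (P u j # R)"
proof -
  let ?a = "P u j"
  have mf: "multilin f" using f by (simp add: cocycle_def cochain_def)
  have r: "right_diff (\<lambda>l. f (P i 0 # l)) (?a # R) = P i 0 * f (?a # R) - f (P i 0 * ?a # R)" for i
  proof -
    have "bar_diff f (P i 0 # ?a # R) = 0" using f by (simp add: cocycle_def)
    then show ?thesis by (simp add: bar_diff_Cons[of f] algebra_simps del: right_diff.simps(2))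
  qed
  have "bar_diff (left_avg f) (?a # R)
      = ?a * left_avg f R + (\<Sum>i<p. P i 0 * right_diff (\<lambda>l. f (P i 0 # l)) (?a # R))"
    by (simp add: bar_diff_def left_avg_def[abs_def] right_diff_sum right_diff_mult
        del: right_diff.simps(2))
  also have "(\<Sum>i<p. P i 0 * right_diff (\<lambda>l. f (P i 0 # l)) (?a # R))
      = (\<Sum>i<p. P i 0 * f (?a # R) - P i 0 * f (P i 0 * ?a # R))"
    unfolding r by (intro sum.cong refl)
      (simp add: right_diff_distrib mult.assoc[symmetric] P_mult)
  also have "\<dots> = f (?a # R) - (\<Sum>i<p. P i 0 * f (P i 0 * ?a # R))"
    by (simp add: sum_subtractf sum_distrib_right[symmetric] sum_P_0)
  also have "(\<Sum>i<p. P i 0 * f (P i 0 * ?a # R)) = (\<Sum>i<p. if i = u then P u 0 * f (?a # R) else 0)"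
    using u lin_zero[OF multilin_head[OF mf]] by (intro sum.cong refl) (auto simp: P_mult)
  also have "\<dots> = P u 0 * f (?a # R)" using u by simp
  also have "?a * left_avg f R = ?a * f (P (u + j) 0 # R)"
    by (simp add: left_avg_def sum_distrib_left sum_P_delta P_mod)
  finally show ?thesis by (simp add: algebra_simps)
qed

text \<open>In the path algebra without relations, splitting the arrows off the first argument one by one
  is a contracting homotopy. With the relations, its failure is the product of \<open>wind\<close> with \<open>period f\<close>.\<close>

fun split_first :: "'a \<Rightarrow> ('a list \<Rightarrow> 'a) \<Rightarrow> 'a list \<Rightarrow> 'a" where
  "split_first c f [] = c"
| "split_first c f (a # R) = lin_ext (\<lambda>u j. path_sum f u j R) a"

lemma cochain_split_first: "cochain f \<Longrightarrow> cochain (split_first c f)"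
proof -
  assume "cochain f"
  then obtain N where f: "multilin f" "bounded_len N f" by (auto simp: cochain_def)
  have "multilin (split_first c f)"
  proof (rule multilinI)
    show "lin (\<lambda>x. split_first c f (x # l))" for l by (simp add: lin_lin_ext)
    show "multilin (\<lambda>l. split_first c f (a # l))" for a
      unfolding split_first.simps lin_ext_def
      by (intro multilin_intros multilin_path_sum f)
  qed
  moreover have "bounded_len (Suc N) (split_first c f)"
    unfolding bounded_len_def
  proof (intro allI impI)
    fix l :: "'a list" assume "Suc N \<le> length l"
    then obtain a R where "l = a # R" "N \<le> length R" by (cases l) auto
    then show "split_first c f l = 0"
      using f(2) by (auto simp: bounded_len_def lin_ext_def path_sum_def intro!: sum.neutral)
  qed
  ultimately show ?thesis by (auto simp: cochain_def)
qed

text \<open>The cuts of a composite of lengths \<open>j\<close> and \<open>l\<close> lie in the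
  first path, where they come from the right differential, or in the second, where they come from
  the left action. Together they are all cuts of the composite. The term of the product in the
  algebra cancels them if \<open>j + l < p\<close> and is zero otherwise; by
  \<open>P_mult_period\<close> what is left over is \<open>wind\<close> times
  \<open>period f\<close>.\<close>

lemma bar_diff_split_first:
  assumes f: "cocycle f" and "u < p" "j < p" "v < p" "l < p"
  shows "bar_diff (split_first c f) (P u j # P v l # R) =
    wind (P u j) (P v l) * period f R
    + P u j * f (P (u + j) 0 # P v l # R) - P u 0 * f (P u j # P v l # R)"
proof -
  let ?a = "P v l" and ?b = "\<lambda>k. P (u + k) 1" and ?c = "\<lambda>k. P (u + k + 1) (j - 1 - k)"
  have mf: "multilin f" using f by (simp add: cocycle_def cochain_def)
  have z: "f (0 # R) = 0" "f (b # 0 # R) = 0" for b R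
    using lin_zero[OF multilin_head[OF mf]] lin_zero[OF multilin_snd[OF mf]] by auto
  have bc: "?b k * ?c k = P (u + k) (j - k)" if "k < j" for k
    using that by (simp add: P_mult Suc_diff_Suc)
  \<comment> \<open>The cocycle condition trades the differential in the later arguments for terms
    involving the arrow and its tail.\<close>
  have r: "right_diff (\<lambda>l. f (b # c # l)) (?a # R) = f (b * c # ?a # R) - b * f (c # ?a # R)
      - f (b # c * ?a # R)" for b c
  proof -
    have "bar_diff f (b # c # ?a # R) = 0" using f by (simp add: cocycle_def)
    then have "b * f (c # ?a # R) - f (b * c # ?a # R) + f (b # c * ?a # R)
      + right_diff (\<lambda>l. f (b # c # l)) (?a # R) = 0"
      by (simp add: bar_diff_Cons algebra_simps)
    then show ?thesis by (simp add: algebra_simps eq_neg_iff_add_eq_0 del: right_diff.simps(2))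
  qed
  have s: "split_first c f (P u j # l) = path_sum f u j l" for l
    using assms by (simp add: lin_ext_P)
  have "right_diff (\<lambda>l. split_first c f (P u j # l)) (?a # R)
     = (\<Sum>k<j. P u k * right_diff (\<lambda>l. f (?b k # ?c k # l)) (?a # R))"
    unfolding s path_sum_def[abs_def] by (simp only: right_diff_sum right_diff_mult)
  also have "\<dots> = (\<Sum>k<j. - (P u (k + 1) * f (?c k # ?a # R) - P u k * f (P (u + k) (j - k) # ?a # R))
     - P u k * f (?b k # ?c k * ?a # R))"
    unfolding r by (intro sum.cong refl)
      (simp add: bc right_diff_distrib mult.assoc[symmetric] P_mult Suc_diff_Suc algebra_simps)
  also have "\<dots> = - (P u j * f (P (u + j) 0 # ?a # R) - P u 0 * f (P u j # ?a # R))
     - (\<Sum>k<j. P u k * f (?b k # ?c k * ?a # R))"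
    using telescope_path[of u "\<lambda>x. f (x # ?a # R)" j]
    by (simp only: sum_subtractf sum_negf)
  finally have "bar_diff (split_first c f) (P u j # ?a # R) =
      (P u j * path_sum f v l R - lin_ext (\<lambda>u j. path_sum f u j R) (P u j * ?a)
        + (\<Sum>k<j. P u k * f (?b k # ?c k * ?a # R)))
      + (P u j * f (P (u + j) 0 # ?a # R) - P u 0 * f (P u j # ?a # R))"
    using assms by (simp add: bar_diff_Cons lin_ext_P algebra_simps del: right_diff.simps(2))
  moreover have "P u j * path_sum f v l R - lin_ext (\<lambda>u j. path_sum f u j R) (P u j * ?a)
        + (\<Sum>k<j. P u k * f (?b k # ?c k * ?a # R)) = wind (P u j) ?a * period f R"
  proof (cases "(u + j) mod p = v")
    case False
    have "?c k * ?a = 0" if "k < j" for k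
    proof -
      have "u + k + 1 + (j - 1 - k) = u + j" using that by simp
      then show ?thesis using False assms by (simp add: P_mult)
    qed
    then show ?thesis
      using False assms lin_zero[OF lin_lin_ext] by (simp add: P_mult_path_sum wind_P z P_mult)
  next
    case True
    have "?c k * ?a = P (u + k + 1) (j + l - 1 - k)" if "k < j" for k
    proof -
      have "u + k + 1 + (j - 1 - k) = u + j" "j - 1 - k + l = j + l - 1 - k" using that by simp_all
      then show ?thesis using True assms by (simp add: P_mult)
    qed
    then have "(\<Sum>k<j. P u k * f (?b k # ?c k * ?a # R))
       = (\<Sum>k<j. P u k * f (?b k # P (u + k + 1) (j + l - 1 - k) # R))" by simp
    moreover have "P u j * path_sum f v l R
       = (\<Sum>k\<in>{j..<j + l}. P u k * f (?b k # P (u + k + 1) (j + l - 1 - k) # R))"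
    proof -
      have "P u j * path_sum f v l R = P u j * path_sum f (u + j) l R"
        using True assms by (simp add: path_sum_cong[of v "u + j"])
      also have "\<dots> = (\<Sum>k<l. P u (j + k) * f (P (u + j + k) 1 # P (u + j + k + 1) (l - 1 - k) # R))"
        by (simp add: P_mult_path_sum)
      also have "\<dots> = (\<Sum>k\<in>{j..<j + l}. P u k * f (?b k # P (u + k + 1) (j + l - 1 - k) # R))"
        by (rule sum.reindex_bij_witness[of _ "\<lambda>k. k - j" "\<lambda>k. j + k"]) (auto simp: add.assoc)
      finally show ?thesis .
    qed
    moreover have "(\<Sum>k<j. P u k * f (?b k # P (u + k + 1) (j + l - 1 - k) # R))
        + (\<Sum>k\<in>{j..<j + l}. P u k * f (?b k # P (u + k + 1) (j + l - 1 - k) # R))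
        = path_sum f u (j + l) R"
      unfolding path_sum_def atLeast0LessThan[symmetric] by (rule sum.atLeastLessThan_concat) auto
    moreover have "lin_ext (\<lambda>u j. path_sum f u j R) (P u j * ?a)
        = (if j + l < p then path_sum f u (j + l) R else 0)"
      using True assms by (simp add: P_mult lin_ext_P)
    moreover have "wind (P u j) ?a * period f R = (if j + l < p then 0 else path_sum f u (j + l) R)"
      using True assms by (auto simp: wind_P P_mult_period[OF mf])
    ultimately show ?thesis by (auto simp: algebra_simps)
  qed
  ultimately show ?thesis by simp
qed

section \<open>Cocycles in degrees 0 and 1, and the decomposition of a cocycle\<close>

definition chi0 :: "('a list \<Rightarrow> 'a) \<Rightarrow> 'k" where
  "chi0 f = co (f []) 0 0"

text \<open>The holonomy of a derivation: the sum of its coefficients on all arrows of the cycle. An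
  inner derivation contributes differences of vertex coefficients, which add up to zero around the
  cycle.\<close>

definition chi1 :: "('a list \<Rightarrow> 'a) \<Rightarrow> 'k" where
  "chi1 f = (\<Sum>u<p. co (f [P u 1]) u 1)"

text \<open>In degree 0 a cocycle is a central element. Commuting with the vertices leaves only
  multiples of vertices, and commuting with the arrows makes their coefficients equal.\<close>

lemma cocycle_Nil:
  assumes f: "cocycle f" shows "f [] = sc (chi0 f) 1"
proof -
  have comm: "x * f [] = f [] * x" for x
    using f by (auto simp: cocycle_def bar_diff_Cons dest: spec[of _ "[x]"])
  have step: "co (f []) ((u + 1) mod p) 0 = co (f []) u 0" if "u < p" for u
    using co_mult_left[of u 1 0 "f []"] co_mult_right[of u 0 1 "f []"] that p_ge_2 comm[of "P u 1"]
    by simp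
  have const: "co (f []) u 0 = chi0 f" if "u < p" for u
    using that
  proof (induction u)
    case (Suc u)
    then show ?case using step[of u] by simp
  qed (simp add: chi0_def)
  have "f [] = (\<Sum>i<p. P i 0) * f []" by (simp add: sum_P_0)
  also have "\<dots> = (\<Sum>i<p. P i 0 * f [] * P (i + 0) 0)"
    unfolding sum_distrib_right
  proof (rule sum.cong)
    fix i assume "i \<in> {..<p}"
    have "P i 0 * f [] = P i 0 * P i 0 * f []" by (simp add: P_mult)
    also have "\<dots> = P i 0 * f [] * P (i + 0) 0" by (metis add.right_neutral comm mult.assoc)
    finally show "P i 0 * f [] = P i 0 * f [] * P (i + 0) 0" .
  qed simp
  also have "\<dots> = (\<Sum>i<p. sc (chi0 f) (P i 0))"
    using p_pos by (intro sum.cong refl) (subst P_corner, auto simp: const)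
  also have "\<dots> = sc (chi0 f) 1" by (simp add: sc_sum_right[symmetric] sum_P_0)
  finally show ?thesis .
qed

lemma cross_Suc: "cross u (Suc j) = cross u j + of_bool ((u + j) mod p = p - 1)"
  unfolding cross_def by (rule sum.lessThan_Suc)

text \<open>In degree 1 a cocycle is a derivation. Up to the differential of \<open>left_avg\<close>
  it rescales paths and is given by its scalars \<gamma> on the arrows. The potential \<nu>
  integrates \<gamma> from vertex 0 to vertex \<open>p - 1\<close>, so the commutator with
  \<open>c\<close> accounts for every arrow but the last. The defect on the last arrow is the
  holonomy \<open>chi1 f\<close>, and \<open>xd\<close> counts exactly this arrow.\<close>

lemma cocycle_singleton:
  assumes f: "cocycle f"
  shows "\<exists>c. \<forall>a. f [a] = sc (chi1 f) (xd a) + bar_diff (left_avg f) [a] + (a * c - c * a)"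
proof -
  define \<gamma> where "\<gamma> v = co (f [P v 1]) v 1" for v
  define \<nu> where "\<nu> u = (\<Sum>i<u mod p. \<gamma> i)" for u
  define c where "c = (\<Sum>v<p. sc (\<nu> v) (P v 0))"
  have mf: "multilin f" using f by (simp add: cocycle_def cochain_def)
  have der: "f [a * b] = a * f [b] + f [a] * b" for a b
  proof -
    have "bar_diff f [a, b] = 0" using f by (simp add: cocycle_def)
    then show ?thesis by (simp add: bar_diff_Cons algebra_simps)
  qed
  have coeff: "co (f [P u j]) u j = (\<Sum>k<j. \<gamma> ((u + k) mod p))" if "u < p" "j < p" for u j
    using that(2)
  proof (induction j)
    case 0
    have "f [P u 0] = P u 0 * f [P u 0] + f [P u 0] * P u 0"
      using der[of "P u 0" "P u 0"] by (simp add: P_mult)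
    then have "co (f [P u 0]) u 0 = co (P u 0 * f [P u 0]) u (0 + 0) + co (f [P u 0] * P (u + 0) 0) u (0 + 0)"
      by (metis co_add add.right_neutral)
    also have "\<dots> = co (f [P u 0]) u 0 + co (f [P u 0]) u 0"
      using that p_pos by (subst co_mult_left, simp, simp, subst co_mult_right) auto
    finally have "co (f [P u 0]) u 0 + 0 = co (f [P u 0]) u 0 + co (f [P u 0]) u 0"
      by (simp only: add_0_right)
    then have "co (f [P u 0]) u 0 = 0" by (simp only: add_left_cancel)
    then show ?case by simp
  next
    case (Suc j)
    have "f [P u (j + 1)] = P u j * f [P (u + j) 1] + f [P u j] * P (u + j) 1"
      using der[of "P u j" "P (u + j) 1"] by (simp add: P_mult)
    then have "co (f [P u (j + 1)]) u (j + 1) = co (f [P (u + j) 1]) ((u + j) mod p) 1 + co (f [P u j]) u j"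
      using that Suc.prems by (simp add: co_add co_mult_left[of u j 1, simplified] co_mult_right[of u j 1, simplified])
    also have "co (f [P (u + j) 1]) ((u + j) mod p) 1 = \<gamma> ((u + j) mod p)"
      by (simp add: \<gamma>_def P_mod)
    finally show ?case using Suc by simp
  qed
  \<comment> \<open>Along an arrow \<nu> grows by \<gamma>, except that it falls back to 0 at the
    arrow from \<open>p - 1\<close> to 0; there the total \<open>chi1 f\<close> makes up the
    difference.\<close>
  have tel: "(\<Sum>k<j. \<gamma> ((u + k) mod p)) = chi1 f * cross u j + \<nu> (u + j) - \<nu> u" for u j
  proof (induction j)
    case 0
    then show ?case by (simp add: cross_def)
  next
    case (Suc j)
    define w where "w = (u + j) mod p"
    have D: "chi1 f = (\<Sum>i<p - 1. \<gamma> i) + \<gamma> (p - 1)"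
    proof -
      have "chi1 f = (\<Sum>i<Suc (p - 1). \<gamma> i)" using p_pos by (simp add: chi1_def \<gamma>_def)
      then show ?thesis by simp
    qed
    have "\<gamma> w = chi1 f * of_bool (w = p - 1) + \<nu> (u + Suc j) - \<nu> (u + j)"
    proof (cases "w = p - 1")
      case True
      then have "Suc (u + j) mod p = 0" using p_pos by (simp add: w_def mod_Suc)
      then show ?thesis using True D by (simp add: \<nu>_def w_def)
    next
      case False
      then have "Suc (u + j) mod p = Suc w" using p_pos by (simp add: w_def mod_Suc)
      then show ?thesis using False by (simp add: \<nu>_def w_def)
    qed
    then obtain q where q: "\<gamma> ((u + j) mod p) = chi1 f * q + \<nu> (u + Suc j) - \<nu> (u + j)"
        "cross u (Suc j) = cross u j + q"
      unfolding w_def using cross_Suc by blast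
    show ?case
      by (simp only: sum.lessThan_Suc Suc q) (simp add: algebra_simps)
  qed
  have "f [a] = sc (chi1 f) (xd a) + bar_diff (left_avg f) [a] + (a * c - c * a)" for a
  proof (rule lin_eqI[where x = a])
    show "lin (\<lambda>a. f [a])" by (rule multilin_head[OF mf])
    have "multilin (bar_diff (left_avg f))"
      using f cochain_left_avg[of f] by (intro multilin_bar_diff) (auto simp: cocycle_def cochain_def)
    then show "lin (\<lambda>a. sc (chi1 f) (xd a) + bar_diff (left_avg f) [a] + (a * c - c * a))"
      by (intro lin_intros lin_xd multilin_head)
    fix u j assume u: "u < p" "j < p"
    have "P u j * c = (\<Sum>v<p. P u j * (P v 0 * sc (\<nu> v) 1))"
      unfolding c_def sum_distrib_left by (simp add: sc_mult_right)
    also have "\<dots> = sc (\<nu> (u + j)) (P u j)"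
      unfolding sum_P_delta by (simp add: sc_mult_right \<nu>_def)
    finally have 1: "P u j * c = sc (\<nu> (u + j)) (P u j)" .
    have "c * P u j = (\<Sum>v<p. if v = u then sc (\<nu> v) (P u j) else 0)"
      unfolding c_def sum_distrib_right using u
      by (intro sum.cong refl) (auto simp: sc_mult_left P_mult)
    then have 2: "c * P u j = sc (\<nu> u) (P u j)" using u by simp
    have "P u 0 * f [P u j] = P u 0 * (P u j * f [P (u + j) 0] + f [P u j] * P (u + j) 0)"
      using der[of "P u j" "P (u + j) 0"] by (simp add: P_mult)
    also have "\<dots> = P u j * f [P (u + j) 0] + P u 0 * f [P u j] * P (u + j) 0"
      by (simp add: distrib_left mult.assoc[symmetric] P_mult)
    also have "P u 0 * f [P u j] * P (u + j) 0
        = sc (chi1 f * cross u j + \<nu> (u + j) - \<nu> u) (P u j)"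
      using P_corner[of u j "f [P u j]"] u coeff tel by simp
    finally show "f [P u j] = sc (chi1 f) (xd (P u j)) + bar_diff (left_avg f) [P u j]
        + (P u j * c - c * P u j)"
      using bar_diff_left_avg[OF f u(1), of j "[]"] 1 2
      by (simp add: xd_P sc_add_left sc_diff_left sc_sc)
  qed
  then show ?thesis by blast
qed

theorem cocycle_decomposition:
  assumes f: "cocycle f"
  obtains b where "cochain b" and
    "\<And>l. f l = sc (chi0 f) (unit_cochain l) + sc (chi1 f) (xcup unit_cochain l)
      + wcup (period f) l + bar_diff b l"
proof -
  obtain c where c: "f [a] = sc (chi1 f) (xd a) + bar_diff (left_avg f) [a] + (a * c - c * a)" for a
    using cocycle_singleton[OF f] by blast
  \<comment> \<open>The error terms of the two homotopies cancel in the difference. The value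
    \<open>- c\<close> at the empty list affects degree 1 only, where it produces the commutator
    with \<open>c\<close>.\<close>
  define b where "b = (\<lambda>l. left_avg f l - split_first (- c) f l)"
  have cf: "cochain f" using f by (simp add: cocycle_def)
  then have mf: "multilin f" by (simp add: cochain_def)
  have b: "cochain b"
    unfolding b_def using cf by (intro cochain_minus cochain_left_avg cochain_split_first)
  have db: "bar_diff b l = bar_diff (left_avg f) l - bar_diff (split_first (- c) f) l" for l
    unfolding b_def by (rule bar_diff_diff)
  have mb: "multilin (bar_diff b)" using b by (auto simp: cochain_def intro: multilin_bar_diff)
  have "f l = sc (chi0 f) (unit_cochain l) + sc (chi1 f) (xcup unit_cochain l)
      + wcup (period f) l + bar_diff b l" for l
  proof -
    consider "l = []" | a where "l = [a]" | a1 a2 R where "l = a1 # a2 # R"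
      by (metis list.exhaust)
    then show ?thesis
    proof cases
      case 1
      then show ?thesis using cocycle_Nil[OF f] by (simp add: unit_cochain_def)
    next
      case 2
      then show ?thesis
        using c[of a] by (simp add: unit_cochain_def db bar_diff_Cons[of "split_first (- c) f"])
    next
      case 3
      have eq: "f (P u j # P v l # R) = wind (P u j) (P v l) * period f R + bar_diff b (P u j # P v l # R)"
        if "u < p" "j < p" "v < p" "l < p" for u j v l
        using bar_diff_left_avg[OF f that(1), of j "P v l # R"] bar_diff_split_first[OF f that, of "- c" R]
        by (simp add: db)
      have eq': "f (P u j # a2 # R) = wind (P u j) a2 * period f R + bar_diff b (P u j # a2 # R)"
        if "u < p" "j < p" for u j
        by (rule lin_eqI[where x = a2])
          (auto intro!: lin_intros lin_wind_right multilin_snd[OF mf] multilin_snd[OF mb] eq that)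
      have "f (a1 # a2 # R) = wind a1 a2 * period f R + bar_diff b (a1 # a2 # R)"
        by (rule lin_eqI[where x = a1])
          (auto intro!: lin_intros lin_wind_left multilin_head[OF mf] multilin_head[OF mb] eq')
      then show ?thesis using 3 by (simp add: unit_cochain_def)
    qed
  qed
  with b show ?thesis by (rule that)
qed

end

section \<open>The cohomology algebra\<close>

context cyclic_path_algebra
begin

lemma chi0_unit: "chi0 unit_cochain = 1"
  and chi1_unit: "chi1 unit_cochain = 0"
  and chi0_xcup: "chi0 (xcup h) = 0"
  and chi0_wcup: "chi0 (wcup h) = 0"
  and chi1_wcup: "chi1 (wcup h) = 0"
  and chi1_xcup_xcup: "chi1 (xcup (xcup h)) = 0"
  and chi1_xcup_wcup: "chi1 (xcup (wcup h)) = 0"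
  and chi1_xcup_unit: "chi1 (xcup unit_cochain) = 1"
proof -
  have "co 1 0 0 = (\<Sum>u<p. co (P u 0) 0 0)"
    unfolding sum_P_0[symmetric] by (rule co_sum)
  also have "\<dots> = (\<Sum>u<p. if u = 0 then 1 else 0)"
    using p_pos by (intro sum.cong refl) (auto simp: co_P)
  finally show "chi0 unit_cochain = 1" using p_pos by (simp add: chi0_def unit_cochain_def)
  have "cross u 1 = of_bool (u = p - 1)" if "u < p" for u
    using that by (simp add: cross_def)
  then have "chi1 (xcup unit_cochain) = (\<Sum>u<p. if u = p - 1 then 1 else 0)"
    unfolding chi1_def using p_ge_2
    by (intro sum.cong refl) (auto simp: unit_cochain_def xd_P co_sc co_P)
  also have "\<dots> = 1" using p_pos by simp
  finally show "chi1 (xcup unit_cochain) = 1" .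
qed (auto simp: chi0_def chi1_def unit_cochain_def)

lemma chi0_add: "chi0 (\<lambda>l. f l + g l) = chi0 f + chi0 g"
  and chi1_add: "chi1 (\<lambda>l. f l + g l) = chi1 f + chi1 g"
  and chi0_scale: "chi0 (\<lambda>l. sc c (f l)) = c * chi0 f"
  and chi1_scale: "chi1 (\<lambda>l. sc c (f l)) = c * chi1 f"
  by (auto simp: chi0_def chi1_def co_add co_sc sum.distrib sum_distrib_left)

lemma sum_cyclic_shift: "(\<Sum>u<p. F ((u + 1) mod p)) = (\<Sum>u<p. F u)" for F :: "nat \<Rightarrow> 'k"
proof -
  obtain q where q: "p = Suc q" using p_pos by (cases p) auto
  have "(\<Sum>u<p. F ((u + 1) mod p)) = (\<Sum>u<q. F (Suc u)) + F 0"
    by (simp add: q)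
  then show ?thesis by (simp add: q sum.lessThan_Suc_shift del: sum.lessThan_Suc)
qed

lemma chi0_bar_diff: "chi0 (bar_diff b) = 0"
  by (simp add: chi0_def)

lemma chi1_bar_diff: "chi1 (bar_diff b) = 0"
proof -
  have "co (P u 1 * b []) u 1 = co (b []) ((u + 1) mod p) 0" "co (b [] * P u 1) u 1 = co (b []) u 0"
    if "u < p" for u
    using co_mult_left[of u 1 0 "b []"] co_mult_right[of u 0 1 "b []"] that p_ge_2 by auto
  then have "chi1 (bar_diff b) = (\<Sum>u<p. co (b []) ((u + 1) mod p) 0 - co (b []) u 0)"
    unfolding chi1_def by (intro sum.cong refl) (auto simp: bar_diff_Cons co_diff)
  also have "\<dots> = 0"
    using sum_cyclic_shift[of "\<lambda>u. co (b []) u 0"] by (simp add: sum_subtractf)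
  finally show ?thesis .
qed

text \<open>The generating polynomial of the invariants of the iterates of \<open>period\<close>:
  its coefficient at \<open>m\<close> belongs to w^m. The sequence is finite because
  \<open>period\<close> lowers degrees by 2 and cochains have bounded degree.\<close>

definition class_poly :: "(('a list \<Rightarrow> 'a) \<Rightarrow> 'k) \<Rightarrow> ('a list \<Rightarrow> 'a) \<Rightarrow> 'k poly" where
  "class_poly \<epsilon> z = Abs_poly (\<lambda>m. \<epsilon> ((period ^^ m) z))"

lemma bounded_len_funpow_period:
  "bounded_len N f \<Longrightarrow> bounded_len (N - 2 * m) ((period ^^ m) f)"
  by (induction m) (auto dest: bounded_len_period simp: algebra_simps)

lemma coeff_class_poly:
  assumes f: "cochain f" and z: "\<epsilon> (\<lambda>l. 0) = 0"
  shows "coeff (class_poly \<epsilon> f) m = \<epsilon> ((period ^^ m) f)"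
proof -
  obtain N where N: "bounded_len N f" using f by (auto simp: cochain_def)
  have "\<epsilon> ((period ^^ i) f) = 0" if "i > N" for i
  proof -
    have "bounded_len 0 ((period ^^ i) f)"
      using bounded_len_funpow_period[OF N, of i] that by simp
    then have "(period ^^ i) f = (\<lambda>l. 0)" by (auto simp: bounded_len_def)
    then show ?thesis using z by simp
  qed
  then show ?thesis
    unfolding class_poly_def by (subst coeff_Abs_poly) auto
qed

lemma chi0_zero: "chi0 (\<lambda>l. 0) = 0"
  and chi1_zero: "chi1 (\<lambda>l. 0) = 0"
  by (auto simp: chi0_def chi1_def)

definition even_class :: "('a list \<Rightarrow> 'a) \<Rightarrow> 'k poly" where
  "even_class = class_poly chi0"

definition odd_class :: "('a list \<Rightarrow> 'a) \<Rightarrow> 'k poly" where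
  "odd_class = class_poly chi1"

lemma coeff_even_class: "cochain f \<Longrightarrow> coeff (even_class f) m = chi0 ((period ^^ m) f)"
  and coeff_odd_class: "cochain f \<Longrightarrow> coeff (odd_class f) m = chi1 ((period ^^ m) f)"
  by (auto simp: even_class_def odd_class_def coeff_class_poly chi0_zero chi1_zero)

lemma even_class_pCons: "cochain f \<Longrightarrow> even_class f = pCons (chi0 f) (even_class (period f))"
  by (rule poly_eqI)
    (auto simp: coeff_even_class coeff_pCons cochain_period funpow_swap1 split: nat.splits)

lemma odd_class_pCons: "cochain f \<Longrightarrow> odd_class f = pCons (chi1 f) (odd_class (period f))"
  by (rule poly_eqI)
    (auto simp: coeff_odd_class coeff_pCons cochain_period funpow_swap1 split: nat.splits)

lemma funpow_period_add:
  "(period ^^ m) (\<lambda>l. f l + g l) = (\<lambda>l. (period ^^ m) f l + (period ^^ m) g l)"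
  by (induction m) (auto simp: period_add)

lemma funpow_period_scale: "(period ^^ m) (\<lambda>l. sc c (f l)) = (\<lambda>l. sc c ((period ^^ m) f l))"
  by (induction m) (auto simp: period_scale)

lemma even_class_add: "cochain f \<Longrightarrow> cochain g \<Longrightarrow> even_class (\<lambda>l. f l + g l) = even_class f + even_class g"
  and odd_class_add: "cochain f \<Longrightarrow> cochain g \<Longrightarrow> odd_class (\<lambda>l. f l + g l) = odd_class f + odd_class g"
  by (auto intro!: poly_eqI simp: coeff_even_class coeff_odd_class cochain_plus funpow_period_add
      chi0_add chi1_add)

lemma even_class_scale: "cochain f \<Longrightarrow> even_class (\<lambda>l. sc c (f l)) = Polynomial.smult c (even_class f)"
  and odd_class_scale: "cochain f \<Longrightarrow> odd_class (\<lambda>l. sc c (f l)) = Polynomial.smult c (odd_class f)"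
  by (auto intro!: poly_eqI simp: coeff_even_class coeff_odd_class cochain_scale funpow_period_scale
      chi0_scale chi1_scale)

lemma even_class_zero: "even_class (\<lambda>l. 0) = 0"
  and odd_class_zero: "odd_class (\<lambda>l. 0) = 0"
  using even_class_scale[OF cochain_zero, of 0] odd_class_scale[OF cochain_zero, of 0] by auto

lemma even_class_bar_diff: "cochain b \<Longrightarrow> even_class (bar_diff b) = 0"
  and odd_class_bar_diff: "cochain b \<Longrightarrow> odd_class (bar_diff b) = 0"
proof -
  have *: "cochain b \<Longrightarrow> \<exists>b'. (period ^^ m) (bar_diff b) = bar_diff b' \<and> cochain b'" for b m
  proof (induction m)
    case (Suc m)
    then obtain b' where b': "(period ^^ m) (bar_diff b) = bar_diff b'" "cochain b'" by blast
    have "period (bar_diff b') = bar_diff (period b')"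
      using b' period_bar_diff by (auto simp: cochain_def)
    then show ?case using b' cochain_period by auto
  qed auto
  show "cochain b \<Longrightarrow> even_class (bar_diff b) = 0"
    by (rule poly_eqI) (use *[of b] chi0_bar_diff in \<open>metis coeff_even_class cochain_bar_diff coeff_0\<close>)
  show "cochain b \<Longrightarrow> odd_class (bar_diff b) = 0"
    by (rule poly_eqI) (use *[of b] chi1_bar_diff in \<open>metis coeff_odd_class cochain_bar_diff coeff_0\<close>)
qed

lemma period_wcup_fun: "period (wcup g) = g"
  and period_xcup_xcup_fun: "period (xcup (xcup g)) = (\<lambda>l. 0)"
  and period_xcup_wcup_fun: "period (xcup (wcup g)) = xcup g"
  and period_unit_fun: "period unit_cochain = (\<lambda>l. 0)"
  and period_xcup_unit_fun: "period (xcup unit_cochain) = (\<lambda>l. 0)"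
  by (auto simp: period_wcup period_xcup_xcup period_xcup_wcup period_unit period_xcup_unit)

lemma even_class_wcup: "cochain g \<Longrightarrow> even_class (wcup g) = pCons 0 (even_class g)"
  and odd_class_wcup: "cochain g \<Longrightarrow> odd_class (wcup g) = pCons 0 (odd_class g)"
  using even_class_pCons[of "wcup g"] odd_class_pCons[of "wcup g"]
  by (auto simp: cochain_wcup period_wcup_fun chi0_wcup chi1_wcup)

lemma even_class_unit: "even_class unit_cochain = 1"
  and odd_class_unit: "odd_class unit_cochain = 0"
  and even_class_xcup_unit: "even_class (xcup unit_cochain) = 0"
  and odd_class_xcup_unit: "odd_class (xcup unit_cochain) = 1"
  by (auto simp: even_class_pCons odd_class_pCons cochain_unit cochain_xcup period_unit_fun
      period_xcup_unit_fun chi0_unit chi1_unit chi0_xcup chi1_xcup_unit even_class_zero odd_class_zero one_pCons)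

text \<open>Induction along the decomposition: \<open>period z\<close> lives in lower degrees than
  \<open>z\<close>, so a property of \<open>z\<close> may be derived from the same property of
  \<open>period z\<close>.\<close>

lemma cocycle_bounded_induct [consumes 2, case_names zero step]:
  assumes "cocycle z" and "bounded_len N z"
    and zero: "Q (\<lambda>l. 0)"
    and step: "\<And>z b. cocycle z \<Longrightarrow> cochain b \<Longrightarrow> cocycle (period z) \<Longrightarrow> Q (period z) \<Longrightarrow>
      z = (\<lambda>l. sc (chi0 z) (unit_cochain l) + sc (chi1 z) (xcup unit_cochain l)
        + wcup (period z) l + bar_diff b l) \<Longrightarrow> Q z"
  shows "Q z"
  using assms(1,2)
proof (induction N arbitrary: z rule: less_induct)
  case (less N)
  have cp: "cocycle (period z)"
  proof -
    have "bar_diff (period z) = period (bar_diff z)"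
      using less.prems(1) period_bar_diff by (auto simp: cocycle_def cochain_def)
    also have "bar_diff z = (\<lambda>l. 0)" using less.prems(1) by (auto simp: cocycle_def)
    also have "period (\<lambda>l. 0) = (\<lambda>l. 0)" by (auto simp: period_def path_sum_def)
    finally show ?thesis
      using less.prems(1) cochain_period by (auto simp: cocycle_def)
  qed
  show ?case
  proof (cases "N = 0")
    case True
    then have "z = (\<lambda>l. 0)" using less.prems(2) by (auto simp: bounded_len_def)
    then show ?thesis using zero by simp
  next
    case False
    \<comment> \<open>Truncated subtraction does no harm: for \<open>N = 1\<close> the new bound is
      0, which is still smaller.\<close>
    have "Q (period z)"
      using less.IH[of "N - 2" "period z"] False cp bounded_len_period[OF less.prems(2)] by simp
    obtain b where b: "cochain b" and "\<And>l. z l = sc (chi0 z) (unit_cochain l)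
        + sc (chi1 z) (xcup unit_cochain l) + wcup (period z) l + bar_diff b l"
      using cocycle_decomposition[OF less.prems(1)] by metis
    then have "z = (\<lambda>l. sc (chi0 z) (unit_cochain l) + sc (chi1 z) (xcup unit_cochain l)
        + wcup (period z) l + bar_diff b l)" by auto
    then show ?thesis using step[OF less.prems(1) b cp \<open>Q (period z)\<close>] by simp
  qed
qed

lemma cocycle_induct [consumes 1, case_names zero step]:
  assumes "cocycle z"
    and "Q (\<lambda>l. 0)"
    and "\<And>z b. cocycle z \<Longrightarrow> cochain b \<Longrightarrow> cocycle (period z) \<Longrightarrow> Q (period z) \<Longrightarrow>
      z = (\<lambda>l. sc (chi0 z) (unit_cochain l) + sc (chi1 z) (xcup unit_cochain l)
        + wcup (period z) l + bar_diff b l) \<Longrightarrow> Q z"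
  shows "Q z"
proof -
  obtain N where "bounded_len N z" using assms(1) by (auto simp: cocycle_def cochain_def)
  then show ?thesis
    using cocycle_bounded_induct[where Q = Q and z = z and N = N] assms by blast
qed

lemmas cochain_intros = cochain_zero cochain_plus cochain_minus cochain_scale cochain_unit
  cochain_xcup cochain_wcup cochain_bar_diff cochain_cup cochain_period

text \<open>If both polynomials vanish, then \<open>chi0 z\<close> and \<open>chi1 z\<close> do, and
  inductively \<open>period z\<close> is the differential of some \<open>c\<close>. The
  decomposition then makes \<open>z\<close> the differential of \<open>wcup c\<close> plus
  \<open>b\<close>, as w is a cocycle of even degree.\<close>

theorem coboundary_iff:
  assumes "cocycle z"
  shows "coboundary z \<longleftrightarrow> even_class z = 0 \<and> odd_class z = 0"
proof
  show "coboundary z \<Longrightarrow> even_class z = 0 \<and> odd_class z = 0"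
    by (auto simp: coboundary_def even_class_bar_diff odd_class_bar_diff)
  have "even_class z = 0 \<longrightarrow> odd_class z = 0 \<longrightarrow> coboundary z"
    using assms
  proof (induction rule: cocycle_induct)
    case zero
    then show ?case by (simp add: coboundary_zero)
  next
    case (step z b)
    show ?case
    proof (intro impI)
      assume E: "even_class z = 0" "odd_class z = 0"
      have "cochain z" using step by (simp add: cocycle_def)
      then have 0: "chi0 z = 0" "chi1 z = 0" "even_class (period z) = 0" "odd_class (period z) = 0"
        using E even_class_pCons[of z] odd_class_pCons[of z] by auto
      then obtain c where c: "cochain c" "period z = bar_diff c"
        using step by (auto simp: coboundary_def)
      have "z l = wcup (period z) l + bar_diff b l" for l
        using fun_cong[OF step.hyps(4), of l] 0 by simp
      then have "z = (\<lambda>l. wcup (period z) l + bar_diff b l)" by auto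
      also have "\<dots> = bar_diff (\<lambda>l. wcup c l + b l)"
        by (auto simp: bar_diff_add bar_diff_wcup c)
      finally show "coboundary z"
        unfolding coboundary_def using c step.hyps(2) by (metis cochain_plus cochain_wcup)
    qed
  qed
  then show "even_class z = 0 \<and> odd_class z = 0 \<Longrightarrow> coboundary z" by blast
qed

text \<open>Multiplication by x turns the even part into the odd part and kills the odd part. In the
  decomposition x meets x and w, and \<open>period\<close> resolves both products.\<close>

lemma class_xcup:
  assumes "cocycle h"
  shows "even_class (xcup h) = 0 \<and> odd_class (xcup h) = even_class h"
  using assms
proof (induction rule: cocycle_induct)
  case zero
  have "xcup (\<lambda>l. 0) l = 0" for l by (cases l) auto
  then have "xcup (\<lambda>l. 0) = (\<lambda>l. 0)" by auto
  then show ?case by (simp add: even_class_zero odd_class_zero)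
next
  case (step z b)
  have cp: "cochain (period z)" "cochain z" using step by (auto simp: cocycle_def)
  have "xcup z = xcup (\<lambda>l. sc (chi0 z) (unit_cochain l) + sc (chi1 z) (xcup unit_cochain l)
        + wcup (period z) l + bar_diff b l)"
    using step.hyps(4) by (rule arg_cong)
  also have "\<dots> = (\<lambda>l. sc (chi0 z) (xcup unit_cochain l) + sc (chi1 z) (xcup (xcup unit_cochain) l)
        + xcup (wcup (period z)) l + sc (- 1) (bar_diff (xcup b) l))"
    by (auto simp: xcup_add xcup_scale bar_diff_xcup sc_minus_left)
  finally have eq: "xcup z = \<dots>" .
  have xx: "even_class (xcup (xcup unit_cochain)) = 0" "odd_class (xcup (xcup unit_cochain)) = 0"
    by (auto simp: even_class_pCons odd_class_pCons cochain_intros period_xcup_xcup_fun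
        chi0_xcup chi1_xcup_xcup even_class_zero odd_class_zero)
  have xw: "even_class (xcup (wcup (period z))) = 0"
      "odd_class (xcup (wcup (period z))) = pCons 0 (even_class (period z))"
    using step cp by (auto simp: even_class_pCons[of "xcup (wcup (period z))"]
        odd_class_pCons[of "xcup (wcup (period z))"] cochain_intros period_xcup_wcup_fun
        chi0_xcup chi1_xcup_wcup)
  have "even_class z = pCons (chi0 z) (even_class (period z))"
    by (rule even_class_pCons) fact
  then show ?case
    unfolding eq using step cp
    by (simp add: even_class_add odd_class_add even_class_scale odd_class_scale cochain_intros
        even_class_bar_diff odd_class_bar_diff even_class_xcup_unit odd_class_xcup_unit xx xw one_pCons)
qed

text \<open>The unit, x, w and coboundaries as left factors have known effects on the class of
  \<open>h\<close>, so an induction over the left factor suffices and \<open>h\<close> is never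
  decomposed.\<close>

theorem class_cup:
  assumes "cocycle z" and h: "cocycle h"
  shows "even_class (cup z h) = even_class z * even_class h
    \<and> odd_class (cup z h) = even_class z * odd_class h + odd_class z * even_class h"
  using assms(1)
proof (induction rule: cocycle_induct)
  case zero
  have "cup (\<lambda>l. 0) h = (\<lambda>l. 0)" by auto
  then show ?case by (simp add: even_class_zero odd_class_zero)
next
  case (step z b)
  have c: "cochain (period z)" "cochain z" "cochain h" using step h by (auto simp: cocycle_def)
  have "cup z h = cup (\<lambda>l. sc (chi0 z) (unit_cochain l) + sc (chi1 z) (xcup unit_cochain l)
        + wcup (period z) l + bar_diff b l) h"
    using step.hyps(4) by (rule arg_cong)
  also have "\<dots> = (\<lambda>l. sc (chi0 z) (h l) + sc (chi1 z) (xcup h l)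
        + wcup (cup (period z) h) l + bar_diff (cup b h) l)"
  proof
    have "cup unit_cochain h = h" by (auto simp: cup_unit)
    then show "cup (\<lambda>l. sc (chi0 z) (unit_cochain l) + sc (chi1 z) (xcup unit_cochain l)
        + wcup (period z) l + bar_diff b l) h l = sc (chi0 z) (h l) + sc (chi1 z) (xcup h l)
        + wcup (cup (period z) h) l + bar_diff (cup b h) l" for l
      by (simp add: cup_add_left sc_cup_left cup_xcup cup_wcup cup_bar_diff_left[OF h])
  qed
  finally have eq: "cup z h = \<dots>" .
  have "even_class z = pCons (chi0 z) (even_class (period z))"
      "odd_class z = pCons (chi1 z) (odd_class (period z))"
    using c even_class_pCons odd_class_pCons by blast+
  then show ?case
    unfolding eq using step c class_xcup[OF h]
    by (simp add: even_class_add odd_class_add even_class_scale odd_class_scale cochain_intros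
        even_class_bar_diff odd_class_bar_diff even_class_wcup odd_class_wcup mult_pCons_left
        smult_add_right algebra_simps)
qed

section \<open>Standard representatives and the grading\<close>

definition wpow :: "nat \<Rightarrow> 'a list \<Rightarrow> 'a" where
  "wpow m = (wcup ^^ m) unit_cochain"

definition xwpow :: "nat \<Rightarrow> 'a list \<Rightarrow> 'a" where
  "xwpow m = (wcup ^^ m) (xcup unit_cochain)"

lemma cocycle_wpow: "cocycle (wpow m)"
  and cocycle_xwpow: "cocycle (xwpow m)"
  by (induction m) (auto simp: wpow_def xwpow_def intro: cocycle_unit cocycle_xcup cocycle_wcup)

lemma class_wpow: "even_class (wpow m) = monom 1 m \<and> odd_class (wpow m) = 0"
  and class_xwpow: "even_class (xwpow m) = 0 \<and> odd_class (xwpow m) = monom 1 m"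
proof (induction m)
  case 0
  {
    case 1
    then show ?case by (simp add: wpow_def even_class_unit odd_class_unit)
  next
    case 2
    then show ?case by (simp add: xwpow_def even_class_xcup_unit odd_class_xcup_unit)
  }
next
  case (Suc m)
  have "wpow (Suc m) = wcup (wpow m)" "xwpow (Suc m) = wcup (xwpow m)"
    "cochain (wpow m)" "cochain (xwpow m)"
    using cocycle_wpow cocycle_xwpow by (auto simp: wpow_def xwpow_def cocycle_def)
  with Suc show "even_class (wpow (Suc m)) = monom 1 (Suc m) \<and> odd_class (wpow (Suc m)) = 0"
    "even_class (xwpow (Suc m)) = 0 \<and> odd_class (xwpow (Suc m)) = monom 1 (Suc m)"
    by (simp_all add: even_class_wcup odd_class_wcup monom_Suc)
qed

lemma wcup_length: "(\<And>l. length l \<noteq> n \<Longrightarrow> h l = 0) \<Longrightarrow> length l \<noteq> n + 2 \<Longrightarrow> wcup h l = 0"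
  by (cases "(h, l)" rule: wcup.cases) auto

lemma wpow_length: "length l \<noteq> 2 * m \<Longrightarrow> wpow m l = 0"
proof (induction m arbitrary: l)
  case (Suc m)
  then show ?case using wcup_length[of "2 * m" "wpow m" l] by (simp add: wpow_def)
qed (simp add: wpow_def unit_cochain_def)

lemma xwpow_length: "length l \<noteq> 2 * m + 1 \<Longrightarrow> xwpow m l = 0"
proof (induction m arbitrary: l)
  case 0
  then show ?case by (cases l) (auto simp: xwpow_def unit_cochain_def)
next
  case (Suc m)
  then show ?case using wcup_length[of "2 * m + 1" "xwpow m" l] by (simp add: xwpow_def)
qed

lemma funpow_period_length:
  assumes "\<And>l. length l \<noteq> n \<Longrightarrow> f l = 0" and "length l + 2 * m \<noteq> n"
  shows "(period ^^ m) f l = 0"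
  using assms(2)
proof (induction m arbitrary: l)
  case (Suc m)
  then show ?case by (simp add: period_def path_sum_def)
qed (use assms(1) in simp)

lemma class_homogeneous:
  assumes f: "cochain f" and n: "\<And>l. length l \<noteq> n \<Longrightarrow> f l = 0"
  shows "coeff (even_class f) m \<noteq> 0 \<Longrightarrow> n = 2 * m"
    and "coeff (odd_class f) m \<noteq> 0 \<Longrightarrow> n = 2 * m + 1"
proof -
  assume "coeff (even_class f) m \<noteq> 0"
  then have "(period ^^ m) f [] \<noteq> 0" by (auto simp: coeff_even_class[OF f] chi0_def)
  then show "n = 2 * m" using funpow_period_length[of n f "[]" m] n by auto
next
  assume "coeff (odd_class f) m \<noteq> 0"
  then have "\<exists>u. (period ^^ m) f [P u 1] \<noteq> 0"
    by (auto simp: coeff_odd_class[OF f] chi1_def) (metis (mono_tags, lifting) co_zero sum.neutral)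
  then obtain u where "(period ^^ m) f [P u 1] \<noteq> 0" by blast
  then show "n = 2 * m + 1" using funpow_period_length[of n f "[P u 1]" m] n by auto
qed

definition standard_cocycle :: "'k poly \<Rightarrow> 'k poly \<Rightarrow> 'a list \<Rightarrow> 'a" where
  "standard_cocycle q r l = (\<Sum>m\<le>degree q. sc (coeff q m) (wpow m l))
     + (\<Sum>m\<le>degree r. sc (coeff r m) (xwpow m l))"

lemma cocycle_Sum: "(\<And>i. i \<in> I \<Longrightarrow> cocycle (f i)) \<Longrightarrow> cocycle (\<lambda>l. \<Sum>i\<in>I. f i l)"
  by (induction I rule: infinite_finite_induct) (auto intro: cocycle_zero cocycle_plus)

lemma even_class_Sum: "(\<And>i. i \<in> I \<Longrightarrow> cochain (f i)) \<Longrightarrow>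
    even_class (\<lambda>l. \<Sum>i\<in>I. f i l) = (\<Sum>i\<in>I. even_class (f i))"
  and odd_class_Sum: "(\<And>i. i \<in> I \<Longrightarrow> cochain (f i)) \<Longrightarrow>
    odd_class (\<lambda>l. \<Sum>i\<in>I. f i l) = (\<Sum>i\<in>I. odd_class (f i))"
  by (induction I rule: infinite_finite_induct)
    (auto simp: even_class_add odd_class_add even_class_zero odd_class_zero cochain_Sum)

lemma standard_cocycle:
  shows "cocycle (standard_cocycle q r)"
    and "even_class (standard_cocycle q r) = q" and "odd_class (standard_cocycle q r) = r"
proof -
  have c: "cochain (wpow m)" "cochain (xwpow m)" for m
    using cocycle_wpow cocycle_xwpow by (auto simp: cocycle_def)
  have eq: "standard_cocycle q r = (\<lambda>l. (\<Sum>m\<le>degree q. sc (coeff q m) (wpow m l))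
     + (\<Sum>m\<le>degree r. sc (coeff r m) (xwpow m l)))"
    by (auto simp: standard_cocycle_def)
  show "cocycle (standard_cocycle q r)"
    unfolding eq by (intro cocycle_plus cocycle_Sum cocycle_scale cocycle_wpow cocycle_xwpow)
  have cc: "cochain (\<lambda>l. \<Sum>m\<le>degree q. sc (coeff q m) (wpow m l))"
     "cochain (\<lambda>l. \<Sum>m\<le>degree r. sc (coeff r m) (xwpow m l))"
    by (intro cochain_Sum cochain_scale c)+
  show "even_class (standard_cocycle q r) = q"
    unfolding eq
    by (simp add: even_class_add cc even_class_Sum cochain_scale c even_class_scale class_wpow class_xwpow
        smult_monom poly_as_sum_of_monoms)
  show "odd_class (standard_cocycle q r) = r"
    unfolding eq
    by (simp add: odd_class_add cc odd_class_Sum cochain_scale c odd_class_scale class_wpow class_xwpow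
        smult_monom poly_as_sum_of_monoms)
qed

lemma cocycle_standard:
  assumes z: "cocycle z"
  obtains b where "cochain b"
    and "z = (\<lambda>l. standard_cocycle (even_class z) (odd_class z) l + bar_diff b l)"
proof -
  let ?s = "standard_cocycle (even_class z) (odd_class z)"
  have c: "cocycle (\<lambda>l. z l + sc (- 1) (?s l))" "cochain z" "cochain ?s"
    using z standard_cocycle(1) cocycle_plus cocycle_scale by (auto simp: cocycle_def)
  have "even_class (\<lambda>l. z l + sc (- 1) (?s l)) = 0" "odd_class (\<lambda>l. z l + sc (- 1) (?s l)) = 0"
    using c by (auto simp: even_class_add odd_class_add even_class_scale odd_class_scale cochain_scale
        standard_cocycle)
  then obtain b where b: "cochain b" "(\<lambda>l. z l + sc (- 1) (?s l)) = bar_diff b"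
    using coboundary_iff[OF c(1)] by (auto simp: coboundary_def)
  then have "z = (\<lambda>l. ?s l + bar_diff b l)"
    by (auto simp: fun_eq_iff sc_minus_left algebra_simps)
  with b(1) show ?thesis by (rule that)
qed

end

section \<open>Weights of the torus action\<close>

context cyclic_path_algebra
begin

text \<open>The automorphism given by the grading by path length. The torus element with parameter s
  will act with r = s^(-2), the weight of an arrow.\<close>

definition act :: "'k \<Rightarrow> 'a \<Rightarrow> 'a" where
  "act r = lin_ext (\<lambda>u j. sc (r ^ j) (P u j))"

definition conj_action :: "'k \<Rightarrow> ('a list \<Rightarrow> 'a) \<Rightarrow> 'a list \<Rightarrow> 'a" where
  "conj_action r f l = act r (f (map (act (inverse r)) l))"

lemma lin_act: "lin (act r)"
  unfolding act_def by (rule lin_lin_ext)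

lemmas act_add = lin_add[OF lin_act] and act_sc = lin_sc[OF lin_act]
  and act_zero = lin_zero[OF lin_act] and act_sum = lin_sum[OF lin_act]

lemma act_minus: "act r (- x) = - act r x"
  using act_sc[of r "- 1" x] by (simp add: sc_minus_left)

lemma act_diff: "act r (x - y) = act r x - act r y"
  using act_add[of r x "- y"] by (simp add: act_minus)

lemma act_P: "act r (P u j) = sc (r ^ j) (P u j)"
  by (auto simp: act_def lin_ext_P P_mod P_ge)

lemma act_mult: "act r (x * y) = act r x * act r y"
proof -
  have *: "act r (P u j * y) = act r (P u j) * act r y" for u j
    by (rule lin_eqI[where x = y])
      (auto intro!: lin_intros lin_compose[OF lin_act] lin_act
        simp: P_mult act_P sc_mult_left sc_mult_right sc_sc power_add mult.commute act_zero)
  show ?thesis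
    by (rule lin_eqI[where x = x]) (auto intro!: lin_intros lin_compose[OF lin_act] lin_act *)
qed

lemma act_act: "act r (act s x) = act (r * s) x"
  by (rule lin_eqI[where x = x])
    (auto intro!: lin_compose[OF lin_act] lin_act simp: act_P act_sc sc_sc power_mult_distrib mult.commute)

lemma act_1: "act 1 x = x"
  by (rule lin_eqI[where x = x]) (auto intro!: lin_intros lin_act simp: act_P)

lemma act_inverse: "r \<noteq> 0 \<Longrightarrow> act r (act (inverse r) x) = x"
  by (simp add: act_act act_1)

lemma co_act: "u < p \<Longrightarrow> j < p \<Longrightarrow> co (act r x) u j = r ^ j * co x u j"
proof -
  assume uj: "u < p" "j < p"
  have "sc (co (act r x) u j) (P u j) = sc (r ^ j * co x u j) (P u j)"
  proof (rule lin_eqI[where x = x])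
    show "lin (\<lambda>x. sc (co (act r x) u j) (P u j))" "lin (\<lambda>x. sc (r ^ j * co x u j) (P u j))"
      by (auto intro!: linI simp: act_add act_sc co_add co_sc sc_add_left sc_sc algebra_simps)
  qed (use uj in \<open>auto simp: act_P co_sc co_P\<close>)
  then have "co (sc (co (act r x) u j) (P u j)) u j = co (sc (r ^ j * co x u j) (P u j)) u j" by simp
  then show ?thesis using uj by (simp add: co_sc co_P)
qed

lemma right_diff_conj_action:
  assumes "r \<noteq> 0"
  shows "right_diff (conj_action r f) l = conj_action r (right_diff f) l"
proof (induction l arbitrary: f)
  case (Cons a l)
  have mh: "merge_head (conj_action r f) a l = act r (merge_head f (act (inverse r) a) (map (act (inverse r)) l))"
    using assms by (cases l) (auto simp: conj_action_def act_mult act_inverse)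
  have eq: "(\<lambda>l. conj_action r f (a # l)) = conj_action r (\<lambda>l. f (act (inverse r) a # l))"
    by (auto simp: conj_action_def)
  show ?case
    unfolding right_diff.simps(2) mh eq Cons by (simp add: conj_action_def act_diff act_minus)
qed (simp add: conj_action_def act_zero)

lemma bar_diff_conj_action:
  assumes "r \<noteq> 0"
  shows "bar_diff (conj_action r f) l = conj_action r (bar_diff f) l"
proof -
  have "left_diff (conj_action r f) l = conj_action r (left_diff f) l"
    using assms by (cases l) (auto simp: conj_action_def act_mult act_inverse act_zero)
  moreover have "conj_action r (bar_diff f) l = conj_action r (left_diff f) l + conj_action r (right_diff f) l"
    by (simp add: conj_action_def bar_diff_def act_add)
  ultimately show ?thesis
    using right_diff_conj_action[OF assms] by (simp add: bar_diff_def)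
qed

lemma cochain_conj_action: "cochain f \<Longrightarrow> cochain (conj_action r f)"
proof -
  assume f: "cochain f"
  then have "multilin (conj_action r f)"
    unfolding multilin_def conj_action_def cochain_def
    by (auto intro!: lin_compose[OF lin_act] lin_compose[OF _ lin_act])
  moreover obtain N where "bounded_len N f" using f by (auto simp: cochain_def)
  then have "bounded_len N (conj_action r f)" by (auto simp: bounded_len_def conj_action_def act_zero)
  ultimately show ?thesis by (auto simp: cochain_def)
qed

lemma cocycle_conj_action: "r \<noteq> 0 \<Longrightarrow> cocycle f \<Longrightarrow> cocycle (conj_action r f)"
  unfolding cocycle_def
  by (auto simp: cochain_conj_action bar_diff_conj_action) (simp add: conj_action_def act_zero)

lemma conj_action_add: "conj_action r (\<lambda>l. f l + g l) l = conj_action r f l + conj_action r g l"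
  and conj_action_sc: "conj_action r (\<lambda>l. sc c (f l)) l = sc c (conj_action r f l)"
  by (auto simp: conj_action_def act_add act_sc)

text \<open>The arrow and the tail contribute the power \<open>p - k\<close> of the inverse of
  \<open>r\<close>, and pulling the prefix into \<open>act r\<close> contributes the power
  \<open>k\<close>. The total does not depend on the cut.\<close>

lemma period_conj_action:
  assumes "r \<noteq> 0" and f: "multilin f"
  shows "period (conj_action r f) R = sc (inverse r ^ p) (conj_action r (period f) R)"
proof -
  have *: "P v k * conj_action r f (P (v + k) 1 # P (v + k + 1) (p - 1 - k) # R)
    = sc (inverse r ^ p) (act r (P v k * f (P (v + k) 1 # P (v + k + 1) (p - 1 - k) # map (act (inverse r)) R)))"
    if "k < p" for v k
  proof -
    let ?x = "f (P (v + k) 1 # P (v + k + 1) (p - 1 - k) # map (act (inverse r)) R)"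
    have "f (map (act (inverse r)) (P (v + k) 1 # P (v + k + 1) (p - 1 - k) # R))
      = sc (inverse r ^ 1 * inverse r ^ (p - 1 - k)) ?x"
      using lin_sc[OF multilin_head[OF f]] lin_sc[OF multilin_snd[OF f]]
      by (simp only: list.map act_P) (simp add: sc_sc mult.commute)
    also have "inverse r ^ 1 * inverse r ^ (p - 1 - k) = inverse r ^ (p - k)"
      using that by (simp only: power_add[symmetric]) (simp add: Suc_diff_Suc)
    finally have "P v k * conj_action r f (P (v + k) 1 # P (v + k + 1) (p - 1 - k) # R)
      = sc (inverse r ^ (p - k)) (P v k * act r ?x)"
      by (simp only: conj_action_def act_sc sc_mult_right)
    also have "P v k * act r ?x = sc (inverse r ^ k) (act r (P v k * ?x))"
      using assms(1) by (simp add: act_mult act_P sc_mult_left sc_sc power_mult_distrib[symmetric])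
    finally show ?thesis
      using that by (simp add: sc_sc power_add[symmetric])
  qed
  then show ?thesis
    by (simp add: period_def path_sum_def conj_action_def[of r "\<lambda>R. \<Sum>v<p. _ v R"] act_sum
        sc_sum_right conj_action_def[of r "period f"])
qed

lemma funpow_period_conj_action:
  assumes "r \<noteq> 0" and f: "multilin f"
  shows "(period ^^ m) (conj_action r f) = (\<lambda>R. sc ((inverse r ^ p) ^ m) (conj_action r ((period ^^ m) f) R))"
proof (induction m)
  case (Suc m)
  have "multilin ((period ^^ m) f)" by (induction m) (auto simp: f multilin_period)
  then show ?case
    using assms(1) by (simp add: Suc period_scale period_conj_action sc_sc mult.commute)
qed simp

lemma chi0_conj_action: "chi0 (conj_action r f) = chi0 f"
  using p_pos by (simp add: chi0_def conj_action_def co_act)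

lemma chi1_conj_action: "r \<noteq> 0 \<Longrightarrow> multilin f \<Longrightarrow> chi1 (conj_action r f) = chi1 f"
  unfolding chi1_def using p_ge_2
  by (intro sum.cong refl)
    (simp add: conj_action_def co_act act_P lin_sc[OF multilin_head] co_sc)

lemma coeff_class_conj_action:
  assumes "r \<noteq> 0" and f: "cochain f"
  shows "coeff (even_class (conj_action r f)) m = (inverse r ^ p) ^ m * coeff (even_class f) m"
    and "coeff (odd_class (conj_action r f)) m = (inverse r ^ p) ^ m * coeff (odd_class f) m"
proof -
  have mf: "multilin f" using f by (simp add: cochain_def)
  then have "multilin ((period ^^ m) f)" by (induction m) (auto simp: multilin_period)
  then show "coeff (even_class (conj_action r f)) m = (inverse r ^ p) ^ m * coeff (even_class f) m"
      "coeff (odd_class (conj_action r f)) m = (inverse r ^ p) ^ m * coeff (odd_class f) m"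
    using assms by (simp_all add: coeff_even_class coeff_odd_class cochain_conj_action
        funpow_period_conj_action[OF assms(1) mf] chi0_scale chi1_scale chi0_conj_action chi1_conj_action)
qed

lemma act_wind:
  assumes "r \<noteq> 0"
  shows "act r (wind (act (inverse r) a) (act (inverse r) b)) = sc (inverse r ^ p) (wind a b)"
proof -
  note lin_comp = lin_compose[OF lin_act] lin_compose[OF lin_wind_left lin_act]
    lin_compose[OF lin_wind_right lin_act]
  have *: "act r (wind (act (inverse r) (P u j)) (act (inverse r) (P v l))) = sc (inverse r ^ p) (wind (P u j) (P v l))"
    for u j v l
  proof (cases "j < p \<and> l < p \<and> (u + j) mod p = v mod p \<and> p \<le> j + l")
    case True
    then have "inverse r ^ j * inverse r ^ l * r ^ (j + l - p) = inverse r ^ p * (inverse r ^ (j + l - p) * r ^ (j + l - p))"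
      by (simp only: power_add[symmetric] mult.assoc[symmetric]) simp
    also have "\<dots> = inverse r ^ p"
      using assms by (simp add: power_mult_distrib[symmetric])
    finally show ?thesis
      using True by (simp add: act_P lin_sc[OF lin_wind_left] lin_sc[OF lin_wind_right] act_sc sc_sc wind_P mult_ac)
  next
    case False
    then have "wind (P u j) (P v l) = 0" by (auto simp: wind_P)
    then show ?thesis
      by (simp add: act_P lin_sc[OF lin_wind_left] lin_sc[OF lin_wind_right] act_sc act_zero)
  qed
  have "act r (wind (act (inverse r) (P u j)) (act (inverse r) b)) = sc (inverse r ^ p) (wind (P u j) b)" for u j
    by (rule lin_eqI[where x = b])
      (auto intro!: lin_comp lin_intros lin_wind_right simp: *)
  then show ?thesis
    by (intro lin_eqI[where x = a and \<phi> = "\<lambda>a. act r (wind (act (inverse r) a) (act (inverse r) b))"])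
      (auto intro!: lin_comp lin_intros lin_wind_left)
qed

lemma act_xd:
  assumes "r \<noteq> 0" shows "act r (xd (act (inverse r) a)) = xd a"
proof (rule lin_eqI[where x = a])
  fix u j
  have "inverse r ^ j * cross u j * r ^ j = cross u j"
    using assms by (simp add: power_inverse)
  then show "act r (xd (act (inverse r) (P u j))) = xd (P u j)"
    by (simp only: act_P lin_sc[OF lin_xd] xd_P act_sc sc_sc)
qed (auto intro!: lin_compose[OF lin_act] lin_compose[OF lin_xd lin_act] lin_xd)

lemma conj_action_wcup:
  "r \<noteq> 0 \<Longrightarrow> conj_action r (wcup h) l = sc (inverse r ^ p) (wcup (conj_action r h) l)"
  by (cases "(h, l)" rule: wcup.cases)
    (auto simp: conj_action_def act_mult act_wind act_zero sc_mult_left)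

lemma conj_action_xcup: "r \<noteq> 0 \<Longrightarrow> conj_action r (xcup h) l = xcup (conj_action r h) l"
  by (cases l) (auto simp: conj_action_def act_mult act_xd act_zero)

lemma act_one: "act r 1 = 1"
  unfolding sum_P_0[symmetric] by (simp only: act_sum act_P) simp

lemma conj_action_unit: "conj_action r unit_cochain l = unit_cochain l"
  by (cases l) (auto simp: conj_action_def unit_cochain_def act_zero act_one)

lemma wcup_scale: "wcup (\<lambda>l. sc c (f l)) l = sc c (wcup f l)"
  by (cases "(f, l)" rule: wcup.cases) (auto simp: sc_mult_right)

lemma conj_action_wpow: "r \<noteq> 0 \<Longrightarrow> conj_action r (wpow m) = (\<lambda>l. sc ((inverse r ^ p) ^ m) (wpow m l))"
  and conj_action_xwpow: "r \<noteq> 0 \<Longrightarrow> conj_action r (xwpow m) = (\<lambda>l. sc ((inverse r ^ p) ^ m) (xwpow m l))"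
proof (induction m)
  case 0
  {
    case 1
    then show ?case by (auto simp: wpow_def conj_action_unit)
  next
    case 2
    have "conj_action r unit_cochain = unit_cochain" by (auto simp: conj_action_unit)
    with 2 show ?case by (auto simp: xwpow_def conj_action_xcup)
  }
next
  case (Suc m)
  {
    case 1
    then show ?case
      using Suc(1) by (auto simp: wpow_def conj_action_wcup wcup_scale sc_sc)
  next
    case 2
    then show ?case
      using Suc(2) by (auto simp: xwpow_def conj_action_wcup wcup_scale sc_sc)
  }
qed

section \<open>Decomposition of cochains into weight components\<close>

definition proj :: "nat \<Rightarrow> 'a \<Rightarrow> 'a" where
  "proj i = lin_ext (\<lambda>u j. if j = i then P u j else 0)"

lemma lin_proj: "lin (proj i)"
  unfolding proj_def by (rule lin_lin_ext)

lemma act_eq_proj: "act r x = (\<Sum>i<p. sc (r ^ i) (proj i x))"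
  by (rule lin_eqI[where x = x])
    (auto intro!: lin_act lin_intros lin_lin_ext
      simp: act_P proj_def lin_ext_P P_mod if_distrib[of "sc _"] cong: if_cong)

text \<open>The component that raises the total path length by \<open>n\<close>. The recursion adds
  the lengths of the arguments to \<open>n\<close>; at the end of the list the accumulated number is
  the length required of the value.\<close>

fun weight_part :: "('a list \<Rightarrow> 'a) \<Rightarrow> int \<Rightarrow> 'a list \<Rightarrow> 'a" where
  "weight_part f n [] = (if 0 \<le> n \<and> n < int p then proj (nat n) (f []) else 0)"
| "weight_part f n (a # l) = (\<Sum>j<p. weight_part (\<lambda>l. f (proj j a # l)) (n + int j) l)"

lemma weight_part_add: "weight_part (\<lambda>l. f l + g l) n l = weight_part f n l + weight_part g n l"
  by (induction l arbitrary: f g n) (auto simp: lin_add[OF lin_proj] sum.distrib)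

lemma weight_part_scale: "weight_part (\<lambda>l. sc c (f l)) n l = sc c (weight_part f n l)"
  by (induction l arbitrary: f n) (auto simp: lin_sc[OF lin_proj] sc_sum_right)

lemma multilin_weight_part:
  assumes "multilin f" shows "multilin (weight_part f n)"
  unfolding multilin_def
proof (intro allI)
  fix as bs show "lin (\<lambda>x. weight_part f n (as @ x # bs))"
    using assms
  proof (induction as arbitrary: f n)
    case Nil
    have "lin (\<lambda>x. weight_part (\<lambda>l. f (proj j x # l)) (n + int j) bs)" for j
      by (intro linI) (simp_all add: lin_add[OF lin_proj] lin_sc[OF lin_proj] multilin_Cons_add[OF Nil]
          multilin_Cons_sc[OF Nil] weight_part_add weight_part_scale)
    then show ?case by (auto intro!: lin_intros)
  next
    case (Cons a as)
    then show ?case using multilin_Cons[OF Cons.prems] by (auto intro!: lin_intros)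
  qed
qed

lemma bounded_len_weight_part: "bounded_len N f \<Longrightarrow> bounded_len N (weight_part f n)"
  unfolding bounded_len_def[of N "weight_part f n"]
proof (intro allI impI)
  fix l :: "'a list" assume "bounded_len N f" "N \<le> length l"
  then show "weight_part f n l = 0"
  proof (induction l arbitrary: f n N)
    case Nil
    then show ?case by (auto simp: bounded_len_def lin_zero[OF lin_proj])
  next
    case (Cons a l)
    have "weight_part (\<lambda>l. f (proj j a # l)) m l = 0" for j m
      using Cons.IH[OF bounded_len_Cons[OF Cons.prems(1), of "proj j a"]] Cons.prems(2) by simp
    then show ?case by simp
  qed
qed

lemma cochain_weight_part: "cochain f \<Longrightarrow> cochain (weight_part f n)"
  by (auto simp: cochain_def intro: multilin_weight_part bounded_len_weight_part)

text \<open>The arguments can only increase the index, and a value has no component of length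
  \<open>p\<close> or more.\<close>

lemma weight_part_ge: "int p \<le> n \<Longrightarrow> weight_part f n l = 0"
  by (induction l arbitrary: f n) auto

text \<open>The action is a Laurent polynomial in \<open>r\<close>. Its range of exponents is a
  parameter \<open>K\<close> for two reasons: the induction subtracts the length of the first
  argument from it, and one range must later serve lists of different lengths.\<close>

lemma conj_action_weight_part:
  assumes r: "r \<noteq> 0" and "multilin f" and "int (p * length l) \<le> K"
  shows "conj_action r f l = (\<Sum>n\<in>{- K..int p}. sc (r powi n) (weight_part f n l))"
  using assms(2,3)
proof (induction l arbitrary: f K)
  case Nil
  have "(\<Sum>n\<in>{- K..int p}. sc (r powi n) (weight_part f n [])) =
     (\<Sum>n\<in>int ` {..<p}. sc (r powi n) (weight_part f n []))"
    using Nil image_atLeastZeroLessThan_int[of "int p"]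
    by (intro sum.mono_neutral_right) (auto simp flip: image_atLeastZeroLessThan_int)
  also have "\<dots> = (\<Sum>i<p. sc (r ^ i) (proj i (f [])))"
    by (subst sum.reindex) auto
  also have "\<dots> = conj_action r f []" by (simp add: conj_action_def act_eq_proj)
  finally show ?case by simp
next
  case (Cons a l)
  let ?f = "\<lambda>j l. f (proj j a # l)"
  have mf: "multilin (?f j)" for j using multilin_Cons[OF Cons.prems(1)] .
  have "conj_action r f (a # l) = conj_action r (\<lambda>l. f ((\<Sum>j<p. sc (inverse r ^ j) (proj j a)) # l)) l"
    by (simp add: conj_action_def act_eq_proj[symmetric])
  also have "(\<lambda>l. f ((\<Sum>j<p. sc (inverse r ^ j) (proj j a)) # l)) = (\<lambda>l. \<Sum>j<p. sc (inverse r ^ j) (?f j l))"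
    by (auto simp: lin_sum[OF multilin_head[OF Cons.prems(1)]] lin_sc[OF multilin_head[OF Cons.prems(1)]])
  also have "conj_action r \<dots> l = (\<Sum>j<p. sc (inverse r ^ j) (conj_action r (?f j) l))"
    by (simp add: conj_action_def act_sum act_sc)
  also have "\<dots> = (\<Sum>j<p. \<Sum>n\<in>{- K..int p}. sc (r powi n) (weight_part (?f j) (n + int j) l))"
  proof (rule sum.cong[OF refl])
    fix j assume "j \<in> {..<p}"
    then have "int (p * length l) \<le> K - int j" using Cons.prems(2) by simp
    from Cons.IH[OF mf this, of j]
    have "sc (inverse r ^ j) (conj_action r (?f j) l)
      = (\<Sum>n\<in>{- (K - int j)..int p}. sc (r powi (n - int j)) (weight_part (?f j) n l))"
      using r by (simp add: sc_sum_right sc_sc power_int_diff field_simps)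
    also have "\<dots> = (\<Sum>n\<in>{- (K - int j)..int p + int j}. sc (r powi (n - int j)) (weight_part (?f j) n l))"
      by (intro sum.mono_neutral_left) (auto simp: weight_part_ge)
    also have "\<dots> = (\<Sum>n\<in>{- K..int p}. sc (r powi n) (weight_part (?f j) (n + int j) l))"
      by (rule sum.reindex_bij_witness[of _ "\<lambda>n. n + int j" "\<lambda>n. n - int j"]) auto
    finally show "sc (inverse r ^ j) (conj_action r (?f j) l)
      = (\<Sum>n\<in>{- K..int p}. sc (r powi n) (weight_part (?f j) (n + int j) l))" .
  qed
  also have "\<dots> = (\<Sum>n\<in>{- K..int p}. sc (r powi n) (weight_part f n (a # l)))"
    by (subst sum.swap) (simp add: sc_sum_right)
  finally show ?case .
qed

text \<open>\<open>averages t X x\<close> says that applying a functional with the values \<open>t n\<close> on the characters \<open>r\<^sup>n\<close>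
  to the coefficients of \<open>X\<close> gives \<open>x\<close>. Only the values at \<open>r \<noteq> 0\<close> matter.\<close>

inductive averages :: "(int \<Rightarrow> 'k) \<Rightarrow> ('k \<Rightarrow> 'a) \<Rightarrow> 'a \<Rightarrow> bool" for t where
  monomial: "averages t (\<lambda>r. sc (r powi n) x) (sc (t n) x)"
| plus: "averages t X x \<Longrightarrow> averages t Y y \<Longrightarrow> averages t (\<lambda>r. X r + Y r) (x + y)"
| cong_nonzero: "averages t X x \<Longrightarrow> (\<And>r. r \<noteq> 0 \<Longrightarrow> X r = Y r) \<Longrightarrow> averages t Y x"

lemma averages_zero: "averages t (\<lambda>r. 0) 0"
  using monomial[of t 0 0] by simp

lemma averages_sum:
  "(\<And>i. i \<in> I \<Longrightarrow> averages t (X i) (x i)) \<Longrightarrow> averages t (\<lambda>r. \<Sum>i\<in>I. X i r) (\<Sum>i\<in>I. x i)"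
  by (induction I rule: infinite_finite_induct) (auto intro: averages_zero averages.plus)

text \<open>On the standard cocycles only the exponents \<open>- int (p * m)\<close> occur, where
  the functional has the value \<open>c\<close>. On the remaining differential of \<open>b\<close>
  it acts through the weight components of \<open>b\<close>, so the outcome is again a differential.
  The condition on \<open>t\<close> is what a distribution on T_1 satisfies.\<close>

theorem averages_cocycle:
  assumes z: "cocycle z" and t: "\<And>m. t (- int (p * m)) = c"
  obtains g where "coboundary g" and "\<And>l. averages t (\<lambda>r. conj_action r z l) (sc c (z l) + g l)"
proof -
  let ?q = "even_class z" and ?o = "odd_class z"
  obtain b where b: "cochain b" and zb: "z = (\<lambda>l. standard_cocycle ?q ?o l + bar_diff b l)"
    using cocycle_standard[OF z] by metis
  obtain N where N: "bounded_len N b" and mb: "multilin b" using b by (auto simp: cochain_def)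
  \<comment> \<open>One range of exponents for all lists, so that \<open>g1\<close> is a single
    cochain; on lists longer than \<open>N\<close> both \<open>b\<close> and its components
    vanish.\<close>
  define K where "K = int (p * N)"
  define g1 where "g1 = (\<lambda>l. \<Sum>n\<in>{- K..int p}. sc (t n) (weight_part b n l))"
  have e: "(inverse r ^ p) ^ m = r powi (- int (p * m))" if "r \<noteq> 0" for r :: 'k and m
    by (simp only: power_int_minus power_int_of_nat power_mult power_inverse)
  have "averages t (\<lambda>r. conj_action r (\<lambda>l. sc a (wpow m l)) l) (sc c (sc a (wpow m l)))" for a m l
  proof (rule averages.cong_nonzero)
    show "averages t (\<lambda>r. sc (r powi (- int (p * m))) (sc a (wpow m l))) (sc c (sc a (wpow m l)))"
      using monomial[of t "- int (p * m)"] t by simp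
  qed (simp add: conj_action_sc conj_action_wpow e sc_sc mult.commute)
  moreover have "averages t (\<lambda>r. conj_action r (\<lambda>l. sc a (xwpow m l)) l) (sc c (sc a (xwpow m l)))" for a m l
  proof (rule averages.cong_nonzero)
    show "averages t (\<lambda>r. sc (r powi (- int (p * m))) (sc a (xwpow m l))) (sc c (sc a (xwpow m l)))"
      using monomial[of t "- int (p * m)"] t by simp
  qed (simp add: conj_action_sc conj_action_xwpow e sc_sc mult.commute)
  ultimately have std: "averages t (\<lambda>r. conj_action r (standard_cocycle ?q ?o) l) (sc c (standard_cocycle ?q ?o l))" for l
  proof -
    assume *: "\<And>a m l. averages t (\<lambda>r. conj_action r (\<lambda>l. sc a (wpow m l)) l) (sc c (sc a (wpow m l)))"
      "\<And>a m l. averages t (\<lambda>r. conj_action r (\<lambda>l. sc a (xwpow m l)) l) (sc c (sc a (xwpow m l)))"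
    have "averages t (\<lambda>r. (\<Sum>m\<le>degree ?q. conj_action r (\<lambda>l. sc (coeff ?q m) (wpow m l)) l)
        + (\<Sum>m\<le>degree ?o. conj_action r (\<lambda>l. sc (coeff ?o m) (xwpow m l)) l))
        ((\<Sum>m\<le>degree ?q. sc c (sc (coeff ?q m) (wpow m l))) + (\<Sum>m\<le>degree ?o. sc c (sc (coeff ?o m) (xwpow m l))))"
      by (intro averages.plus averages_sum *)
    then show ?thesis
      by (simp add: conj_action_def standard_cocycle_def act_add act_sum sc_add_right sc_sum_right)
  qed
  have weight: "conj_action r b l = (\<Sum>n\<in>{- K..int p}. sc (r powi n) (weight_part b n l))"
    if "r \<noteq> 0" for r l
  proof (cases "length l \<le> N")
    case True
    then have "int (p * length l) \<le> K" by (simp add: K_def mult_left_mono)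
    then show ?thesis by (rule conj_action_weight_part[OF that mb])
  next
    case False
    then show ?thesis
      using N bounded_len_weight_part[OF N] by (simp add: bounded_len_def conj_action_def act_zero)
  qed
  have db: "averages t (\<lambda>r. conj_action r (bar_diff b) l) (bar_diff g1 l)" for l
  proof (rule averages.cong_nonzero)
    have "bar_diff g1 l = (\<Sum>n\<in>{- K..int p}. sc (t n) (bar_diff (weight_part b n) l))"
      unfolding g1_def bar_diff_sum by (simp add: sc_bar_diff)
    then show "averages t (\<lambda>r. \<Sum>n\<in>{- K..int p}. sc (r powi n) (bar_diff (weight_part b n) l)) (bar_diff g1 l)"
      by (simp add: averages_sum monomial)
    fix r :: 'k assume r: "r \<noteq> 0"
    have "conj_action r (bar_diff b) l = bar_diff (conj_action r b) l"
      using bar_diff_conj_action[OF r] by simp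
    also have "conj_action r b = (\<lambda>l. \<Sum>n\<in>{- K..int p}. sc (r powi n) (weight_part b n l))"
      using weight[OF r] by auto
    finally show "(\<Sum>n\<in>{- K..int p}. sc (r powi n) (bar_diff (weight_part b n) l)) = conj_action r (bar_diff b) l"
      by (simp add: bar_diff_sum sc_bar_diff)
  qed
  \<comment> \<open>The functional sends the differential of \<open>b\<close> to that of
    \<open>g1\<close>, whereas the target \<open>sc c (z l)\<close> contains \<open>c\<close> times
    the differential of \<open>b\<close>; \<open>g\<close> is the discrepancy.\<close>
  define g where "g = (\<lambda>l. bar_diff g1 l - sc c (bar_diff b l))"
  have "cochain g1" unfolding g1_def by (intro cochain_Sum cochain_scale cochain_weight_part b)
  then have "coboundary g"
    unfolding g_def by (intro coboundary_minus coboundary_scale coboundary_bar_diff b)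
  moreover have "averages t (\<lambda>r. conj_action r z l) (sc c (z l) + g l)" for l
  proof -
    have "averages t (\<lambda>r. conj_action r (standard_cocycle ?q ?o) l + conj_action r (bar_diff b) l)
      (sc c (standard_cocycle ?q ?o l) + bar_diff g1 l)"
      by (intro averages.plus std db)
    moreover have "conj_action r z l = conj_action r (standard_cocycle ?q ?o) l + conj_action r (bar_diff b) l" for r
      by (subst zb) (rule conj_action_add)
    moreover have "sc c (z l) + g l = sc c (standard_cocycle ?q ?o l) + bar_diff g1 l"
      by (subst zb) (simp add: g_def sc_add_right)
    ultimately show ?thesis by simp
  qed
  ultimately show ?thesis by (rule that)
qed

end

section \<open>Transport from an algebra record to a type\<close>

text \<open>The record is only required to correspond to the type under a bijection that respects
  the operations. All algebraic laws of the record are pulled back from the type.\<close>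

locale algebra_model = scaled_ring sc
  for sc :: "'k::field \<Rightarrow> 'a::{ring, monoid_mult} \<Rightarrow> 'a" +
  fixes A :: "('k, 'b) module" and \<psi> :: "'b \<Rightarrow> 'a"
  assumes bij_model: "bij_betw \<psi> (carrier A) UNIV"
    and zero_closed: "\<zero>\<^bsub>A\<^esub> \<in> carrier A" and model_zero: "\<psi> \<zero>\<^bsub>A\<^esub> = 0"
    and one_closed: "\<one>\<^bsub>A\<^esub> \<in> carrier A" and model_one: "\<psi> \<one>\<^bsub>A\<^esub> = 1"
    and add_closed: "x \<in> carrier A \<Longrightarrow> y \<in> carrier A \<Longrightarrow> x \<oplus>\<^bsub>A\<^esub> y \<in> carrier A"
    and model_add: "x \<in> carrier A \<Longrightarrow> y \<in> carrier A \<Longrightarrow> \<psi> (x \<oplus>\<^bsub>A\<^esub> y) = \<psi> x + \<psi> y"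
    and mult_closed: "x \<in> carrier A \<Longrightarrow> y \<in> carrier A \<Longrightarrow> x \<otimes>\<^bsub>A\<^esub> y \<in> carrier A"
    and model_mult: "x \<in> carrier A \<Longrightarrow> y \<in> carrier A \<Longrightarrow> \<psi> (x \<otimes>\<^bsub>A\<^esub> y) = \<psi> x * \<psi> y"
    and smult_closed: "x \<in> carrier A \<Longrightarrow> c \<odot>\<^bsub>A\<^esub> x \<in> carrier A"
    and model_smult: "x \<in> carrier A \<Longrightarrow> \<psi> (c \<odot>\<^bsub>A\<^esub> x) = sc c (\<psi> x)"
begin

lemmas closed = zero_closed one_closed add_closed mult_closed smult_closed
lemmas model = model_zero model_one model_add model_mult model_smult

definition unmodel :: "'a \<Rightarrow> 'b" where
  "unmodel = inv_into (carrier A) \<psi>"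

lemma unmodel_closed [simp]: "unmodel x \<in> carrier A"
  unfolding unmodel_def using bij_model by (metis bij_betw_def inv_into_into UNIV_I)

lemma model_unmodel [simp]: "\<psi> (unmodel x) = x"
  unfolding unmodel_def using bij_model by (metis bij_betw_def f_inv_into_f UNIV_I)

lemma unmodel_model [simp]: "x \<in> carrier A \<Longrightarrow> unmodel (\<psi> x) = x"
  unfolding unmodel_def using bij_model by (metis bij_betw_def inv_into_f_f)

lemma model_eqI: "x \<in> carrier A \<Longrightarrow> y \<in> carrier A \<Longrightarrow> \<psi> x = \<psi> y \<Longrightarrow> x = y"
  by (metis unmodel_model)

lemma unmodel_eqI: "x \<in> carrier A \<Longrightarrow> \<psi> x = y \<Longrightarrow> unmodel y = x"
  using unmodel_model by blast

lemma unmodel_add: "unmodel (x + y) = unmodel x \<oplus>\<^bsub>A\<^esub> unmodel y"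
  and unmodel_mult: "unmodel (x * y) = unmodel x \<otimes>\<^bsub>A\<^esub> unmodel y"
  and unmodel_sc: "unmodel (sc c x) = c \<odot>\<^bsub>A\<^esub> unmodel x"
  and unmodel_zero: "unmodel 0 = \<zero>\<^bsub>A\<^esub>"
  and unmodel_one: "unmodel 1 = \<one>\<^bsub>A\<^esub>"
  by (auto intro!: unmodel_eqI simp: closed model)

lemma abelian_monoid_model: "abelian_monoid A"
  by (rule abelian_monoidI) (auto intro!: model_eqI simp: closed model algebra_simps)

lemma unmodel_sum: "finite I \<Longrightarrow> unmodel (\<Sum>i\<in>I. f i) = (\<Oplus>\<^bsub>A\<^esub>i\<in>I. unmodel (f i))"
proof (induction I rule: finite_induct)
  case empty
  then show ?case by (simp add: abelian_monoid.finsum_empty[OF abelian_monoid_model] unmodel_zero)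
next
  case (insert i I)
  then show ?case
    using abelian_monoid.finsum_insert[OF abelian_monoid_model, of I i "\<lambda>i. unmodel (f i)"]
    by (simp add: unmodel_add)
qed

text \<open>Zero outside the carrier is the convention of \<open>hoch_cochains\<close>; it makes
  \<open>lift\<close> a bijection between the cochains of the type and those of the record.\<close>

definition lift :: "('a list \<Rightarrow> 'a) \<Rightarrow> 'b list \<Rightarrow> 'b" where
  "lift f as = (if set as \<subseteq> carrier A then unmodel (f (map \<psi> as)) else \<zero>\<^bsub>A\<^esub>)"

definition lower :: "('b list \<Rightarrow> 'b) \<Rightarrow> 'a list \<Rightarrow> 'a" where
  "lower z l = \<psi> (z (map unmodel l))"

lemma map_model_unmodel [simp]: "map \<psi> (map unmodel l) = l"
  by (induction l) auto

lemma map_unmodel_model: "set as \<subseteq> carrier A \<Longrightarrow> map unmodel (map \<psi> as) = as"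
  by (induction as) auto

lemma lower_lift: "lower (lift f) = f"
  by (rule ext) (auto simp: lower_def lift_def map_model_unmodel[unfolded map_map] simp flip: map_map)

lemma lift_inject: "lift f = lift g \<longleftrightarrow> f = g"
  by (metis lower_lift)

lemma lift_closed: "lift f as \<in> carrier A"
  by (auto simp: lift_def closed)

lemma lift_cochain:
  assumes "cochain f" shows "lift f \<in> hoch_cochains A"
proof -
  obtain N where N: "bounded_len N f" and f: "multilin f" using assms by (auto simp: cochain_def)
  have "N \<le> length as \<Longrightarrow> lift f as = \<zero>\<^bsub>A\<^esub>" for as
    using N by (auto simp: lift_def bounded_len_def unmodel_zero)
  moreover have "lift f (as @ (x \<oplus>\<^bsub>A\<^esub> y) # bs) = lift f (as @ x # bs) \<oplus>\<^bsub>A\<^esub> lift f (as @ y # bs)"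
    if "x \<in> carrier A" "y \<in> carrier A" "set as \<subseteq> carrier A" "set bs \<subseteq> carrier A" for as bs x y
    using that lin_add[OF multilinD[OF f]] by (simp add: lift_def closed model unmodel_add)
  moreover have "lift f (as @ (c \<odot>\<^bsub>A\<^esub> x) # bs) = c \<odot>\<^bsub>A\<^esub> lift f (as @ x # bs)"
    if "x \<in> carrier A" "set as \<subseteq> carrier A" "set bs \<subseteq> carrier A" for as bs c x
    using that lin_sc[OF multilinD[OF f]] by (simp add: lift_def closed model unmodel_sc)
  moreover have "\<not> set as \<subseteq> carrier A \<Longrightarrow> lift f as = \<zero>\<^bsub>A\<^esub>" for as
    by (simp add: lift_def)
  ultimately show ?thesis
    unfolding hoch_cochains_def using lift_closed by blast
qed

lemma lift_lower:
  assumes "z \<in> hoch_cochains A" shows "lift (lower z) = z"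
proof
  fix as show "lift (lower z) as = z as"
  proof (cases "set as \<subseteq> carrier A")
    case True
    then have "z as \<in> carrier A" using assms by (auto simp: hoch_cochains_def)
    then show ?thesis using True map_unmodel_model[OF True] by (simp add: lift_def lower_def)
  next
    case False
    then show ?thesis using assms by (auto simp: lift_def hoch_cochains_def)
  qed
qed

lemma cochain_lower:
  assumes "z \<in> hoch_cochains A" shows "cochain (lower z)"
proof -
  have c: "set (map unmodel l) \<subseteq> carrier A" for l by auto
  have zc: "z (map unmodel l) \<in> carrier A" for l
    using assms c[of l] by (auto simp: hoch_cochains_def simp del: set_map)
  obtain N where N: "N \<le> length as \<Longrightarrow> z as = \<zero>\<^bsub>A\<^esub>" for as
    using assms by (auto simp: hoch_cochains_def)
  have add: "z (as @ (x \<oplus>\<^bsub>A\<^esub> y) # bs) = z (as @ x # bs) \<oplus>\<^bsub>A\<^esub> z (as @ y # bs)"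
    if "x \<in> carrier A" "y \<in> carrier A" "set as \<subseteq> carrier A" "set bs \<subseteq> carrier A" for as bs x y
    using assms that by (simp add: hoch_cochains_def)
  have sc: "z (as @ (c \<odot>\<^bsub>A\<^esub> x) # bs) = c \<odot>\<^bsub>A\<^esub> z (as @ x # bs)"
    if "x \<in> carrier A" "set as \<subseteq> carrier A" "set bs \<subseteq> carrier A" for as bs c x
    using assms that by (simp add: hoch_cochains_def)
  have "multilin (lower z)"
    unfolding multilin_def
  proof (intro allI linI)
    fix as bs x y c
    have m: "z (map unmodel as @ unmodel w # map unmodel bs) \<in> carrier A" for w
      using zc[of "as @ w # bs"] by simp
    show "lower z (as @ (x + y) # bs) = lower z (as @ x # bs) + lower z (as @ y # bs)"
      using add[OF unmodel_closed unmodel_closed c c] m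
      by (auto simp: lower_def unmodel_add model)
    show "lower z (as @ sc c x # bs) = sc c (lower z (as @ x # bs))"
      using sc[OF unmodel_closed c c] m
      by (auto simp: lower_def unmodel_sc model)
  qed
  moreover have "bounded_len N (lower z)" by (auto simp: bounded_len_def lower_def N model)
  ultimately show ?thesis by (auto simp: cochain_def)
qed

lemma hoch_cochains_eq: "hoch_cochains A = lift ` {f. cochain f}"
  using lift_cochain lift_lower cochain_lower by (force simp: image_iff)

text \<open>This unrolls the recursion into the alternating sum used by \<open>hoch_d\<close>. Each
  peeled head shifts the positions by one, which accounts for the sign.\<close>

lemma right_diff_eq_sum:
  "l \<noteq> [] \<Longrightarrow> right_diff f l = (\<Sum>i\<in>{1..<length l}. sc ((- 1) ^ i)
      (f (take (i - 1) l @ (l ! (i - 1) * l ! i) # drop (i + 1) l)))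
    + sc ((- 1) ^ length l) (f (butlast l) * last l)"
proof (induction l arbitrary: f)
  case (Cons a m)
  show ?case
  proof (cases m)
    case Nil
    then show ?thesis by (simp add: sc_minus_left)
  next
    case (Cons b m')
    let ?g = "\<lambda>i. sc ((- 1) ^ i) (f (take (i - 1) (a # m) @ ((a # m) ! (i - 1) * (a # m) ! i) # drop (i + 1) (a # m)))"
    have "sum ?g {1..<length (a # m)} = ?g 1 + sum ?g {Suc 1..<Suc (length m)}"
      using Cons by (subst sum.atLeast_Suc_lessThan) auto
    also have "sum ?g {Suc 1..<Suc (length m)} = (\<Sum>i\<in>{1..<length m}. ?g (Suc i))"
      by (rule sum.shift_bounds_Suc_ivl)
    also have "\<dots> = - (\<Sum>i\<in>{1..<length m}. sc ((- 1) ^ i)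
      (f (a # take (i - 1) m @ (m ! (i - 1) * m ! i) # drop (i + 1) m)))"
      unfolding sum_negf[symmetric]
      by (intro sum.cong refl) (auto simp: sc_minus_left take_Cons nth_Cons split: nat.splits)
    finally show ?thesis
      using Cons Cons.IH[of "\<lambda>l. f (a # l)"] by (simp add: sc_minus_left)
  qed
qed simp

lemma hoch_d_lift: "hoch_d A (lift f) = lift (bar_diff f)"
proof
  fix as
  show "hoch_d A (lift f) as = lift (bar_diff f) as"
  proof (cases "set as \<subseteq> carrier A \<and> as \<noteq> []")
    case False
    then show ?thesis by (auto simp: hoch_d_def lift_def unmodel_zero)
  next
    case True
    then have as: "set as \<subseteq> carrier A" "as \<noteq> []" by auto
    have nth: "as ! i \<in> carrier A" if "i < length as" for i using as that by (auto dest: nth_mem)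
    have hl: "hd as \<in> carrier A" "last as \<in> carrier A" "set (tl as) \<subseteq> carrier A" "set (butlast as) \<subseteq> carrier A"
      using as by (auto dest: list.set_sel(2) in_set_butlastD)
    let ?l = "map \<psi> as"
    have t: "lift f (take (i - 1) as @ (as ! (i - 1) \<otimes>\<^bsub>A\<^esub> as ! i) # drop (i + 1) as)
      = unmodel (f (take (i - 1) ?l @ (?l ! (i - 1) * ?l ! i) # drop (i + 1) ?l))"
      if "i \<in> {1..<length as}" for i
      using that nth as(1) set_take_subset[of "i - 1" as] set_drop_subset[of "i + 1" as]
      by (auto simp: lift_def closed model take_map drop_map)
    have "bar_diff f ?l = hd ?l * f (tl ?l) + right_diff f ?l"
      using as by (cases as) (auto simp: bar_diff_def)
    then have "unmodel (bar_diff f ?l) = (hd as \<otimes>\<^bsub>A\<^esub> lift f (tl as))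
        \<oplus>\<^bsub>A\<^esub> (unmodel (\<Sum>i\<in>{1..<length ?l}. sc ((- 1) ^ i)
      (f (take (i - 1) ?l @ (?l ! (i - 1) * ?l ! i) # drop (i + 1) ?l)))
        \<oplus>\<^bsub>A\<^esub> (((-1) ^ length as) \<odot>\<^bsub>A\<^esub> (lift f (butlast as) \<otimes>\<^bsub>A\<^esub> last as)))"
      using as hl by (simp add: right_diff_eq_sum unmodel_add unmodel_mult unmodel_sc lift_def
          hd_map last_map map_tl map_butlast)
    also have "unmodel (\<Sum>i\<in>{1..<length ?l}. sc ((- 1) ^ i)
      (f (take (i - 1) ?l @ (?l ! (i - 1) * ?l ! i) # drop (i + 1) ?l)))
      = (\<Oplus>\<^bsub>A\<^esub>i\<in>{1..<length as}. ((-1) ^ i) \<odot>\<^bsub>A\<^esub> lift f (take (i - 1) as @ (as ! (i - 1) \<otimes>\<^bsub>A\<^esub> as ! i) # drop (i + 1) as))"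
      unfolding unmodel_sum[OF finite_atLeastLessThan] unmodel_sc length_map
      by (rule abelian_monoid.finsum_cong'[OF abelian_monoid_model refl])
        (use t in \<open>auto simp: closed lift_closed\<close>)
    finally show ?thesis
      using as by (simp add: hoch_d_def lift_def[of "bar_diff f"])
        (rule model_eqI; simp add: closed lift_closed model hl add.assoc
          abelian_monoid.finsum_closed[OF abelian_monoid_model])
  qed
qed

lemma cup_eq_sum: "cup f g l = (\<Sum>i\<in>{0..length l}. f (take i l) * g (drop i l))"
proof (induction l arbitrary: f)
  case (Cons a l)
  have "(\<Sum>i\<in>{0..length (a # l)}. f (take i (a # l)) * g (drop i (a # l)))
    = f [] * g (a # l) + (\<Sum>i\<in>{0..length l}. f (a # take i l) * g (drop i l))"
    by (simp add: sum.atLeast0_atMost_Suc_shift del: sum.atLeast0_atMost_Suc sum.cl_ivl_Suc)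
  then show ?case using Cons by simp
qed simp

lemma hoch_cup_lift: "hoch_cup A (lift f) (lift g) = lift (cup f g)"
proof
  fix as
  show "hoch_cup A (lift f) (lift g) as = lift (cup f g) as"
  proof (cases "set as \<subseteq> carrier A")
    case True
    have "unmodel (cup f g (map \<psi> as)) = (\<Oplus>\<^bsub>A\<^esub>i\<in>{0..length as}. unmodel (f (take i (map \<psi> as)) * g (drop i (map \<psi> as))))"
      by (simp add: cup_eq_sum unmodel_sum)
    also have "\<dots> = (\<Oplus>\<^bsub>A\<^esub>i\<in>{0..length as}. lift f (take i as) \<otimes>\<^bsub>A\<^esub> lift g (drop i as))"
    proof (rule abelian_monoid.finsum_cong'[OF abelian_monoid_model refl])
      fix i
      show "unmodel (f (take i (map \<psi> as)) * g (drop i (map \<psi> as))) = lift f (take i as) \<otimes>\<^bsub>A\<^esub> lift g (drop i as)"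
        using True set_take_subset[of i as] set_drop_subset[of i as]
        by (auto simp: lift_def unmodel_mult take_map drop_map)
    qed (auto simp: closed lift_closed)
    finally show ?thesis using True by (simp add: hoch_cup_def lift_def[of "cup f g"])
  qed (auto simp: hoch_cup_def lift_def)
qed

lemma hoch_cocycles_eq: "hoch_cocycles A = lift ` {f. cocycle f}"
proof -
  have "(\<forall>as. hoch_d A (lift f) as = \<zero>\<^bsub>A\<^esub>) \<longleftrightarrow> (\<forall>l. bar_diff f l = 0)" for f
  proof -
    have "(\<forall>as. hoch_d A (lift f) as = \<zero>\<^bsub>A\<^esub>) \<longleftrightarrow> lift (bar_diff f) = lift (\<lambda>l. 0)"
      by (auto simp: hoch_d_lift fun_eq_iff) (auto simp: lift_def unmodel_zero)
    then show ?thesis by (auto simp: lift_inject)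
  qed
  then show ?thesis
    by (auto simp: hoch_cocycles_def hoch_cochains_eq cocycle_def)
qed

lemma hoch_coboundaries_eq: "hoch_coboundaries A = lift ` {f. coboundary f}"
  by (auto simp: hoch_coboundaries_def hoch_cochains_eq coboundary_def hoch_d_lift image_iff)

lemma add_zero_zero: "\<zero>\<^bsub>A\<^esub> \<oplus>\<^bsub>A\<^esub> \<zero>\<^bsub>A\<^esub> = \<zero>\<^bsub>A\<^esub>"
  and smult_zero: "c \<odot>\<^bsub>A\<^esub> \<zero>\<^bsub>A\<^esub> = \<zero>\<^bsub>A\<^esub>"
  by (rule model_eqI; simp add: closed model)+

lemma lift_add: "(\<lambda>as. lift f as \<oplus>\<^bsub>A\<^esub> lift g as) = lift (\<lambda>l. f l + g l)"
  by (auto simp: lift_def unmodel_add fun_eq_iff add_zero_zero)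

lemma lift_sc: "(\<lambda>as. c \<odot>\<^bsub>A\<^esub> lift f as) = lift (\<lambda>l. sc c (f l))"
  by (auto simp: lift_def unmodel_sc fun_eq_iff smult_zero)

definition cls :: "('a list \<Rightarrow> 'a) \<Rightarrow> ('b list \<Rightarrow> 'b) set" where
  "cls f = lift ` {\<lambda>l. b l + f l | b. coboundary b}"

lemma hoch_class_lift: "hoch_class A (lift f) = cls f"
  by (auto simp: hoch_class_def a_r_coset_def' hoch_cocycle_algebra_def hoch_coboundaries_eq lift_add cls_def)

lemma mem_cls: "lift f \<in> cls g \<longleftrightarrow> coboundary (\<lambda>l. f l - g l)"
proof
  assume "lift f \<in> cls g"
  then obtain b where "coboundary b" "f = (\<lambda>l. b l + g l)" by (auto simp: cls_def lift_inject)
  then show "coboundary (\<lambda>l. f l - g l)" by simp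
next
  assume "coboundary (\<lambda>l. f l - g l)"
  then show "lift f \<in> cls g"
    unfolding cls_def by (intro image_eqI[of _ _ f] CollectI exI[of _ "\<lambda>l. f l - g l"]) auto
qed

lemma cls_elim:
  assumes "z \<in> cls g" and "cocycle g"
  obtains f where "z = lift f" and "cocycle f" and "coboundary (\<lambda>l. f l - g l)"
proof -
  obtain b where "coboundary b" "z = lift (\<lambda>l. b l + g l)" using assms by (auto simp: cls_def)
  then show ?thesis using that[of "\<lambda>l. b l + g l"] assms by (auto intro: cocycle_plus coboundary_cocycle)
qed

lemma lift_mem_cls: "lift f \<in> cls f"
  by (simp add: mem_cls coboundary_zero)

lemma cls_eq_iff: "cls f = cls g \<longleftrightarrow> coboundary (\<lambda>l. f l - g l)"
proof
  show "cls f = cls g \<Longrightarrow> coboundary (\<lambda>l. f l - g l)"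
    using lift_mem_cls[of f] by (simp add: mem_cls)
  have sub: "cls f \<subseteq> cls g" if "coboundary (\<lambda>l. f l - g l)" for f g
  proof
    fix z assume "z \<in> cls f"
    then obtain b where b: "coboundary b" "z = lift (\<lambda>l. b l + f l)" by (auto simp: cls_def)
    have "coboundary (\<lambda>l. b l + (f l - g l))" using b that by (intro coboundary_plus)
    then show "z \<in> cls g" by (simp add: b mem_cls algebra_simps)
  qed
  assume c: "coboundary (\<lambda>l. f l - g l)"
  then have "coboundary (\<lambda>l. g l - f l)"
    using coboundary_scale[OF c, of "- 1"] by (simp add: sc_minus_left)
  then show "cls f = cls g" using sub c by blast
qed

lemma carrier_HH: "carrier (HH A) = cls ` {f. cocycle f}"
  by (auto simp: HH_def ring.defs module.defs FactRing_def A_RCOSETS_def' hoch_class_lift[symmetric]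
      hoch_class_def hoch_cocycles_eq image_iff) (auto simp: hoch_cocycle_algebra_def hoch_cocycles_eq)

end

context algebra_model
begin

text \<open>The union over all representatives collapses once every representative gives the same
  coset.\<close>

lemma hoch_induced_cls:
  assumes f: "cocycle f"
    and op: "\<And>f'. cocycle f' \<Longrightarrow> coboundary (\<lambda>l. f' l - f l) \<Longrightarrow> hoch_class A (op (lift f')) = X"
  shows "hoch_induced A op (cls f) = X"
proof -
  have "hoch_class A (op z) = X" if z: "z \<in> cls f" for z
    using cls_elim[OF z f] op by metis
  then show ?thesis unfolding hoch_induced_def using lift_mem_cls[of f] by blast
qed

lemma HH_add:
  assumes "cocycle f" and "cocycle g"
  shows "cls f \<oplus>\<^bsub>HH A\<^esub> cls g = cls (\<lambda>l. f l + g l)"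
proof -
  have "cls f \<oplus>\<^bsub>HH A\<^esub> cls g = (\<Union>h\<in>cls f. \<Union>k\<in>cls g. {\<lambda>as. h as \<oplus>\<^bsub>A\<^esub> k as})"
    by (simp add: HH_def ring.defs module.defs FactRing_def set_add_def' hoch_cocycle_algebra_def)
  also have "\<dots> = cls (\<lambda>l. f l + g l)"
  proof (intro equalityI subsetI)
    fix z assume "z \<in> (\<Union>h\<in>cls f. \<Union>k\<in>cls g. {\<lambda>as. h as \<oplus>\<^bsub>A\<^esub> k as})"
    then obtain h k where h: "h \<in> cls f" and k: "k \<in> cls g" and z: "z = (\<lambda>as. h as \<oplus>\<^bsub>A\<^esub> k as)" by blast
    obtain f' g' where "h = lift f'" "coboundary (\<lambda>l. f' l - f l)" "k = lift g'" "coboundary (\<lambda>l. g' l - g l)"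
      using cls_elim[OF h assms(1)] cls_elim[OF k assms(2)] by metis
    then show "z \<in> cls (\<lambda>l. f l + g l)"
      using coboundary_plus[of "\<lambda>l. f' l - f l" "\<lambda>l. g' l - g l"]
      by (simp add: z lift_add mem_cls add_diff_add)
  next
    fix z assume "z \<in> cls (\<lambda>l. f l + g l)"
    then obtain b where b: "coboundary b" "z = lift (\<lambda>l. b l + (f l + g l))" by (auto simp: cls_def)
    have "z = (\<lambda>as. lift (\<lambda>l. b l + f l) as \<oplus>\<^bsub>A\<^esub> lift g as)"
      by (simp add: lift_add b add.assoc)
    moreover have "lift (\<lambda>l. b l + f l) \<in> cls f" using b by (simp add: mem_cls)
    ultimately show "z \<in> (\<Union>h\<in>cls f. \<Union>k\<in>cls g. {\<lambda>as. h as \<oplus>\<^bsub>A\<^esub> k as})"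
      using lift_mem_cls[of g] by blast
  qed
  finally show ?thesis .
qed

lemma HH_one: "\<one>\<^bsub>HH A\<^esub> = cls (\<lambda>l. if l = [] then 1 else 0)"
proof -
  have "(\<lambda>as. if as = [] then \<one>\<^bsub>A\<^esub> else \<zero>\<^bsub>A\<^esub>) = lift (\<lambda>l. if l = [] then 1 else 0)"
    by (auto simp: lift_def fun_eq_iff unmodel_one unmodel_zero)
  then show ?thesis
    by (simp add: HH_def ring.defs module.defs FactRing_def hoch_class_lift[symmetric] hoch_class_def)
      (simp add: hoch_cocycle_algebra_def)
qed

lemma HH_smult:
  assumes "cocycle f"
  shows "c \<odot>\<^bsub>HH A\<^esub> cls f = cls (\<lambda>l. sc c (f l))"
proof -
  have "c \<odot>\<^bsub>HH A\<^esub> cls f = hoch_induced A (\<lambda>z as. c \<odot>\<^bsub>A\<^esub> z as) (cls f)"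
    by (simp add: HH_def ring.defs module.defs)
  also have "\<dots> = cls (\<lambda>l. sc c (f l))"
  proof (rule hoch_induced_cls[OF assms])
    fix f' assume "cocycle f'" "coboundary (\<lambda>l. f' l - f l)"
    then show "hoch_class A (\<lambda>as. c \<odot>\<^bsub>A\<^esub> lift f' as) = cls (\<lambda>l. sc c (f l))"
      using coboundary_scale[of "\<lambda>l. f' l - f l" c]
      by (simp add: lift_sc hoch_class_lift cls_eq_iff sc_diff_right)
  qed
  finally show ?thesis .
qed

text \<open>Independence of the representatives is left as a premise, because a coboundary as right
  factor is treated only through the classification of classes.\<close>

lemma HH_mult:
  assumes f: "cocycle f" and g: "cocycle g"
    and cup_cong: "\<And>f' g'. cocycle f' \<Longrightarrow> cocycle g' \<Longrightarrow> coboundary (\<lambda>l. f' l - f l) \<Longrightarrow>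
      coboundary (\<lambda>l. g' l - g l) \<Longrightarrow> coboundary (\<lambda>l. cup f' g' l - cup f g l)"
  shows "cls f \<otimes>\<^bsub>HH A\<^esub> cls g = cls (cup f g)"
proof -
  have "cls f \<otimes>\<^bsub>HH A\<^esub> cls g = (\<Union>h\<in>cls f. \<Union>k\<in>cls g. hoch_class A (hoch_cup A h k))"
    by (simp add: HH_def ring.defs module.defs FactRing_def rcoset_mult_def hoch_class_def)
      (simp add: hoch_cocycle_algebra_def)
  moreover have "hoch_class A (hoch_cup A h k) = cls (cup f g)" if h: "h \<in> cls f" and k: "k \<in> cls g" for h k
  proof -
    obtain f' g' where "h = lift f'" "cocycle f'" "coboundary (\<lambda>l. f' l - f l)"
       "k = lift g'" "cocycle g'" "coboundary (\<lambda>l. g' l - g l)"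
      using cls_elim[OF h f] cls_elim[OF k g] by metis
    then show ?thesis using cup_cong by (simp add: hoch_cup_lift hoch_class_lift cls_eq_iff)
  qed
  ultimately show ?thesis using lift_mem_cls[of f] lift_mem_cls[of g] by blast
qed

lemma HH_degree_eq:
  "HH_degree A n = cls ` {f. cocycle f \<and> (\<forall>l. length l \<noteq> n \<longrightarrow> f l = 0)}"
proof -
  have "(\<forall>as. length as \<noteq> n \<longrightarrow> lift f as = \<zero>\<^bsub>A\<^esub>) \<longleftrightarrow> (\<forall>l. length l \<noteq> n \<longrightarrow> f l = 0)" for f
  proof
    assume *: "\<forall>as. length as \<noteq> n \<longrightarrow> lift f as = \<zero>\<^bsub>A\<^esub>"
    show "\<forall>l. length l \<noteq> n \<longrightarrow> f l = 0"
    proof (intro allI impI)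
      fix l :: "'a list" assume "length l \<noteq> n"
      then have "lift f (map unmodel l) = \<zero>\<^bsub>A\<^esub>" using * by simp
      then have "lower (lift f) l = 0" by (simp add: lower_def model)
      then show "f l = 0" by (simp add: lower_lift)
    qed
  qed (auto simp: lift_def unmodel_zero)
  then show ?thesis
    by (auto simp: HH_degree_def hoch_cocycles_eq hoch_class_lift[symmetric] image_iff)
qed

definition class_map :: "(('a list \<Rightarrow> 'a) \<Rightarrow> 'c) \<Rightarrow> ('b list \<Rightarrow> 'b) set \<Rightarrow> 'c" where
  "class_map \<Theta> \<xi> = \<Theta> (lower (SOME z. z \<in> \<xi>))"

lemma class_map_cls:
  assumes f: "cocycle f"
    and "\<And>f'. cocycle f' \<Longrightarrow> coboundary (\<lambda>l. f' l - f l) \<Longrightarrow> \<Theta> f' = \<Theta> f"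
  shows "class_map \<Theta> (cls f) = \<Theta> f"
proof -
  have "(SOME z. z \<in> cls f) \<in> cls f"
    by (rule someI[of "\<lambda>z. z \<in> cls f", OF lift_mem_cls[of f]])
  then obtain f' where "(SOME z. z \<in> cls f) = lift f'" "cocycle f'" "coboundary (\<lambda>l. f' l - f l)"
    using cls_elim[OF _ f] by metis
  then show ?thesis using assms(2) by (simp add: class_map_def lower_lift)
qed

lemma class_map_algebra_iso:
  fixes S :: "('k, 'c) module"
  assumes kernel: "\<And>f g. cocycle f \<Longrightarrow> cocycle g \<Longrightarrow> \<Theta> f = \<Theta> g \<longleftrightarrow> coboundary (\<lambda>l. f l - g l)"
    and surj: "\<Theta> ` {f. cocycle f} = carrier S"
    and add: "\<And>f g. cocycle f \<Longrightarrow> cocycle g \<Longrightarrow> \<Theta> (\<lambda>l. f l + g l) = \<Theta> f \<oplus>\<^bsub>S\<^esub> \<Theta> g"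
    and mult: "\<And>f g. cocycle f \<Longrightarrow> cocycle g \<Longrightarrow> \<Theta> (cup f g) = \<Theta> f \<otimes>\<^bsub>S\<^esub> \<Theta> g"
    and one: "cocycle (\<lambda>l. if l = [] then 1 else 0)" "\<Theta> (\<lambda>l. if l = [] then 1 else 0) = \<one>\<^bsub>S\<^esub>"
    and smult: "\<And>c f. cocycle f \<Longrightarrow> \<Theta> (\<lambda>l. sc c (f l)) = c \<odot>\<^bsub>S\<^esub> \<Theta> f"
  shows "class_map \<Theta> \<in> algebra_iso (HH A) S"
proof -
  have cm: "class_map \<Theta> (cls f) = \<Theta> f" if "cocycle f" for f
    by (rule class_map_cls[OF that]) (simp add: kernel that)
  have HH_mult': "cls f \<otimes>\<^bsub>HH A\<^esub> cls g = cls (cup f g)" if "cocycle f" "cocycle g" for f g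
  proof (rule HH_mult[OF that])
    \<comment> \<open>Multiplicativity of \<Theta> and the description of its fibres show that the
      product of classes is well defined.\<close>
    fix f' g' assume "cocycle f'" "cocycle g'" "coboundary (\<lambda>l. f' l - f l)" "coboundary (\<lambda>l. g' l - g l)"
    then show "coboundary (\<lambda>l. cup f' g' l - cup f g l)"
      using that kernel[of f' f] kernel[of g' g] kernel[of "cup f' g'" "cup f g"] mult
      by (simp add: cocycle_cup)
  qed
  have "class_map \<Theta> \<in> ring_hom (HH A) S"
    unfolding ring_hom_def using surj
    by (auto simp: carrier_HH HH_add HH_mult' HH_one cm add mult one cocycle_plus cocycle_cup)
  moreover have "bij_betw (class_map \<Theta>) (carrier (HH A)) (carrier S)"
    unfolding bij_betw_def
  proof
    show "inj_on (class_map \<Theta>) (carrier (HH A))"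
      by (auto simp: inj_on_def carrier_HH cm kernel cls_eq_iff)
    show "class_map \<Theta> ` carrier (HH A) = carrier S"
      by (simp add: carrier_HH image_image cm surj[symmetric])
  qed
  moreover have "class_map \<Theta> (c \<odot>\<^bsub>HH A\<^esub> x) = c \<odot>\<^bsub>S\<^esub> class_map \<Theta> x" if "x \<in> carrier (HH A)" for c x
    using that by (auto simp: carrier_HH HH_smult cm cocycle_scale smult)
  ultimately show ?thesis by (simp add: algebra_iso_def ring_iso_def)
qed

end

section \<open>The path algebra as a type\<close>

text \<open>An element is its table of coefficients, indexed by start and length. Taking the number
  of vertices from the characteristic makes the type depend on the field alone. In characteristic 0
  it is the zero ring, hence the instance for \<open>ring\<close> and \<open>monoid_mult\<close>,
  which does not claim that 0 and 1 differ.\<close>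

typedef (overloaded) ('k::field) path_alg =
  "{f :: nat \<Rightarrow> nat \<Rightarrow> 'k. \<forall>u j. CHAR('k) \<le> u \<or> CHAR('k) \<le> j \<longrightarrow> f u j = 0}"
  morphisms pcoef Abs_path_alg
  by (rule exI[of _ "\<lambda>u j. 0"]) auto

definition mk_path :: "(nat \<Rightarrow> nat \<Rightarrow> 'k) \<Rightarrow> 'k::field path_alg" where
  "mk_path f = Abs_path_alg (\<lambda>u j. if u < CHAR('k) \<and> j < CHAR('k) then f u j else 0)"

lemma pcoef_mk_path:
  "pcoef (mk_path f :: 'k::field path_alg) u j = (if u < CHAR('k) \<and> j < CHAR('k) then f u j else 0)"
  unfolding mk_path_def by (subst Abs_path_alg_inverse) auto

lemma pcoef_ge: "CHAR('k) \<le> u \<or> CHAR('k) \<le> j \<Longrightarrow> pcoef (x :: 'k::field path_alg) u j = 0"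
  using pcoef[of x] by auto

lemma path_alg_eqI:
  fixes x y :: "'k::field path_alg"
  assumes "\<And>u j. u < CHAR('k) \<Longrightarrow> j < CHAR('k) \<Longrightarrow> pcoef x u j = pcoef y u j"
  shows "x = y"
proof -
  have "pcoef x u j = pcoef y u j" for u j
    using assms[of u j] pcoef_ge[of u j x] pcoef_ge[of u j y]
    by (cases "u < CHAR('k) \<and> j < CHAR('k)") auto
  then show ?thesis by (metis ext pcoef_inject)
qed

instantiation path_alg :: (field) "{ring, monoid_mult}"
begin

definition "0 = mk_path (\<lambda>u j. 0)"
definition "1 = mk_path (\<lambda>u j. if j = 0 then 1 else 0)"
definition "x + y = mk_path (\<lambda>u j. pcoef x u j + pcoef y u j)"
definition "- x = mk_path (\<lambda>u j. - pcoef x u j)"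
definition "x - y = mk_path (\<lambda>u j. pcoef x u j - pcoef y u j)"
definition times_path_alg :: "'a path_alg \<Rightarrow> 'a path_alg \<Rightarrow> 'a path_alg" where
  "x * y = mk_path (\<lambda>u n. \<Sum>j\<le>n. pcoef x u j * pcoef y ((u + j) mod CHAR('a)) (n - j))"

instance
proof
  fix x y z :: "'a path_alg"
  let ?p = "CHAR('a)"
  note defs = zero_path_alg_def one_path_alg_def plus_path_alg_def uminus_path_alg_def
    minus_path_alg_def times_path_alg_def pcoef_mk_path
  show "x + y + z = x + (y + z)" "x + y = y + x" "0 + x = x" "- x + x = 0" "x - y = x + - y"
    by (rule path_alg_eqI; simp add: defs)+
  show "(x + y) * z = x * z + y * z" "x * (y + z) = x * y + x * z"
    by (rule path_alg_eqI; simp add: defs algebra_simps sum.distrib less_imp_diff_less)+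
  show "1 * x = x"
  proof (rule path_alg_eqI)
    fix u n assume un: "u < ?p" "n < ?p"
    have "pcoef (1 * x) u n = (\<Sum>j\<le>n. pcoef 1 u j * pcoef x ((u + j) mod ?p) (n - j))"
      using un by (simp add: times_path_alg_def pcoef_mk_path)
    also have "\<dots> = (\<Sum>j\<le>n. if j = 0 then pcoef x u n else 0)"
      using un by (intro sum.cong refl) (auto simp: defs)
    finally show "pcoef (1 * x) u n = pcoef x u n" by simp
  qed
  show "x * 1 = x"
  proof (rule path_alg_eqI)
    fix u n assume un: "u < ?p" "n < ?p"
    have "pcoef (x * 1) u n = (\<Sum>j\<le>n. pcoef x u j * pcoef 1 ((u + j) mod ?p) (n - j))"
      using un by (simp add: times_path_alg_def pcoef_mk_path)
    also have "\<dots> = (\<Sum>j\<le>n. if j = n then pcoef x u n else 0)"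
      using un by (intro sum.cong refl) (auto simp: defs)
    finally show "pcoef (x * 1) u n = pcoef x u n" by simp
  qed
  show "x * y * z = x * (y * z)"
  proof (rule path_alg_eqI)
    fix u n assume un: "u < ?p" "n < ?p"
    \<comment> \<open>Both bracketings are sums over all ways to cut a path of length
      \<open>n\<close> into three pieces, \<open>i\<close> and \<open>j\<close> being the lengths of
      the first two.\<close>
    let ?F = "\<lambda>i j. pcoef x u i * pcoef y ((u + i) mod ?p) j * pcoef z ((u + i + j) mod ?p) (n - i - j)"
    have "pcoef (x * y * z) u n = (\<Sum>m\<le>n. \<Sum>i\<le>m. ?F i (m - i))"
      using un by (simp add: defs sum_distrib_right)
    also have "\<dots> = (\<Sum>(i, j) | i + j \<le> n. ?F i j)"
      by (simp add: sum.triangle_reindex_eq)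
    also have "\<dots> = (\<Sum>i\<le>n. \<Sum>j\<le>n - i. ?F i j)"
    proof -
      have "{(i, j). i + j \<le> n} = Sigma {..n} (\<lambda>i. {..n - i})" by auto
      then show ?thesis by (simp add: sum.Sigma)
    qed
    also have "\<dots> = pcoef (x * (y * z)) u n"
    proof -
      have "n - i < ?p" for i using un by simp
      then have "(\<Sum>j\<le>n - i. ?F i j) = pcoef x u i * pcoef (y * z) ((u + i) mod ?p) (n - i)" for i
        using un by (simp add: times_path_alg_def pcoef_mk_path sum_distrib_left mult.assoc mod_add_left_eq)
      then show ?thesis
        using un by (simp add: times_path_alg_def[of x] pcoef_mk_path)
    qed
    finally show "pcoef (x * y * z) u n = pcoef (x * (y * z)) u n" .
  qed
qed

end

definition psc :: "'k::field \<Rightarrow> 'k path_alg \<Rightarrow> 'k path_alg" where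
  "psc c x = mk_path (\<lambda>u j. c * pcoef x u j)"

definition path :: "nat \<Rightarrow> nat \<Rightarrow> 'k::field path_alg" where
  "path u j = mk_path (\<lambda>v l. if v = u mod CHAR('k) \<and> l = j then 1 else 0)"

lemma pcoef_add: "pcoef (x + y) u j = pcoef x u j + pcoef y u j"
  by (auto simp: plus_path_alg_def pcoef_mk_path pcoef_ge not_less)

lemma pcoef_psc: "pcoef (psc c x) u j = c * pcoef x u j"
  by (auto simp: psc_def pcoef_mk_path pcoef_ge not_less)

lemma pcoef_zero: "pcoef 0 u j = 0"
  by (simp add: zero_path_alg_def pcoef_mk_path)

lemma pcoef_sum: "pcoef (\<Sum>i\<in>I. f i) u j = (\<Sum>i\<in>I. pcoef (f i) u j)"
  by (induction I rule: infinite_finite_induct) (auto simp: pcoef_add pcoef_zero)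

lemma pcoef_path: "pcoef (path u j :: 'k::field path_alg) v l =
    (if v < CHAR('k) \<and> l < CHAR('k) \<and> v = u mod CHAR('k) \<and> l = j then 1 else 0)"
  by (auto simp: path_def pcoef_mk_path)

lemma pcoef_mult:
  fixes x y :: "'k::field path_alg"
  assumes "u < CHAR('k)" and "n < CHAR('k)"
  shows "pcoef (x * y) u n = (\<Sum>j\<le>n. pcoef x u j * pcoef y ((u + j) mod CHAR('k)) (n - j))"
  using assms by (simp add: times_path_alg_def pcoef_mk_path)

lemma scaled_ring_path_alg: "scaled_ring (psc :: 'k::field \<Rightarrow> _)"
  by unfold_locales
    (auto intro!: path_alg_eqI simp: pcoef_add pcoef_psc pcoef_mult algebra_simps sum_distrib_left)

lemma cyclic_path_algebra_path_alg:
  assumes "2 \<le> CHAR('k::field)"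
  shows "cyclic_path_algebra (psc :: 'k \<Rightarrow> _) CHAR('k) path pcoef"
proof -
  let ?p = "CHAR('k)"
  interpret scaled_ring "psc :: 'k \<Rightarrow> _" by (rule scaled_ring_path_alg)
  have p: "0 < ?p" using assms by simp
  show ?thesis
  proof
    show "2 \<le> ?p" by fact
    show "path (u mod ?p) j = (path u j :: 'k path_alg)" for u j
      by (rule path_alg_eqI) (simp add: pcoef_path)
    show "?p \<le> j \<Longrightarrow> path u j = (0 :: 'k path_alg)" for u j
      by (rule path_alg_eqI) (auto simp: pcoef_path pcoef_zero)
    show "path u j * path v l = (if (u + j) mod ?p = v mod ?p then path u (j + l) else (0 :: 'k path_alg))"
      for u j v l
    proof (rule path_alg_eqI)
      fix a n assume a: "a < ?p" "n < ?p"
      have "pcoef (path u j * path v l :: 'k path_alg) a n =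
        (\<Sum>i\<le>n. if i = j then (if a = u mod ?p \<and> (a + j) mod ?p = v mod ?p \<and> n - j = l then 1 else 0) else 0)"
        unfolding pcoef_mult[OF a] using a p by (intro sum.cong refl) (auto simp: pcoef_path)
      also have "\<dots> = pcoef (if (u + j) mod ?p = v mod ?p then path u (j + l) else (0 :: 'k path_alg)) a n"
        using a by (auto simp: pcoef_path pcoef_zero mod_add_left_eq)
      finally show "pcoef (path u j * path v l :: 'k path_alg) a n
        = pcoef (if (u + j) mod ?p = v mod ?p then path u (j + l) else (0 :: 'k path_alg)) a n" .
    qed
    show "(\<Sum>u<?p. path u 0) = (1 :: 'k path_alg)"
    proof (rule path_alg_eqI)
      fix a n assume a: "a < ?p" "n < ?p"
      then show "pcoef (\<Sum>u<?p. path u 0 :: 'k path_alg) a n = pcoef (1 :: 'k path_alg) a n"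
        by (simp add: pcoef_sum pcoef_path one_path_alg_def pcoef_mk_path)
    qed
    show "pcoef (x + y) u j = pcoef x u j + pcoef y u j" "pcoef (psc c x) u j = c * pcoef x u j"
      for x y :: "'k path_alg" and c u j
      by (rule pcoef_add pcoef_psc)+
    show "u < ?p \<Longrightarrow> j < ?p \<Longrightarrow> pcoef (path v l :: 'k path_alg) u j = (if v mod ?p = u \<and> l = j then 1 else 0)"
      for u j v l by (auto simp: pcoef_path)
    show "x = (\<Sum>u<?p. \<Sum>j<?p. psc (pcoef x u j) (path u j))" for x :: "'k path_alg"
    proof (rule path_alg_eqI)
      fix a n assume a: "a < ?p" "n < ?p"
      have "pcoef (\<Sum>u<?p. \<Sum>j<?p. psc (pcoef x u j) (path u j)) a n
        = (\<Sum>u<?p. \<Sum>j<?p. if j = n then (if u = a then pcoef x a n else 0) else 0)"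
        unfolding pcoef_sum pcoef_psc using a by (intro sum.cong refl) (auto simp: pcoef_path)
      also have "\<dots> = pcoef x a n" using a by simp
      finally show "pcoef x a n = pcoef (\<Sum>u<?p. \<Sum>j<?p. psc (pcoef x u j) (path u j)) a n" by simp
    qed
  qed
qed

section \<open>Coordinate rings and distributions of Frobenius kernels\<close>

lemma coord_outside: "f \<in> coord_ring H \<Longrightarrow> x \<notin> H \<Longrightarrow> f x = 0"
  unfolding coord_ring_def by (induction rule: function_algebra.induct) (auto simp: restr_def)

lemma coord_eqI:
  assumes "f \<in> coord_ring H" and "\<And>x. x \<in> H \<Longrightarrow> f x = g x" and "\<And>x. x \<notin> H \<Longrightarrow> g x = 0"
  shows "g \<in> coord_ring H"
proof -
  have "f = g" using assms coord_outside[OF assms(1)] by (metis ext)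
  then show ?thesis using assms by simp
qed

lemma coord_const: "restr H (\<lambda>_. c) \<in> coord_ring H"
  and coord_entry: "restr H (\<lambda>x. x $ i $ j) \<in> coord_ring H"
  and coord_add: "f \<in> coord_ring H \<Longrightarrow> g \<in> coord_ring H \<Longrightarrow> (\<lambda>x. f x + g x) \<in> coord_ring H"
  and coord_mult: "f \<in> coord_ring H \<Longrightarrow> g \<in> coord_ring H \<Longrightarrow> (\<lambda>x. f x * g x) \<in> coord_ring H"
  unfolding coord_ring_def by (auto intro: function_algebra.intros)

lemma coord_scale: "f \<in> coord_ring H \<Longrightarrow> (\<lambda>x. c * f x) \<in> coord_ring H"
  by (rule coord_eqI[OF coord_mult[OF coord_const[of H c]]]) (auto simp: restr_def coord_outside)

lemma coord_zero: "(\<lambda>x. 0) \<in> coord_ring H"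
  using coord_scale[OF coord_const[of H 0], of 0] by simp

lemma coord_restr_add: "restr H f \<in> coord_ring H \<Longrightarrow> restr H g \<in> coord_ring H \<Longrightarrow>
    restr H (\<lambda>x. f x + g x) \<in> coord_ring H"
  by (rule coord_eqI[OF coord_add[of "restr H f" H "restr H g"]]) (auto simp: restr_def)

lemma coord_restr_mult: "restr H f \<in> coord_ring H \<Longrightarrow> restr H g \<in> coord_ring H \<Longrightarrow>
    restr H (\<lambda>x. f x * g x) \<in> coord_ring H"
  by (rule coord_eqI[OF coord_mult[of "restr H f" H "restr H g"]]) (auto simp: restr_def)

lemma coord_restr_scale: "restr H f \<in> coord_ring H \<Longrightarrow> restr H (\<lambda>x. c * f x) \<in> coord_ring H"
  by (rule coord_eqI[OF coord_scale[of "restr H f" H c]]) (auto simp: restr_def)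

lemma coord_restr_sum: "(\<And>i. i \<in> I \<Longrightarrow> restr H (f i) \<in> coord_ring H) \<Longrightarrow>
    restr H (\<lambda>x. \<Sum>i\<in>I. f i x) \<in> coord_ring H"
  by (induction I rule: infinite_finite_induct) (auto intro: coord_const coord_restr_add)

lemma coord_restr_power: "restr H f \<in> coord_ring H \<Longrightarrow> restr H (\<lambda>x. f x ^ n) \<in> coord_ring H"
  by (induction n) (auto intro: coord_const coord_restr_mult)

lemmas coord_intros = coord_const coord_entry coord_restr_add coord_restr_mult coord_restr_scale
  coord_restr_sum coord_restr_power

lemma coord_induct [consumes 1, case_names const entry add mult]:
  assumes "f \<in> coord_ring H"
    and "\<And>c. Q (restr H (\<lambda>_. c))"
    and "\<And>i j. Q (restr H (\<lambda>x. x $ i $ j))"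
    and "\<And>f g. f \<in> coord_ring H \<Longrightarrow> g \<in> coord_ring H \<Longrightarrow> Q f \<Longrightarrow> Q g \<Longrightarrow> Q (\<lambda>x. f x + g x)"
    and "\<And>f g. f \<in> coord_ring H \<Longrightarrow> g \<in> coord_ring H \<Longrightarrow> Q f \<Longrightarrow> Q g \<Longrightarrow> Q (\<lambda>x. f x * g x)"
  shows "Q f"
  using assms(1) unfolding coord_ring_def
proof (induction rule: function_algebra.induct)
  case (const c)
  then show ?case by (rule assms(2))
next
  case (gen f)
  then show ?case using assms(3) by auto
next
  case (add f g)
  then show ?case using assms(4)[unfolded coord_ring_def] by blast
next
  case (mult f g)
  then show ?case using assms(5)[unfolded coord_ring_def] by blast
qed

lemma coord_pullback:
  assumes f: "f \<in> coord_ring H"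
    and maps: "\<And>x. x \<in> K \<Longrightarrow> \<phi> x \<in> H"
    and entries: "\<And>i j. restr K (\<lambda>x. \<phi> x $ i $ j) \<in> coord_ring K"
  shows "restr K (\<lambda>x. f (\<phi> x)) \<in> coord_ring K"
  using f
proof (induction rule: coord_induct)
  case (const c)
  show ?case by (rule coord_eqI[OF coord_const[of K c]]) (auto simp: restr_def maps)
next
  case (entry i j)
  show ?case by (rule coord_eqI[OF entries[of i j]]) (auto simp: restr_def maps)
qed (auto intro: coord_intros)

lemma coord_frobenius:
  assumes "f \<in> coord_ring H" and "frobenius ` K \<subseteq> H"
  shows "restr K (\<lambda>x. f (frobenius x)) \<in> coord_ring K"
proof (rule coord_pullback[OF assms(1)])
  show "\<And>x. x \<in> K \<Longrightarrow> frobenius x \<in> H" using assms(2) by auto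
  show "restr K (\<lambda>x. frobenius x $ i $ j) \<in> coord_ring K" for i j
    unfolding frobenius_def by (simp) (intro coord_intros)
qed

lemma coord_two_sided:
  assumes "f \<in> coord_ring H" and "\<And>x. x \<in> K \<Longrightarrow> y ** x ** z \<in> H"
  shows "restr K (\<lambda>x. f (y ** x ** z)) \<in> coord_ring K"
proof (rule coord_pullback[OF assms])
  show "restr K (\<lambda>x. (y ** x ** z) $ i $ j) \<in> coord_ring K" for i j
    unfolding matrix_matrix_mult_def
    by (simp add: mult.commute[of _ "z $ _ $ _"]) (intro coord_intros)
qed

lemma frobenius_mult:
  assumes "prime CHAR('k::field)"
  shows "frobenius (x ** y :: 'k ^ 2 ^ 2) = frobenius x ** frobenius y"
  by (simp add: frobenius_def matrix_matrix_mult_def vec_eq_iff freshmans_dream_sum[OF assms refl]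
      power_mult_distrib)

lemma frobenius_one: "CHAR('k) > 0 \<Longrightarrow> frobenius (mat 1 :: 'k::field ^ 2 ^ 2) = mat 1"
  by (auto simp: frobenius_def mat_def vec_eq_iff)

text \<open>The functions on H x H that come from the tensor square of the coordinate ring. On these
  a pair of functionals can be applied one variable at a time without leaving the coordinate
  ring.\<close>

inductive tensor :: "('k::field ^ 2 ^ 2) set \<Rightarrow> ('k ^ 2 ^ 2 \<Rightarrow> 'k ^ 2 ^ 2 \<Rightarrow> 'k) \<Rightarrow> bool" for H where
  pure: "u \<in> coord_ring H \<Longrightarrow> v \<in> coord_ring H \<Longrightarrow> tensor H (\<lambda>x y. u x * v y)"
| add: "tensor H f \<Longrightarrow> tensor H g \<Longrightarrow> tensor H (\<lambda>x y. f x y + g x y)"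

lemma tensor_zero: "tensor H (\<lambda>x y. 0)"
  using tensor.pure[OF coord_zero coord_zero, of H] by simp

lemma tensor_sum: "(\<And>i. i \<in> I \<Longrightarrow> tensor H (f i)) \<Longrightarrow> tensor H (\<lambda>x y. \<Sum>i\<in>I. f i x y)"
  by (induction I rule: infinite_finite_induct) (auto intro: tensor_zero tensor.add)

lemma tensor_mult:
  assumes "tensor H f" and "tensor H g"
  shows "tensor H (\<lambda>x y. f x y * g x y)"
  using assms(1)
proof (induction rule: tensor.induct)
  case (pure u v)
  show ?case
    using assms(2)
  proof (induction rule: tensor.induct)
    case (pure u' v')
    have "tensor H (\<lambda>x y. (u x * u' x) * (v y * v' y))"
      by (intro tensor.pure coord_mult pure \<open>u \<in> _\<close> \<open>v \<in> _\<close>)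
    then show ?case by (simp add: mult_ac)
  next
    case (add f g)
    then show ?case by (auto dest: tensor.add simp: distrib_left)
  qed
next
  case (add f g)
  then show ?case by (auto dest: tensor.add simp: distrib_right)
qed

text \<open>An entry of a matrix product is a sum of products of entries, and the tensor functions
  are closed under sums and products.\<close>

lemma tensor_comult:
  assumes "f \<in> coord_ring H" and closed: "\<And>x y. x \<in> H \<Longrightarrow> y \<in> H \<Longrightarrow> x ** y \<in> H"
  shows "tensor H (\<lambda>x y. if x \<in> H \<and> y \<in> H then f (x ** y) else 0)"
  using assms(1)
proof (induction rule: coord_induct)
  case (const c)
  have "(\<lambda>x y. if x \<in> H \<and> y \<in> H then restr H (\<lambda>_. c) (x ** y) else 0)
      = (\<lambda>x y. restr H (\<lambda>_. c) x * restr H (\<lambda>_. 1) y)"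
    by (auto simp: restr_def fun_eq_iff closed)
  then show ?case by (simp add: tensor.pure coord_const)
next
  case (entry i j)
  have e: "(x ** y) $ i $ j = (\<Sum>k\<in>UNIV. x $ i $ k * y $ k $ j)" for x y :: "'a ^ 2 ^ 2"
    by (simp add: matrix_matrix_mult_def)
  have "(\<lambda>x y. if x \<in> H \<and> y \<in> H then restr H (\<lambda>x. x $ i $ j) (x ** y) else 0)
      = (\<lambda>x y. \<Sum>k\<in>UNIV. restr H (\<lambda>x. x $ i $ k) x * restr H (\<lambda>x. x $ k $ j) y)"
    by (auto simp: restr_def fun_eq_iff closed e)
  then show ?case by (simp add: tensor_sum tensor.pure coord_entry)
next
  case (add f g)
  have "(\<lambda>x y. if x \<in> H \<and> y \<in> H then f (x ** y) + g (x ** y) else 0) =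
    (\<lambda>x y. (if x \<in> H \<and> y \<in> H then f (x ** y) else 0) + (if x \<in> H \<and> y \<in> H then g (x ** y) else 0))"
    by (auto simp: fun_eq_iff)
  with add show ?case by (simp add: tensor.add)
next
  case (mult f g)
  have "(\<lambda>x y. if x \<in> H \<and> y \<in> H then f (x ** y) * g (x ** y) else 0) =
    (\<lambda>x y. (if x \<in> H \<and> y \<in> H then f (x ** y) else 0) * (if x \<in> H \<and> y \<in> H then g (x ** y) else 0))"
    by (auto simp: fun_eq_iff)
  with mult show ?case by (simp add: tensor_mult)
qed

section \<open>Linear functionals and the convolution product\<close>

lemma dual_add: "\<xi> \<in> dual_space V \<Longrightarrow> f \<in> V \<Longrightarrow> g \<in> V \<Longrightarrow> \<xi> (\<lambda>x. f x + g x) = \<xi> f + \<xi> g"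
  and dual_scale: "\<xi> \<in> dual_space V \<Longrightarrow> f \<in> V \<Longrightarrow> \<xi> (\<lambda>x. c * f x) = c * \<xi> f"
  and dual_outside: "\<xi> \<in> dual_space V \<Longrightarrow> f \<notin> V \<Longrightarrow> \<xi> f = 0"
  by (auto simp: dual_space_def)

lemma dual_eqI:
  assumes "\<xi> \<in> dual_space V" "\<eta> \<in> dual_space V" "\<And>f. f \<in> V \<Longrightarrow> \<xi> f = \<eta> f"
  shows "\<xi> = \<eta>"
  using assms dual_outside by (metis ext)

lemma dual_zero: "\<xi> \<in> dual_space (coord_ring H) \<Longrightarrow> \<xi> (\<lambda>x. 0) = 0"
  using dual_scale[OF _ coord_zero, of \<xi> H 0] by simp

lemma dual_diff: "\<xi> \<in> dual_space (coord_ring H) \<Longrightarrow> f \<in> coord_ring H \<Longrightarrow> g \<in> coord_ring H \<Longrightarrow>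
    \<xi> (\<lambda>x. f x - g x) = \<xi> f - \<xi> g"
  using dual_add[of \<xi> "coord_ring H" f "\<lambda>x. - 1 * g x"] dual_scale[of \<xi> "coord_ring H" g "- 1"]
    coord_scale[of g H "- 1"]
  by simp

lemma dual_restr_add: "\<xi> \<in> dual_space (coord_ring H) \<Longrightarrow> restr H f \<in> coord_ring H \<Longrightarrow> restr H g \<in> coord_ring H \<Longrightarrow>
    \<xi> (restr H (\<lambda>x. f x + g x)) = \<xi> (restr H f) + \<xi> (restr H g)"
  using dual_add[of \<xi> "coord_ring H" "restr H f" "restr H g"]
  by (simp add: restr_def if_distrib cong: if_cong)

lemma dual_restr_scale: "\<xi> \<in> dual_space (coord_ring H) \<Longrightarrow> restr H f \<in> coord_ring H \<Longrightarrow>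
    \<xi> (restr H (\<lambda>x. c * f x)) = c * \<xi> (restr H f)"
  using dual_scale[of \<xi> "coord_ring H" "restr H f" c]
  by (simp add: restr_def if_distrib cong: if_cong)

locale frobenius_group =
  fixes H :: "('k::field ^ 2 ^ 2) set"
  assumes char_prime: "prime CHAR('k)"
    and one_mem: "mat 1 \<in> H"
    and mult_mem: "x \<in> H \<Longrightarrow> y \<in> H \<Longrightarrow> x ** y \<in> H"
    and frobenius_mem: "x \<in> H \<Longrightarrow> frobenius x \<in> H"
begin

abbreviation "\<O> \<equiv> coord_ring H"

lemma coord_frob_mult: "h \<in> \<O> \<Longrightarrow> v \<in> \<O> \<Longrightarrow> (\<lambda>x. h x * v (frobenius x)) \<in> \<O>"
  by (rule coord_eqI[OF coord_mult[of h H "restr H (\<lambda>x. v (frobenius x))"]])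
    (auto simp: restr_def coord_outside intro!: coord_frobenius[unfolded restr_def] frobenius_mem)

lemma dist_dual: "\<mu> \<in> carrier (dist_frob_kernel H) \<Longrightarrow> \<mu> \<in> dual_space \<O>"
  by (simp add: dist_frob_kernel_def)

text \<open>The function \<open>v\<close> minus its value at 1 lies in the augmentation ideal, so
  its composite with F generates elements killed by \<mu>. With the converse \<open>distI\<close>
  this is the working form of the ideal condition: functions pulled back along F behave as
  constants.\<close>

lemma dist_frobenius:
  assumes \<mu>: "\<mu> \<in> carrier (dist_frob_kernel H)" and h: "h \<in> \<O>" and v: "v \<in> \<O>"
  shows "\<mu> (\<lambda>x. h x * v (frobenius x)) = v (mat 1) * \<mu> h"
proof -
  define g where "g = (\<lambda>x. v x - restr H (\<lambda>_. v (mat 1)) x)"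
  have "g = (\<lambda>x. v x + restr H (\<lambda>_. - v (mat 1)) x)" by (auto simp: g_def restr_def)
  then have g: "g \<in> \<O>" by (simp add: coord_add v coord_const)
  have "(\<lambda>x. h x * g (frobenius x)) \<in> frob_kernel_ideal H"
    by (rule frob_kernel_ideal.gen[OF g _ h]) (simp add: g_def restr_def one_mem)
  then have "\<mu> (\<lambda>x. h x * g (frobenius x)) = 0" using \<mu> by (simp add: dist_frob_kernel_def)
  also have "(\<lambda>x. h x * g (frobenius x)) = (\<lambda>x. h x * v (frobenius x) - v (mat 1) * h x)"
    using coord_outside[OF h] frobenius_mem by (auto simp: g_def restr_def fun_eq_iff algebra_simps)
  also have "\<mu> \<dots> = \<mu> (\<lambda>x. h x * v (frobenius x)) - v (mat 1) * \<mu> h"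
    using dist_dual[OF \<mu>] h v
      dual_diff[of \<mu> H "\<lambda>x. h x * v (frobenius x)" "\<lambda>x. v (mat 1) * h x"]
    by (simp add: coord_frob_mult coord_scale dual_scale)
  finally show ?thesis by simp
qed

lemma distI:
  assumes \<mu>: "\<mu> \<in> dual_space \<O>"
    and "\<And>h v. h \<in> \<O> \<Longrightarrow> v \<in> \<O> \<Longrightarrow> \<mu> (\<lambda>x. h x * v (frobenius x)) = v (mat 1) * \<mu> h"
  shows "\<mu> \<in> carrier (dist_frob_kernel H)"
proof -
  have "\<mu> f = 0 \<and> f \<in> \<O>" if "f \<in> frob_kernel_ideal H" for f
    using that
  proof (induction rule: frob_kernel_ideal.induct)
    case (gen g h)
    then show ?case using assms(2)[of h g] by (simp add: coord_frob_mult)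
  next
    case (add f g)
    then show ?case using dual_add[OF \<mu>] coord_add by auto
  qed
  then show ?thesis using \<mu> by (simp add: dist_frob_kernel_def)
qed

lemma tensor_slice: "tensor H f \<Longrightarrow> f x \<in> \<O>"
  by (induction rule: tensor.induct) (auto intro: coord_scale coord_add)

lemma tensor_apply:
  assumes \<nu>: "\<nu> \<in> dual_space \<O>" and "tensor H f"
  shows "(\<lambda>x. \<nu> (f x)) \<in> \<O>"
  using assms(2)
proof (induction rule: tensor.induct)
  case (pure u v)
  then have "(\<lambda>x. \<nu> (\<lambda>y. u x * v y)) = (\<lambda>x. \<nu> v * u x)"
    using \<nu> by (simp add: dual_scale mult.commute)
  then show ?case using pure by (simp add: coord_scale)
next
  case (add f g)
  then show ?case using \<nu> by (simp add: dual_add tensor_slice coord_add)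
qed

definition pairing :: "_ \<Rightarrow> _ \<Rightarrow> ('k ^ 2 ^ 2 \<Rightarrow> 'k ^ 2 ^ 2 \<Rightarrow> 'k) \<Rightarrow> 'k" where
  "pairing \<mu> \<nu> f = \<mu> (\<lambda>x. \<nu> (f x))"

lemma pairing_add:
  assumes "\<mu> \<in> dual_space \<O>" "\<nu> \<in> dual_space \<O>" "tensor H f" "tensor H g"
  shows "pairing \<mu> \<nu> (\<lambda>x y. f x y + g x y) = pairing \<mu> \<nu> f + pairing \<mu> \<nu> g"
  using assms unfolding pairing_def
  using dual_add[of \<mu> \<O> "\<lambda>x. \<nu> (f x)" "\<lambda>x. \<nu> (g x)"]
  by (simp add: dual_add tensor_slice tensor_apply)

lemma pairing_pure:
  assumes "\<mu> \<in> dual_space \<O>" "\<nu> \<in> dual_space \<O>" "u \<in> \<O>" "v \<in> \<O>"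
  shows "pairing \<mu> \<nu> (\<lambda>x y. u x * v y) = \<mu> u * \<nu> v"
  using assms unfolding pairing_def
  by (simp add: dual_scale) (simp add: mult.commute[of _ "\<nu> v"] dual_scale)

text \<open>The same criterion in two variables. It suffices for pure tensors, where it holds in
  each variable; it shows that convolution preserves distributions, because F is
  multiplicative.\<close>

lemma pairing_frobenius:
  assumes \<mu>: "\<mu> \<in> carrier (dist_frob_kernel H)" and \<nu>: "\<nu> \<in> carrier (dist_frob_kernel H)"
    and h: "tensor H h" and v: "tensor H v"
  shows "tensor H (\<lambda>x y. h x y * v (frobenius x) (frobenius y)) \<and>
    pairing \<mu> \<nu> (\<lambda>x y. h x y * v (frobenius x) (frobenius y)) = v (mat 1) (mat 1) * pairing \<mu> \<nu> h"
  using v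
proof (induction rule: tensor.induct)
  case (pure u v)
  show ?case
    using h
  proof (induction rule: tensor.induct)
    case (pure a b)
    have eq: "(\<lambda>x y. a x * b y * (u (frobenius x) * v (frobenius y)))
      = (\<lambda>x y. (a x * u (frobenius x)) * (b y * v (frobenius y)))"
      by (simp add: mult_ac)
    show ?case
      unfolding eq using pure \<open>u \<in> \<O>\<close> \<open>v \<in> \<O>\<close> \<mu> \<nu>
      by (simp add: pairing_pure dist_dual coord_frob_mult tensor.pure dist_frobenius)
  next
    case (add f g)
    then show ?case
      using dist_dual[OF \<mu>] dist_dual[OF \<nu>]
      by (simp add: distrib_right distrib_left pairing_add tensor.add)
  qed
next
  case (add f g)
  then show ?case
    using dist_dual[OF \<mu>] dist_dual[OF \<nu>]
    by (simp add: distrib_right distrib_left pairing_add tensor.add)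
qed

lemma dist_mult_pairing:
  assumes "\<nu> \<in> dual_space \<O>" and "f \<in> \<O>"
  shows "(\<mu> \<otimes>\<^bsub>dist_frob_kernel H\<^esub> \<nu>) f = pairing \<mu> \<nu> (\<lambda>x y. if x \<in> H \<and> y \<in> H then f (x ** y) else 0)"
proof -
  have "restr H (\<lambda>x. \<nu> (restr H (\<lambda>y. f (x ** y)))) = (\<lambda>x. \<nu> (\<lambda>y. if x \<in> H \<and> y \<in> H then f (x ** y) else 0))"
    using dual_zero[OF assms(1)] by (auto simp: restr_def fun_eq_iff)
  then show ?thesis
    using assms(2) by (simp add: dist_frob_kernel_def pairing_def restr_def[of \<O>])
qed

lemma dist_mult_closed:
  assumes \<mu>: "\<mu> \<in> carrier (dist_frob_kernel H)" and \<nu>: "\<nu> \<in> carrier (dist_frob_kernel H)"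
  shows "\<mu> \<otimes>\<^bsub>dist_frob_kernel H\<^esub> \<nu> \<in> carrier (dist_frob_kernel H)"
proof (rule distI)
  let ?M = "\<mu> \<otimes>\<^bsub>dist_frob_kernel H\<^esub> \<nu>"
  let ?C = "\<lambda>f x y. if x \<in> H \<and> y \<in> H then f (x ** y) else 0"
  note d = dist_dual[OF \<mu>] dist_dual[OF \<nu>]
  have t: "tensor H (?C f)" if "f \<in> \<O>" for f using tensor_comult[OF that mult_mem] .
  have M: "?M f = pairing \<mu> \<nu> (?C f)" if "f \<in> \<O>" for f using dist_mult_pairing d that by blast
  show "?M \<in> dual_space \<O>"
    unfolding dual_space_def
  proof (intro CollectI conjI ballI allI impI)
    show "?M f = 0" if "f \<notin> \<O>" for f using that by (simp add: dist_frob_kernel_def restr_def[of \<O>])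
    fix f assume f: "f \<in> \<O>"
    show "?M (\<lambda>x. f x + g x) = ?M f + ?M g" if g: "g \<in> \<O>" for g
    proof -
      have "?C (\<lambda>x. f x + g x) = (\<lambda>x y. ?C f x y + ?C g x y)" by (auto simp: fun_eq_iff)
      then show ?thesis using pairing_add[OF d t[OF f] t[OF g]] f g by (simp add: M coord_add)
    qed
    show "?M (\<lambda>x. c * f x) = c * ?M f" for c
    proof -
      have "pairing \<mu> \<nu> (\<lambda>x y. c * F x y) = c * pairing \<mu> \<nu> F" if "tensor H F" for F
        unfolding pairing_def using d that dual_scale[of \<mu> \<O> "\<lambda>x. \<nu> (F x)" c]
        by (simp add: dual_scale tensor_slice tensor_apply)
      moreover have "?C (\<lambda>x. c * f x) = (\<lambda>x y. c * ?C f x y)" by (auto simp: fun_eq_iff)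
      ultimately show ?thesis using f t[OF f] by (simp add: M coord_scale)
    qed
  qed
  fix h v assume h: "h \<in> \<O>" and v: "v \<in> \<O>"
  have "?C (\<lambda>x. h x * v (frobenius x)) = (\<lambda>x y. ?C h x y * ?C v (frobenius x) (frobenius y))"
    by (auto simp: fun_eq_iff frobenius_mult[OF char_prime] frobenius_mem)
  then show "?M (\<lambda>x. h x * v (frobenius x)) = v (mat 1) * ?M h"
    using pairing_frobenius[OF \<mu> \<nu> t[OF h] t[OF v]] h v by (simp add: M coord_frob_mult one_mem)
qed

lemma dist_one_closed: "\<one>\<^bsub>dist_frob_kernel H\<^esub> \<in> carrier (dist_frob_kernel H)"
proof (rule distI)
  have [simp]: "\<one>\<^bsub>dist_frob_kernel H\<^esub> = restr \<O> (\<lambda>f. f (mat 1))" by (simp add: dist_frob_kernel_def)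
  show "\<one>\<^bsub>dist_frob_kernel H\<^esub> \<in> dual_space \<O>"
    by (auto simp: dual_space_def restr_def coord_add coord_scale)
  have "CHAR('k) > 0" using char_prime by (simp add: prime_gt_0_nat)
  then show "\<one>\<^bsub>dist_frob_kernel H\<^esub> (\<lambda>x. h x * v (frobenius x)) = v (mat 1) * \<one>\<^bsub>dist_frob_kernel H\<^esub> h"
    if "h \<in> \<O>" "v \<in> \<O>" for h v
    using that by (simp add: restr_def coord_frob_mult frobenius_one)
qed

lemma adjoint_action_closed:
  assumes \<mu>: "\<mu> \<in> carrier (dist_frob_kernel H)" and t: "t \<in> H" "matrix_inv t \<in> H"
    and inv: "t ** matrix_inv t = mat 1"
  shows "adjoint_action H t \<mu> \<in> carrier (dist_frob_kernel H)"
proof (rule distI)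
  let ?M = "adjoint_action H t \<mu>"
  let ?c = "\<lambda>f. restr H (\<lambda>x. f (t ** x ** matrix_inv t))"
  note d = dist_dual[OF \<mu>]
  have mem: "t ** x ** matrix_inv t \<in> H" if "x \<in> H" for x using that t mult_mem by blast
  have c: "?c f \<in> \<O>" if "f \<in> \<O>" for f by (rule coord_two_sided[OF that mem])
  have M: "?M f = \<mu> (?c f)" if "f \<in> \<O>" for f using that by (simp add: adjoint_action_def restr_def[of \<O>])
  show "?M \<in> dual_space \<O>"
    unfolding dual_space_def
  proof (intro CollectI conjI ballI allI impI)
    show "?M f = 0" if "f \<notin> \<O>" for f using that by (simp add: adjoint_action_def restr_def[of \<O>])
    fix f assume f: "f \<in> \<O>"
    show "?M (\<lambda>x. f x + g x) = ?M f + ?M g" if g: "g \<in> \<O>" for g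
      using f g by (simp add: M coord_add dual_restr_add[OF d] c)
    show "?M (\<lambda>x. a * f x) = a * ?M f" for a
      using f by (simp add: M coord_scale dual_restr_scale[OF d] c)
  qed
  fix h v assume h: "h \<in> \<O>" and v: "v \<in> \<O>"
  \<comment> \<open>Conjugating first and applying F afterwards equals applying F and conjugating by
    F(t). So \<open>v\<close> is replaced by a conjugate, which has the same value at 1.\<close>
  let ?v = "restr H (\<lambda>x. v (frobenius t ** x ** frobenius (matrix_inv t)))"
  have Ft: "frobenius t ** frobenius (matrix_inv t) = mat 1"
    using char_prime inv by (simp add: frobenius_mult[symmetric] frobenius_one prime_gt_0_nat)
  have v': "?v \<in> \<O>"
    by (rule coord_two_sided[OF v]) (simp add: t frobenius_mem mult_mem)
  have "?c (\<lambda>x. h x * v (frobenius x)) = (\<lambda>x. ?c h x * ?v (frobenius x))"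
    by (auto simp: restr_def fun_eq_iff frobenius_mult[OF char_prime] frobenius_mem)
  then show "?M (\<lambda>x. h x * v (frobenius x)) = v (mat 1) * ?M h"
    using dist_frobenius[OF \<mu> c[OF h] v'] h v
    by (simp add: M coord_frob_mult) (simp add: restr_def one_mem Ft)
qed

end

section \<open>The Borel subgroup in coordinates\<close>

lemma matrix_inv_eqI:
  fixes A X :: "'k::field ^ 2 ^ 2"
  assumes "A ** X = mat 1" and "X ** A = mat 1"
  shows "matrix_inv A = X"
proof -
  have "A ** matrix_inv A = mat 1 \<and> matrix_inv A ** A = mat 1"
    unfolding matrix_inv_def by (rule someI[of _ X]) (use assms in blast)
  then have "matrix_inv A = (X ** A) ** matrix_inv A" using assms(2) by simp
  also have "\<dots> = X ** (A ** matrix_inv A)" by (simp only: matrix_mul_assoc)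
  finally show ?thesis
    using \<open>A ** matrix_inv A = mat 1 \<and> matrix_inv A ** A = mat 1\<close> by simp
qed

definition lowtri :: "'k \<Rightarrow> 'k \<Rightarrow> 'k::field ^ 2 ^ 2" where
  "lowtri a c = (\<chi> i j. if i = 1 then (if j = 1 then a else 0) else (if j = 1 then c else inverse a))"

lemma lowtri_entries [simp]:
  "lowtri a c $ 1 $ 1 = a" "lowtri a c $ 1 $ 2 = 0" "lowtri a c $ 2 $ 1 = c" "lowtri a c $ 2 $ 2 = inverse a"
  by (auto simp: lowtri_def)

lemma mat2_eq_iff: "x = y \<longleftrightarrow> x $ 1 $ 1 = y $ 1 $ 1 \<and> x $ 1 $ 2 = y $ 1 $ 2 \<and> x $ 2 $ 1 = y $ 2 $ 1 \<and> x $ 2 $ 2 = y $ 2 $ 2"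
  for x y :: "'k ^ 2 ^ 2"
  by (auto simp: vec_eq_iff forall_2)

lemma mult_entry: "(x ** y) $ i $ j = x $ i $ 1 * y $ 1 $ j + x $ i $ 2 * y $ 2 $ j" for x y :: "'k::field ^ 2 ^ 2"
  by (simp add: matrix_matrix_mult_def sum_2)

lemma mat_1_entries: "(mat 1 :: 'k::field ^ 2 ^ 2) $ 1 $ 1 = 1" "(mat 1 :: 'k ^ 2 ^ 2) $ 1 $ 2 = 0"
  "(mat 1 :: 'k ^ 2 ^ 2) $ 2 $ 1 = 0" "(mat 1 :: 'k ^ 2 ^ 2) $ 2 $ 2 = 1"
  by (simp_all add: mat_def)

lemma lowtri_mult: "lowtri a c ** lowtri a' c' = lowtri (a * a') (c * a' + inverse a * c')"
  by (simp add: mat2_eq_iff mult_entry)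

lemma lowtri_one: "lowtri 1 0 = mat 1"
  by (simp add: mat2_eq_iff mat_1_entries)

lemma lower_triangular_eq:
  "{x :: 'k::field ^ 2 ^ 2. det x = 1 \<and> x $ 1 $ 2 = 0} = {lowtri a c | a c. a \<noteq> 0}"
proof -
  have "x = lowtri (x $ 1 $ 1) (x $ 2 $ 1) \<and> x $ 1 $ 1 \<noteq> 0" if "det x = 1" "x $ 1 $ 2 = 0" for x :: "'k ^ 2 ^ 2"
  proof -
    have "x $ 1 $ 1 * x $ 2 $ 2 = 1" using that by (simp add: det_2)
    then show ?thesis using that by (auto simp: mat2_eq_iff) (metis inverse_unique)
  qed
  then have "{x :: 'k ^ 2 ^ 2. det x = 1 \<and> x $ 1 $ 2 = 0} \<subseteq> {lowtri a c | a c. a \<noteq> 0}"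
    by blast
  then show ?thesis by (auto simp: det_2)
qed

lemma diagonal_eq:
  "{x :: 'k::field ^ 2 ^ 2. det x = 1 \<and> x $ 1 $ 2 = 0 \<and> x $ 2 $ 1 = 0} = {lowtri a 0 | a. a \<noteq> 0}"
proof (intro equalityI subsetI)
  fix x :: "'k ^ 2 ^ 2" assume "x \<in> {x. det x = 1 \<and> x $ 1 $ 2 = 0 \<and> x $ 2 $ 1 = 0}"
  then have "x \<in> {x. det x = 1 \<and> x $ 1 $ 2 = 0}" "x $ 2 $ 1 = 0" by simp_all
  then show "x \<in> {lowtri a 0 | a. a \<noteq> 0}"
    unfolding lower_triangular_eq by auto
next
  fix x :: "'k ^ 2 ^ 2" assume "x \<in> {lowtri a 0 | a. a \<noteq> 0}"
  then show "x \<in> {x. det x = 1 \<and> x $ 1 $ 2 = 0 \<and> x $ 2 $ 1 = 0}" by (auto simp: det_2)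
qed

lemma unitriangular_eq:
  "{x :: 'k::field ^ 2 ^ 2. x $ 1 $ 1 = 1 \<and> x $ 2 $ 2 = 1 \<and> x $ 1 $ 2 = 0} = {lowtri 1 c | c. True}"
proof -
  have "x = lowtri 1 (x $ 2 $ 1)" if "x $ 1 $ 1 = 1" "x $ 2 $ 2 = 1" "x $ 1 $ 2 = 0" for x :: "'k ^ 2 ^ 2"
    using that by (simp add: mat2_eq_iff)
  then show ?thesis by auto
qed

lemma infinite_UNIV_alg_closed: "infinite (UNIV :: 'k::alg_closed_field set)"
proof
  assume fin: "finite (UNIV :: 'k set)"
  define q where "q = (\<Prod>a\<in>(UNIV :: 'k set). [:- a, 1:])"
  have "degree q = card (UNIV :: 'k set)"
    unfolding q_def by (subst degree_prod_eq_sum_degree) auto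
  then have "degree (q + 1) > 0"
    using fin by (simp add: degree_add_eq_left card_gt_0_iff)
  then obtain x where "poly (q + 1) x = 0" using alg_closed_imp_poly_has_root by blast
  moreover have "poly q x = 0"
    unfolding q_def poly_prod using fin by (auto intro!: prod_zero bexI[of _ x])
  ultimately show False by simp
qed

lemma poly_eq_0_nonzero_roots:
  fixes q :: "'k::alg_closed_field poly"
  assumes "\<And>a. a \<noteq> 0 \<Longrightarrow> poly q a = 0"
  shows "q = 0"
proof (rule ccontr)
  assume "q \<noteq> 0"
  then have "finite {x. poly q x = 0}" by (rule poly_roots_finite)
  moreover have "UNIV - {0} \<subseteq> {x. poly q x = 0}" using assms by auto
  ultimately have "finite (UNIV - {0 :: 'k})" by (rule finite_subset[rotated])
  then show False using infinite_UNIV_alg_closed[where 'k = 'k] by simp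
qed

locale borel_setup =
  fixes g :: "'k::alg_closed_field ^ 2 ^ 2" and T U B :: "('k ^ 2 ^ 2) set" and p :: nat
  assumes p_eq: "p = CHAR('k)" and p_ge_3: "3 \<le> p"
    and det_g: "det g = 1"
    and T_def: "T = (\<lambda>x. g ** x ** matrix_inv g) ` {x. det x = 1 \<and> x $ 1 $ 2 = 0 \<and> x $ 2 $ 1 = 0}"
    and U_def: "U = (\<lambda>x. g ** x ** matrix_inv g) ` {x. x $ 1 $ 1 = 1 \<and> x $ 2 $ 2 = 1 \<and> x $ 1 $ 2 = 0}"
    and B_def: "B = (\<lambda>x. g ** x ** matrix_inv g) ` {x. det x = 1 \<and> x $ 1 $ 2 = 0}"
    and frob_T: "frobenius ` T \<subseteq> T" and frob_B: "frobenius ` B \<subseteq> B"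
begin

lemma prime_p: "prime p" and prime_CHAR: "prime CHAR('k)"
  using p_ge_3 prime_CHAR_semidom[where 'a = 'k] by (auto simp: p_eq)

lemma odd_p: "odd p"
  using prime_odd_nat[OF prime_p] p_ge_3 by simp

abbreviation "gi \<equiv> matrix_inv g"

lemma g_gi: "g ** gi = mat 1" and gi_g: "gi ** g = mat 1"
proof -
  have "invertible g" using det_g by (simp add: invertible_det_nz)
  then have "g ** gi = mat 1 \<and> gi ** g = mat 1"
    unfolding invertible_def matrix_inv_def by (rule someI_ex)
  then show "g ** gi = mat 1" "gi ** g = mat 1" by auto
qed

definition el :: "'k \<Rightarrow> 'k \<Rightarrow> 'k ^ 2 ^ 2" where
  "el a c = g ** lowtri a c ** gi"

definition pull :: "'k ^ 2 ^ 2 \<Rightarrow> 'k ^ 2 ^ 2" where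
  "pull x = gi ** x ** g"

lemma pull_conj: "pull (g ** x ** gi) = x"
proof -
  have "pull (g ** x ** gi) = (gi ** g) ** x ** (gi ** g)"
    by (simp only: pull_def matrix_mul_assoc)
  then show ?thesis by (simp add: gi_g)
qed

lemma pull_el [simp]: "pull (el a c) = lowtri a c"
  by (simp add: el_def pull_conj)

lemma conj_mult: "(g ** x ** gi) ** (g ** y ** gi) = g ** (x ** y) ** gi"
proof -
  have "(g ** x ** gi) ** (g ** y ** gi) = g ** x ** (gi ** g) ** y ** gi"
    by (simp only: matrix_mul_assoc)
  then show ?thesis by (simp add: gi_g matrix_mul_assoc)
qed

lemma el_mult: "el a c ** el a' c' = el (a * a') (c * a' + inverse a * c')"
  by (simp add: el_def conj_mult lowtri_mult)

lemma el_one: "el 1 0 = mat 1"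
  by (simp add: el_def lowtri_one g_gi)

lemma B_eq: "B = {el a c | a c. a \<noteq> 0}"
  unfolding B_def lower_triangular_eq el_def by auto

lemma T_eq: "T = {el a 0 | a. a \<noteq> 0}"
  unfolding T_def diagonal_eq el_def by auto

lemma U_eq: "U = {el 1 c | c. True}"
  unfolding U_def unitriangular_eq el_def by auto

lemma matrix_inv_el: "a \<noteq> 0 \<Longrightarrow> matrix_inv (el a c) = el (inverse a) (- c)"
  by (rule matrix_inv_eqI) (simp_all add: el_mult flip: el_one)

lemma el_conj: "s \<noteq> 0 \<Longrightarrow> el s 0 ** el a c ** matrix_inv (el s 0) = el a (c * inverse s ^ 2)"
  by (simp add: matrix_inv_el el_mult power2_eq_square mult_ac)

text \<open>A torus element whose Frobenius image has two different diagonal entries. Otherwise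
  s^(2p) = 1 for all nonzero s, and the polynomial X^(2p) - 1 would have infinitely many
  roots.\<close>

lemma exists_generic: "\<exists>s :: 'k. s \<noteq> 0 \<and> s ^ p \<noteq> inverse (s ^ p)"
proof (rule ccontr)
  assume "\<not> ?thesis"
  then have *: "s ^ p * s ^ p = 1" if "s \<noteq> 0" for s :: 'k
    using that by (metis power_not_zero right_inverse)
  have "monom 1 (2 * p) - 1 = (0 :: 'k poly)"
    by (rule poly_eq_0_nonzero_roots) (use * in \<open>auto simp: poly_monom mult_2 power_add\<close>)
  then have "coeff (monom 1 (2 * p) - 1) 0 = (0 :: 'k)" by simp
  then show False using p_ge_3 by simp
qed

text \<open>The element \<open>g\<inverse> F(g)\<close> normalises both the torus and the Borel subgroup, so it is diagonal.\<close>

lemma frobenius_el: "\<exists>\<kappa>. \<kappa> \<noteq> 0 \<and> (\<forall>a c. frobenius (el a c) = el (a ^ p) (\<kappa> * c ^ p))"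
proof -
  define n where "n = gi ** frobenius g"
  define n' where "n' = frobenius gi ** g"
  note fm = frobenius_mult[OF prime_CHAR]
  have F1: "frobenius g ** frobenius gi = mat 1"
    using p_ge_3 by (simp add: fm[symmetric] g_gi frobenius_one flip: p_eq)
  have nn': "n ** n' = mat 1"
  proof -
    have "n ** n' = gi ** (frobenius g ** frobenius gi) ** g" by (simp only: n_def n'_def matrix_mul_assoc)
    then show ?thesis by (simp add: F1 gi_g)
  qed
  have detn: "det n = 1"
  proof -
    have "det gi = 1" using det_mul[of g gi] det_g by (simp add: g_gi)
    moreover have "det (frobenius g) = det g ^ p"
    proof -
      have "(x - y) ^ p = x ^ p - y ^ p" for x y :: 'k
        using freshmans_dream[OF prime_CHAR p_eq, of x "- y"] minus_power_prime_CHAR[OF p_eq prime_p, of y]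
        by simp
      then show ?thesis by (simp add: det_2 frobenius_def p_eq[symmetric] power_mult_distrib)
    qed
    ultimately show ?thesis by (simp add: n_def det_mul det_g)
  qed
  have dn: "n $ 1 $ 1 * n $ 2 $ 2 - n $ 1 $ 2 * n $ 2 $ 1 = 1" using detn by (simp add: det_2)
  \<comment> \<open>As \<open>n\<close> has determinant 1, its inverse \<open>n'\<close> is the
    adjugate, which makes the entries of the conjugates below explicit.\<close>
  define adj :: "'k ^ 2 ^ 2" where "adj = (\<chi> i j. if i = 1 then (if j = 1 then n $ 2 $ 2 else - n $ 1 $ 2)
    else (if j = 1 then - n $ 2 $ 1 else n $ 1 $ 1))"
  have adj: "adj $ 1 $ 1 = n $ 2 $ 2" "adj $ 1 $ 2 = - n $ 1 $ 2" "adj $ 2 $ 1 = - n $ 2 $ 1" "adj $ 2 $ 2 = n $ 1 $ 1"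
    by (auto simp: adj_def)
  have "adj ** n = mat 1"
    using dn by (simp add: mat2_eq_iff mult_entry adj mat_1_entries algebra_simps)
  then have "n' = (adj ** n) ** n'" by simp
  also have "\<dots> = adj ** (n ** n')" by (simp only: matrix_mul_assoc)
  finally have n': "n' = adj" by (simp add: nn')
  have Flow: "frobenius (lowtri a c) = lowtri (a ^ p) (c ^ p)" for a c :: 'k
    using p_ge_3 by (simp add: mat2_eq_iff frobenius_def power_inverse flip: p_eq)
  have Fel: "frobenius (el a c) = g ** (n ** lowtri (a ^ p) (c ^ p) ** n') ** gi" for a c
  proof -
    have "g ** (n ** lowtri (a ^ p) (c ^ p) ** n') ** gi
      = (g ** gi) ** frobenius g ** lowtri (a ^ p) (c ^ p) ** frobenius gi ** (g ** gi)"
      by (simp only: n_def n'_def matrix_mul_assoc)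
    then show ?thesis by (simp add: el_def fm Flow g_gi)
  qed
  have pullF: "pull (frobenius (el a c)) = n ** lowtri (a ^ p) (c ^ p) ** n'" for a c
    by (simp add: Fel pull_conj)
  have "el 1 1 \<in> B" unfolding B_eq by (rule CollectI, rule exI[of _ 1], rule exI[of _ 1], simp)
  then have "frobenius (el 1 1) \<in> B" using frob_B by auto
  then obtain a c where "frobenius (el 1 1) = el a c" using B_eq by auto
  then have "pull (frobenius (el 1 1)) $ 1 $ 2 = 0" by simp
  \<comment> \<open>The upper right entry of the conjugate is minus the square of this entry of
    \<open>n\<close>.\<close>
  then have n12: "n $ 1 $ 2 = 0"
    using dn by (simp add: pullF n' mult_entry adj algebra_simps)
  obtain s :: 'k where s: "s \<noteq> 0" "s ^ p \<noteq> inverse (s ^ p)" using exists_generic by blast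
  have "el s 0 \<in> T" unfolding T_eq using s(1) by blast
  then have "frobenius (el s 0) \<in> T" using frob_T by auto
  then obtain b where "frobenius (el s 0) = el b 0" using T_eq by auto
  then have "pull (frobenius (el s 0)) $ 2 $ 1 = 0" by simp
  then have "n $ 2 $ 1 * n $ 2 $ 2 * (s ^ p - inverse (s ^ p)) = 0"
    using p_ge_3 by (simp add: pullF n' mult_entry adj algebra_simps power_0_left)
  moreover have n22: "n $ 2 $ 2 \<noteq> 0" using dn n12 by auto
  ultimately have n21: "n $ 2 $ 1 = 0" using s by simp
  have n11: "n $ 1 $ 1 * n $ 2 $ 2 = 1" using dn n12 by simp
  \<comment> \<open>Conjugation by a diagonal matrix of determinant 1 rescales the lower left entry;
    the factor, the square of the last diagonal entry of \<open>n\<close>, is the constant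
    sought.\<close>
  have conj: "n ** lowtri a c ** n' = lowtri a (n $ 2 $ 2 ^ 2 * c)" for a c
    using n11 by (simp add: mat2_eq_iff mult_entry n' adj n12 n21 power2_eq_square algebra_simps)
  have "frobenius (el a c) = el (a ^ p) (n $ 2 $ 2 ^ 2 * c ^ p)" for a c
    unfolding Fel conj by (simp only: el_def)
  then show ?thesis using n22 by (intro exI[of _ "n $ 2 $ 2 ^ 2"]) simp
qed

section \<open>Coordinate functions on the Borel subgroup\<close>

definition \<kappa> :: 'k where
  "\<kappa> = (SOME \<kappa>. \<kappa> \<noteq> 0 \<and> (\<forall>a c. frobenius (el a c) = el (a ^ p) (\<kappa> * c ^ p)))"

lemma \<kappa>_nonzero: "\<kappa> \<noteq> 0" and frob_el: "frobenius (el a c) = el (a ^ p) (\<kappa> * c ^ p)"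
proof -
  have "\<kappa> \<noteq> 0 \<and> (\<forall>a c. frobenius (el a c) = el (a ^ p) (\<kappa> * c ^ p))"
    unfolding \<kappa>_def by (rule someI_ex[OF frobenius_el])
  then show "\<kappa> \<noteq> 0" "frobenius (el a c) = el (a ^ p) (\<kappa> * c ^ p)" by blast+
qed

definition "ca x = pull x $ 1 $ 1"
definition "cb x = pull x $ 2 $ 2"
definition "cc x = pull x $ 2 $ 1"

lemma coords_el [simp]: "ca (el a c) = a" "cb (el a c) = inverse a" "cc (el a c) = c"
  by (simp_all add: ca_def cb_def cc_def)

lemma coords_coord: "restr K ca \<in> coord_ring K" "restr K cb \<in> coord_ring K" "restr K cc \<in> coord_ring K"
proof -
  have "restr K (\<lambda>x. (gi ** x ** g) $ i $ j) \<in> coord_ring K" for i j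
    unfolding matrix_matrix_mult_def by (simp add: mult.commute[of _ "g $ _ $ _"]) (intro coord_intros)
  then show "restr K ca \<in> coord_ring K" "restr K cb \<in> coord_ring K" "restr K cc \<in> coord_ring K"
    by (simp_all add: ca_def[abs_def] cb_def[abs_def] cc_def[abs_def] pull_def)
qed

text \<open>Conjugation by the fixed matrix g is linear. Hence inductions over a coordinate ring
  only have to deal with linear forms in a, c and the inverse of a.\<close>

lemma entry_el:
  obtains \<alpha> \<beta> \<gamma> where "\<And>a c. el a c $ i $ j = \<alpha> * a + \<beta> * c + \<gamma> * inverse a"
proof (rule that)
  show "el a c $ i $ j = (g $ i $ 1 * gi $ 1 $ j) * a + (g $ i $ 2 * gi $ 1 $ j) * c + (g $ i $ 2 * gi $ 2 $ j) * inverse a"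
    for a c by (simp add: el_def mult_entry algebra_simps)
qed

lemma B_group: "frobenius_group B"
proof
  show "prime CHAR('k)" by (rule prime_CHAR)
  show "mat 1 \<in> B" 
    unfolding B_eq el_one[symmetric] by (rule CollectI, rule exI[of _ 1], rule exI[of _ 0], simp)
  show "x ** y \<in> B" if xy: "x \<in> B" "y \<in> B" for x y
  proof -
    obtain a c a' c' where "x = el a c" "y = el a' c'" "a \<noteq> 0" "a' \<noteq> 0" using xy by (auto simp: B_eq)
    then have "x ** y = el (a * a') (c * a' + inverse a * c')" "a * a' \<noteq> 0" by (simp_all add: el_mult)
    then show ?thesis unfolding B_eq by blast
  qed
  show "frobenius x \<in> B" if "x \<in> B" for x using that frob_B by auto
qed

lemma T_group: "frobenius_group T"
proof
  show "prime CHAR('k)" by (rule prime_CHAR)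
  show "mat 1 \<in> T" 
    unfolding T_eq el_one[symmetric] by (rule CollectI, rule exI[of _ 1], simp)
  show "x ** y \<in> T" if "x \<in> T" "y \<in> T" for x y
    using that by (auto simp: T_eq el_mult)
  show "frobenius x \<in> T" if "x \<in> T" for x using that frob_T by auto
qed

end

section \<open>Moments of distributions\<close>

definition poly_pairing :: "(nat \<Rightarrow> 'c::zero \<Rightarrow> 'k::comm_ring) \<Rightarrow> 'c poly \<Rightarrow> 'k" where
  "poly_pairing w q = (\<Sum>i\<le>degree q. w i (coeff q i))"

lemma poly_pairing_bound:
  assumes "\<And>i. w i 0 = 0" and "degree q \<le> n"
  shows "poly_pairing w q = (\<Sum>i\<le>n. w i (coeff q i))"
  unfolding poly_pairing_def using assms
  by (intro sum.mono_neutral_left) (auto simp: coeff_eq_0)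

lemma poly_pairing_add:
  assumes "\<And>i. w i 0 = 0" and "\<And>i a b. w i (a + b) = w i a + w i b"
  shows "poly_pairing w (q + r) = poly_pairing w q + poly_pairing w r"
proof -
  let ?n = "max (degree q) (degree r)"
  have "degree (q + r) \<le> ?n" by (rule degree_add_le_max)
  then show ?thesis
    using assms(2) by (simp add: poly_pairing_bound[of w, OF assms(1), of _ ?n] sum.distrib)
qed

lemma poly_pairing_smult:
  fixes q :: "'c::idom poly"
  assumes "\<And>i. w i 0 = 0"
  shows "poly_pairing w (Polynomial.smult c q) = poly_pairing (\<lambda>i x. w i (c * x)) q"
proof -
  have "degree (Polynomial.smult c q) \<le> degree q" by (rule degree_smult_le)
  then have "poly_pairing w (Polynomial.smult c q) = (\<Sum>i\<le>degree q. w i (coeff (Polynomial.smult c q) i))"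
    by (rule poly_pairing_bound[of w, OF assms])
  then show ?thesis by (simp add: poly_pairing_def)
qed

lemma poly_pairing_monom_mult:
  fixes q :: "'c::idom poly"
  assumes "\<And>i. w i 0 = 0"
  shows "poly_pairing w (monom 1 k * q) = poly_pairing (\<lambda>i. w (i + k)) q"
proof -
  have "degree (monom 1 k * q) \<le> k + degree q"
    by (metis degree_monom_le degree_mult_le add_mono_thms_linordered_semiring(3) order_trans)
  then have "poly_pairing w (monom 1 k * q) = (\<Sum>i\<le>k + degree q. w i (coeff (monom 1 k * q) i))"
    by (rule poly_pairing_bound[of w, OF assms])
  also have "\<dots> = (\<Sum>i\<in>{k..k + degree q}. w i (coeff (monom 1 k * q) i))"
    using assms by (intro sum.mono_neutral_right) (auto simp: coeff_monom_mult)
  also have "\<dots> = (\<Sum>i\<le>degree q. w (i + k) (coeff q i))"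
    by (rule sum.reindex_bij_witness[of _ "\<lambda>i. i + k" "\<lambda>i. i - k"]) (auto simp: coeff_monom_mult)
  finally show ?thesis by (simp add: poly_pairing_def)
qed

text \<open>The linear functional on polynomials in two variables that takes the value
  \<open>v i m\<close> on a^i c^m. The outer variable is c, the inner one is a.\<close>

definition moment_sum :: "(nat \<Rightarrow> nat \<Rightarrow> 'k) \<Rightarrow> 'k::idom poly poly \<Rightarrow> 'k" where
  "moment_sum v Q = poly_pairing (\<lambda>m. poly_pairing (\<lambda>i x. x * v i m)) Q"

lemma inner_pairing_0: "poly_pairing (\<lambda>i x. x * v i) (0 :: 'k::idom poly) = 0"
  by (simp add: poly_pairing_def)

lemma inner_pairing_add: "poly_pairing (\<lambda>i x. x * v i) (q + r :: 'k::idom poly)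
    = poly_pairing (\<lambda>i x. x * v i) q + poly_pairing (\<lambda>i x. x * v i) r"
  by (rule poly_pairing_add) (auto simp: algebra_simps)

lemma moment_sum_add: "moment_sum v (Q + R) = moment_sum v Q + moment_sum v R"
  unfolding moment_sum_def by (rule poly_pairing_add) (auto simp: inner_pairing_0 inner_pairing_add)

lemma moment_sum_const_mult: "moment_sum v (Polynomial.smult [:c:] Q) = c * moment_sum v Q"
proof -
  have "poly_pairing (\<lambda>i x. x * v i m) ([:c:] * q) = c * poly_pairing (\<lambda>i x. x * v i m) q" for q m
  proof -
    have "poly_pairing (\<lambda>i x. x * v i m) (Polynomial.smult c q) = poly_pairing (\<lambda>i x. c * x * v i m) q"
      by (rule poly_pairing_smult) simp
    then show ?thesis by (simp add: poly_pairing_def sum_distrib_left mult.assoc)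
  qed
  then show ?thesis
    unfolding moment_sum_def
    by (subst poly_pairing_smult) (auto simp: inner_pairing_0 poly_pairing_def[of _ Q] sum_distrib_left)
qed

lemma moment_sum_shift_inner: "moment_sum v (Polynomial.smult (monom 1 k) Q) = moment_sum (\<lambda>i. v (i + k)) Q"
  unfolding moment_sum_def
  by (subst poly_pairing_smult) (auto simp: inner_pairing_0 poly_pairing_monom_mult)

lemma moment_sum_shift_outer: "moment_sum v (monom 1 k * Q) = moment_sum (\<lambda>i m. v i (m + k)) Q"
  unfolding moment_sum_def
  by (subst poly_pairing_monom_mult) (auto simp: inner_pairing_0)

lemma moment_sum_zero_moments: "(\<And>i m. v i m = 0) \<Longrightarrow> moment_sum v Q = 0"
  by (simp add: moment_sum_def poly_pairing_def)

lemma moment_sum_monom: "moment_sum v (monom (monom 1 i) m) = v i m"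
proof -
  have "moment_sum v (Polynomial.smult (monom 1 i) (monom 1 m * [:[:1:]:])) = v i m"
    by (simp only: moment_sum_shift_inner moment_sum_shift_outer) (simp add: moment_sum_def poly_pairing_def)
  then show ?thesis by (simp add: smult_monom one_pCons[symmetric])
qed

definition eval2 :: "'k::idom poly poly \<Rightarrow> 'k \<Rightarrow> 'k \<Rightarrow> 'k" where
  "eval2 Q a c = poly (poly Q [:c:]) a"

lemma eval2_simps: "eval2 (Q + R) a c = eval2 Q a c + eval2 R a c" "eval2 (Q * R) a c = eval2 Q a c * eval2 R a c"
  "eval2 (Polynomial.smult q Q) a c = poly q a * eval2 Q a c" "eval2 (monom 1 k) a c = c ^ k"
  "eval2 [:[:x:]:] a c = x"
  by (auto simp: eval2_def poly_monom poly_pCons)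

lemma eval2_eqI:
  fixes Q R :: "'k::alg_closed_field poly poly"
  assumes "\<And>a c. a \<noteq> 0 \<Longrightarrow> eval2 Q a c = eval2 R a c"
  shows "Q = R"
proof (rule ccontr)
  assume "Q \<noteq> R"
  then have "finite {x. poly (Q - R) x = 0}" by (intro poly_roots_finite) simp
  moreover have "poly (Q - R) [:c:] = 0" for c
    by (rule poly_eq_0_nonzero_roots) (use assms in \<open>simp add: eval2_def\<close>)
  then have "range (\<lambda>c. [:c:]) \<subseteq> {x. poly (Q - R) x = 0}" by auto
  ultimately have "finite (range (\<lambda>c :: 'k. [:c:]))" by (rule finite_subset[rotated])
  then have "finite (UNIV :: 'k set)" by (rule finite_imageD) (auto simp: inj_on_def)
  then show False using infinite_UNIV_alg_closed by blast
qed

section \<open>Functionals with prescribed moments\<close>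

context borel_setup
begin

interpretation B: frobenius_group B by (rule B_group)

text \<open>Denominators are cleared by powers of \<open>a\<^sup>p\<close> only, as this does not change the exponents
  of \<open>a\<close> modulo \<open>p\<close>.\<close>

definition represents :: "('k ^ 2 ^ 2 \<Rightarrow> 'k) \<Rightarrow> nat \<Rightarrow> 'k poly poly \<Rightarrow> bool" where
  "represents f N Q \<longleftrightarrow> (\<forall>a c. a \<noteq> 0 \<longrightarrow> f (el a c) * a ^ (p * N) = eval2 Q a c)"

lemma el_in_B: "a \<noteq> 0 \<Longrightarrow> el a c \<in> B"
  by (auto simp: B_eq)

lemma represents_add: "represents f N Q \<Longrightarrow> represents h M R \<Longrightarrow>
    represents (\<lambda>x. f x + h x) (N + M) (Polynomial.smult (monom 1 (p * M)) Q + Polynomial.smult (monom 1 (p * N)) R)"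
  by (auto simp: represents_def eval2_simps poly_monom power_add algebra_simps)

lemma represents_mult: "represents f N Q \<Longrightarrow> represents h M R \<Longrightarrow>
    represents (\<lambda>x. f x * h x) (N + M) (Q * R)"
  unfolding represents_def
proof (intro allI impI)
  fix a c :: 'k assume *: "\<forall>a c. a \<noteq> 0 \<longrightarrow> f (el a c) * a ^ (p * N) = eval2 Q a c"
    "\<forall>a c. a \<noteq> 0 \<longrightarrow> h (el a c) * a ^ (p * M) = eval2 R a c" "a \<noteq> 0"
  then have "eval2 (Q * R) a c = (f (el a c) * a ^ (p * N)) * (h (el a c) * a ^ (p * M))"
    by (simp add: eval2_simps)
  then show "f (el a c) * h (el a c) * a ^ (p * (N + M)) = eval2 (Q * R) a c"
    by (simp add: power_add distrib_left mult_ac)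
qed

lemma represents_exists: "f \<in> coord_ring B \<Longrightarrow> \<exists>N Q. represents f N Q"
proof (induction rule: coord_induct)
  case (const c)
  have "represents (restr B (\<lambda>_. c)) 0 [:[:c:]:]"
    by (auto simp: represents_def restr_def el_in_B eval2_simps)
  then show ?case by blast
next
  case (entry i j)
  obtain \<alpha> \<beta> \<gamma> where e: "\<And>a c. el a c $ i $ j = \<alpha> * a + \<beta> * c + \<gamma> * inverse a"
    using entry_el[of i j] by metis
  have "represents (restr B (\<lambda>x. x $ i $ j)) 1
    (Polynomial.smult (monom \<alpha> (p + 1)) [:[:1:]:] + Polynomial.smult (monom \<beta> p) (monom 1 1) + Polynomial.smult (monom \<gamma> (p - 1)) [:[:1:]:])"
    unfolding represents_def
  proof (intro allI impI)
    fix a c :: 'k assume a: "a \<noteq> 0"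
    obtain q where q: "p = Suc q" using p_ge_3 by (cases p) auto
    have "inverse a * a ^ p = a ^ (p - 1)" using a by (simp add: q)
    then have "(\<alpha> * a + \<beta> * c + \<gamma> * inverse a) * a ^ p = \<alpha> * a ^ (p + 1) + \<beta> * a ^ p * c + \<gamma> * a ^ (p - 1)"
      by (simp add: algebra_simps)
    then show "restr B (\<lambda>x. x $ i $ j) (el a c) * a ^ (p * 1) = eval2 (Polynomial.smult (monom \<alpha> (p + 1)) [:[:1:]:]
        + Polynomial.smult (monom \<beta> p) (monom 1 1) + Polynomial.smult (monom \<gamma> (p - 1)) [:[:1:]:]) a c"
      using a by (simp only: eval2_simps poly_monom) (simp add: restr_def el_in_B e)
  qed
  then show ?case by blast
next
  case (add f g)
  then show ?case using represents_add by blast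
next
  case (mult f g)
  then show ?case using represents_mult by blast
qed

lemma moment_sum_periodic_power:
  assumes "\<And>i m. v (i + p) m = v i m"
  shows "moment_sum v (Polynomial.smult (monom 1 (p * N)) Q) = moment_sum v Q"
proof -
  have "v (i + p * N) m = v i m" for i m
  proof (induction N)
    case (Suc N)
    have "i + p * Suc N = (i + p * N) + p" by simp
    then show ?case by (simp only: assms Suc)
  qed simp
  then have "(\<lambda>i. v (i + p * N)) = v" by (intro ext)
  then show ?thesis by (simp only: moment_sum_shift_inner)
qed

definition functional :: "(nat \<Rightarrow> nat \<Rightarrow> 'k) \<Rightarrow> ('k ^ 2 ^ 2 \<Rightarrow> 'k) \<Rightarrow> 'k" where
  "functional v = restr (coord_ring B) (\<lambda>f. moment_sum v (SOME Q. \<exists>N. represents f N Q))"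

text \<open>Two representing polynomials agree after multiplication by powers of a^p, and periodic
  moments do not see such powers. So the chosen representative does not matter.\<close>

lemma functional_eq:
  assumes per: "\<And>i m. v (i + p) m = v i m" and f: "f \<in> coord_ring B" and Q: "represents f N Q"
  shows "functional v f = moment_sum v Q"
proof -
  define R where "R = (SOME Q. \<exists>N. represents f N Q)"
  have "\<exists>N. represents f N R" unfolding R_def by (rule someI[of _ Q]) (use Q in blast)
  then obtain M where M: "represents f M R" by blast
  have "Polynomial.smult (monom 1 (p * M)) Q = Polynomial.smult (monom 1 (p * N)) R"
  proof (rule eval2_eqI)
    fix a c :: 'k assume "a \<noteq> 0"
    then have "eval2 Q a c = f (el a c) * a ^ (p * N)" "eval2 R a c = f (el a c) * a ^ (p * M)"
      using Q M by (simp_all add: represents_def)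
    then show "eval2 (Polynomial.smult (monom 1 (p * M)) Q) a c = eval2 (Polynomial.smult (monom 1 (p * N)) R) a c"
      by (simp add: eval2_simps poly_monom)
  qed
  then have "moment_sum v Q = moment_sum v R"
    using moment_sum_periodic_power[of v, OF per] by metis
  then show ?thesis using f by (simp add: functional_def restr_def R_def)
qed

lemma functional_dual:
  assumes per: "\<And>i m. v (i + p) m = v i m"
  shows "functional v \<in> dual_space (coord_ring B)"
  unfolding dual_space_def
proof (intro CollectI conjI allI ballI impI)
  show "functional v f = 0" if "f \<notin> coord_ring B" for f using that by (simp add: functional_def restr_def)
  fix f assume f: "f \<in> coord_ring B"
  then obtain N Q where Q: "represents f N Q" using represents_exists by blast
  show "functional v (\<lambda>x. f x + h x) = functional v f + functional v h" if h: "h \<in> coord_ring B" for h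
  proof -
    obtain M R where R: "represents h M R" using represents_exists[OF h] by blast
    show ?thesis
      using functional_eq[of v, OF per coord_add[OF f h] represents_add[OF Q R]]
        functional_eq[of v, OF per f Q] functional_eq[of v, OF per h R]
        moment_sum_periodic_power[of v, OF per]
      by (simp add: moment_sum_add)
  qed
  show "functional v (\<lambda>x. c * f x) = c * functional v f" for c
  proof -
    have "represents (\<lambda>x. c * f x) N (Polynomial.smult [:c:] Q)"
      using Q by (simp add: represents_def eval2_simps)
    then show ?thesis
      using functional_eq[of v, OF per coord_scale[OF f]] functional_eq[of v, OF per f Q]
      by (simp add: moment_sum_const_mult)
  qed
qed

text \<open>Periodicity says that a^p acts as 1, and vanishing says that c^p acts as 0: the
  relations of k[B_1]. The criterion \<open>distI\<close> is stable under sums and products of the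
  function pulled back, which reduces it to matrix entries.\<close>

lemma functional_dist:
  assumes per: "\<And>i m. v (i + p) m = v i m" and vanish: "\<And>i m. p \<le> m \<Longrightarrow> v i m = 0"
  shows "functional v \<in> carrier (dist_frob_kernel B)"
proof (rule B.distI[OF functional_dual[of v, OF per]])
  fix h u assume h: "h \<in> coord_ring B" and "u \<in> coord_ring B"
  note dual = functional_dual[of v, OF per]
  from \<open>u \<in> coord_ring B\<close> show "functional v (\<lambda>x. h x * u (frobenius x)) = u (mat 1) * functional v h"
    using h
  proof (induction arbitrary: h rule: coord_induct)
    case (const c)
    have "(\<lambda>x. h x * restr B (\<lambda>_. c) (frobenius x)) = (\<lambda>x. c * h x)"
      using coord_outside[OF const] B.frobenius_mem by (auto simp: restr_def fun_eq_iff)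
    then show ?case using const dual_scale[OF dual] B.one_mem by (simp add: restr_def)
  next
    case (entry i j)
    obtain \<alpha> \<beta> \<gamma> where e: "\<And>a c. el a c $ i $ j = \<alpha> * a + \<beta> * c + \<gamma> * inverse a"
      using entry_el[of i j] by metis
    obtain N Q where Q: "represents h N Q" using represents_exists[OF entry] by blast
    \<comment> \<open>Composed with F, the entry becomes \<alpha> a^p + \<beta> \<kappa> c^p +
      \<gamma> a^(-p). Multiplication by one more a^p clears the denominator, whence
      \<open>N + 1\<close>.\<close>
    let ?Q = "Polynomial.smult [:\<alpha>:] (Polynomial.smult (monom 1 (p * 2)) Q) + Polynomial.smult [:\<beta> * \<kappa>:] (Polynomial.smult (monom 1 p) (monom 1 p * Q)) + Polynomial.smult [:\<gamma>:] Q"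
    have "represents (\<lambda>x. h x * restr B (\<lambda>x. x $ i $ j) (frobenius x)) (N + 1) ?Q"
      unfolding represents_def
    proof (intro allI impI)
      fix a c :: 'k assume a: "a \<noteq> 0"
      have "eval2 ?Q a c = (\<alpha> * a ^ (p * 2) + \<beta> * \<kappa> * (a ^ p * c ^ p) + \<gamma>) * (h (el a c) * a ^ (p * N))"
        using Q a by (simp add: represents_def eval2_simps poly_monom algebra_simps)
      also have "\<dots> = h (el a c) * (\<alpha> * a ^ p + \<beta> * (\<kappa> * c ^ p) + \<gamma> * inverse (a ^ p)) * (a ^ (p * N) * a ^ p)"
      proof -
        have "inverse (a ^ p) * a ^ p = 1" using a by simp
        then have "(\<alpha> * a ^ p + \<beta> * (\<kappa> * c ^ p) + \<gamma> * inverse (a ^ p)) * a ^ p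
          = \<alpha> * a ^ (p * 2) + \<beta> * \<kappa> * (a ^ p * c ^ p) + \<gamma>"
          by (simp add: algebra_simps power_add mult_2_right)
        then show ?thesis by (metis (no_types, lifting) mult.assoc mult.commute)
      qed
      finally show "h (el a c) * restr B (\<lambda>x. x $ i $ j) (frobenius (el a c)) * a ^ (p * (N + 1)) = eval2 ?Q a c"
        using a by (simp add: restr_def frob_el el_in_B e power_add)
    qed
    from functional_eq[of v, OF per B.coord_frob_mult[OF entry coord_entry] this]
    have "functional v (\<lambda>x. h x * restr B (\<lambda>x. x $ i $ j) (frobenius x)) = moment_sum v ?Q" .
    also have "\<dots> = (\<alpha> + \<gamma>) * moment_sum v Q"
    proof -
      have "moment_sum v (Polynomial.smult (monom 1 p) (monom 1 p * Q)) = 0"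
        unfolding moment_sum_shift_inner moment_sum_shift_outer
        by (rule moment_sum_zero_moments) (simp add: vanish)
      then show ?thesis
        by (simp only: moment_sum_add moment_sum_const_mult moment_sum_periodic_power[of v, OF per])
          (simp add: algebra_simps)
    qed
    finally have "functional v (\<lambda>x. h x * restr B (\<lambda>x. x $ i $ j) (frobenius x)) = (\<alpha> + \<gamma>) * moment_sum v Q" .
    moreover have "(mat 1 :: 'k ^ 2 ^ 2) $ i $ j = \<alpha> + \<gamma>" using e[of 1 0] by (simp add: el_one)
    ultimately show ?case
      using functional_eq[of v, OF per entry Q] B.one_mem by (simp add: restr_def)
  next
    case (add u1 u2)
    have "functional v (\<lambda>x. h x * u1 (frobenius x) + h x * u2 (frobenius x))
      = functional v (\<lambda>x. h x * u1 (frobenius x)) + functional v (\<lambda>x. h x * u2 (frobenius x))"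
      by (intro dual_add[OF dual] B.coord_frob_mult add)
    then show ?case using add by (simp add: algebra_simps)
  next
    case (mult u1 u2)
    have "functional v (\<lambda>x. (h x * u1 (frobenius x)) * u2 (frobenius x))
      = u2 (mat 1) * functional v (\<lambda>x. h x * u1 (frobenius x))"
      by (intro mult B.coord_frob_mult)
    then show ?case using mult by (simp add: mult_ac)
  qed
qed

definition mono :: "nat \<Rightarrow> nat \<Rightarrow> 'k ^ 2 ^ 2 \<Rightarrow> 'k" where
  "mono i m = restr B (\<lambda>x. ca x ^ i * cc x ^ m)"

lemma mono_coord: "mono i m \<in> coord_ring B"
  unfolding mono_def by (intro coord_intros coords_coord)

lemma mono_el: "a \<noteq> 0 \<Longrightarrow> mono i m (el a c) = a ^ i * c ^ m"
  by (simp add: mono_def restr_def el_in_B)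

lemma B_eqI:
  assumes "f \<in> coord_ring B" and "h \<in> coord_ring B" and eq: "\<And>a c. a \<noteq> 0 \<Longrightarrow> f (el a c) = h (el a c)"
  shows "f = h"
proof
  fix x show "f x = h x"
  proof (cases "x \<in> B")
    case True
    then obtain a c where "x = el a c" "a \<noteq> 0" by (auto simp: B_eq)
    then show ?thesis using eq by simp
  qed (simp add: coord_outside[OF assms(1)] coord_outside[OF assms(2)])
qed

lemma functional_mono:
  assumes "\<And>i m. v (i + p) m = v i m"
  shows "functional v (mono i m) = v i m"
proof -
  have "represents (mono i m) 0 (monom (monom 1 i) m)"
    by (auto simp: represents_def mono_el eval2_def poly_monom)
  then show ?thesis using functional_eq[of v, OF assms mono_coord] by (simp add: moment_sum_monom)
qed

section \<open>A distribution is determined by its moments\<close>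

definition moment :: "(('k ^ 2 ^ 2 \<Rightarrow> 'k) \<Rightarrow> 'k) \<Rightarrow> nat \<Rightarrow> nat \<Rightarrow> 'k" where
  "moment \<mu> i m = \<mu> (mono i m)"

lemma coord_ca: "restr B ca \<in> coord_ring B" and coord_cb: "restr B cb \<in> coord_ring B"
  and coord_cc: "restr B cc \<in> coord_ring B"
  by (rule coords_coord)+

lemma moment_periodic:
  assumes "\<mu> \<in> carrier (dist_frob_kernel B)"
  shows "moment \<mu> (i + p) m = moment \<mu> i m"
proof -
  have "(\<lambda>x. mono i m x * restr B ca (frobenius x)) = mono (i + p) m"
    by (rule B_eqI, intro B.coord_frob_mult mono_coord coord_ca, rule mono_coord)
      (simp add: mono_el restr_def frob_el el_in_B power_add)
  then show ?thesis
    using B.dist_frobenius[OF assms mono_coord coord_ca, of i m] B.one_mem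
    by (simp add: moment_def restr_def flip: el_one)
qed

text \<open>The coordinate c composed with F is \<kappa> c^p and vanishes at 1; the nonzero factor
  \<kappa> can be cancelled.\<close>

lemma moment_vanish:
  assumes "\<mu> \<in> carrier (dist_frob_kernel B)" and "p \<le> m"
  shows "moment \<mu> i m = 0"
proof -
  have "(\<lambda>x. mono i (m - p) x * restr B cc (frobenius x)) = (\<lambda>x. \<kappa> * mono i m x)"
    by (rule B_eqI, intro B.coord_frob_mult mono_coord coord_cc, intro coord_scale mono_coord)
      (use assms(2) in \<open>simp add: mono_el restr_def frob_el el_in_B power_add[symmetric]\<close>)
  then have "\<kappa> * moment \<mu> i m = 0"
    using B.dist_frobenius[OF assms(1) mono_coord coord_cc, of i "m - p"] B.one_mem
      dual_scale[OF B.dist_dual[OF assms(1)] mono_coord, of \<kappa> i m]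
    by (simp add: moment_def restr_def flip: el_one)
  then show ?thesis using \<kappa>_nonzero by simp
qed

text \<open>The functionals killed by all moments are stable under multiplication by functions, and
  evaluating at \<open>1\<close> shows that they are zero.\<close>

definition momentless :: "(('k ^ 2 ^ 2 \<Rightarrow> 'k) \<Rightarrow> 'k) \<Rightarrow> bool" where
  "momentless \<delta> \<longleftrightarrow> (\<forall>f\<in>coord_ring B. \<forall>h\<in>coord_ring B. \<delta> (\<lambda>x. f x + h x) = \<delta> f + \<delta> h) \<and>
     (\<forall>c. \<forall>f\<in>coord_ring B. \<delta> (\<lambda>x. c * f x) = c * \<delta> f) \<and>
     (\<forall>h\<in>coord_ring B. \<forall>u\<in>coord_ring B. \<delta> (\<lambda>x. h x * u (frobenius x)) = u (mat 1) * \<delta> h) \<and>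
     (\<forall>i m. \<delta> (mono i m) = 0)"

lemma momentless_scaled:
  assumes "momentless \<delta>" and "\<And>h. h \<in> coord_ring B \<Longrightarrow> \<delta>' h = c * \<delta> h"
  shows "momentless \<delta>'"
  using assms
  by (simp add: momentless_def coord_add coord_scale mono_coord B.coord_frob_mult algebra_simps)

lemma momentless_sum:
  assumes "momentless \<delta>" and "momentless \<epsilon>"
    and "\<And>h. h \<in> coord_ring B \<Longrightarrow> \<delta>' h = \<delta> h + \<epsilon> h"
  shows "momentless \<delta>'"
  using assms
  by (simp add: momentless_def coord_add coord_scale mono_coord B.coord_frob_mult algebra_simps)

text \<open>Sums and products of the multiplier are formal. For a matrix entry the only part that
  does not map monomials to monomials is the inverse of a, and periodicity removes it.\<close>

lemma momentless_mult:
  assumes "f \<in> coord_ring B" and "momentless \<delta>"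
  shows "momentless (\<lambda>h. \<delta> (\<lambda>x. f x * h x))"
  using assms
proof (induction arbitrary: \<delta> rule: coord_induct)
  case (const c)
  have "(\<lambda>x. restr B (\<lambda>_. c) x * h x) = (\<lambda>x. c * h x)" if "h \<in> coord_ring B" for h
    using coord_outside[OF that] by (auto simp: restr_def fun_eq_iff)
  moreover have "\<delta> (\<lambda>x. c * h x) = c * \<delta> h" if "h \<in> coord_ring B" for h
    using const that by (simp add: momentless_def)
  ultimately show ?case by (intro momentless_scaled[OF const, where c = c]) simp
next
  case (entry i j)
  obtain \<alpha> \<beta> \<gamma> where e: "\<And>a c. el a c $ i $ j = \<alpha> * a + \<beta> * c + \<gamma> * inverse a"
    using entry_el[of i j] by metis
  let ?e = "restr B (\<lambda>x. x $ i $ j)"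
  have add: "\<delta> (\<lambda>x. f x + h x) = \<delta> f + \<delta> h"
    and frob: "\<delta> (\<lambda>x. f x * h (frobenius x)) = h (mat 1) * \<delta> f"
    if "f \<in> coord_ring B" "h \<in> coord_ring B" for f h
    using entry that by (auto simp: momentless_def)
  have scale: "\<delta> (\<lambda>x. c * f x) = c * \<delta> f" if "f \<in> coord_ring B" for f c
    using entry that by (auto simp: momentless_def)
  have zero: "\<delta> (mono k m) = 0" for k m using entry by (auto simp: momentless_def)
  have "\<delta> (\<lambda>x. ?e x * mono k m x) = 0" for k m
  proof -
    \<comment> \<open>A monomial divided by a. Multiplied by a^p, which is a composed with F and
      counts as 1, it becomes an ordinary monomial with exponent \<open>k + (p - 1)\<close>.\<close>
    let ?b = "\<lambda>x. restr B cb x * mono k m x"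
    have b: "?b \<in> coord_ring B" by (intro coord_mult coord_cb mono_coord)
    have "(\<lambda>x. ?b x * restr B ca (frobenius x)) = mono (k + (p - 1)) m"
    proof (rule B_eqI)
      fix a c :: 'k assume a: "a \<noteq> 0"
      obtain q where q: "p = Suc q" using p_ge_3 by (cases p) auto
      show "?b (el a c) * restr B ca (frobenius (el a c)) = mono (k + (p - 1)) m (el a c)"
        using a by (simp add: restr_def el_in_B mono_el frob_el q power_add)
    qed (intro B.coord_frob_mult b coord_ca mono_coord)+
    then have "\<delta> ?b = 0"
      using frob[OF b coord_ca] zero B.one_mem by (simp add: restr_def flip: el_one)
    moreover have "(\<lambda>x. ?e x * mono k m x) = (\<lambda>x. \<alpha> * mono (k + 1) m x + (\<beta> * mono k (m + 1) x + \<gamma> * ?b x))"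
      by (rule B_eqI, intro coord_mult coord_entry mono_coord, intro coord_add coord_scale mono_coord b)
        (simp add: mono_el restr_def el_in_B e algebra_simps)
    ultimately show ?thesis
      by (simp add: add scale zero coord_add coord_scale mono_coord b)
  qed
  then have "\<forall>k m. \<delta> (\<lambda>x. ?e x * mono k m x) = 0" by blast
  moreover have "\<delta> (\<lambda>x. ?e x * (f x + h x)) = \<delta> (\<lambda>x. ?e x * f x) + \<delta> (\<lambda>x. ?e x * h x)"
    if "f \<in> coord_ring B" "h \<in> coord_ring B" for f h
    using add[of "\<lambda>x. ?e x * f x" "\<lambda>x. ?e x * h x"] that by (simp add: coord_mult coord_entry distrib_left)
  moreover have "\<delta> (\<lambda>x. ?e x * (c * f x)) = c * \<delta> (\<lambda>x. ?e x * f x)" if "f \<in> coord_ring B" for f c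
    using scale[of "\<lambda>x. ?e x * f x" c] that by (simp add: coord_mult coord_entry mult.left_commute)
  moreover have "\<delta> (\<lambda>x. ?e x * (h x * u (frobenius x))) = u (mat 1) * \<delta> (\<lambda>x. ?e x * h x)"
    if "h \<in> coord_ring B" "u \<in> coord_ring B" for h u
    using frob[of "\<lambda>x. ?e x * h x" u] that by (simp add: coord_mult coord_entry mult.assoc)
  ultimately show ?case unfolding momentless_def by blast
next
  case (add f g)
  then have "momentless (\<lambda>h. \<delta> (\<lambda>x. f x * h x))" "momentless (\<lambda>h. \<delta> (\<lambda>x. g x * h x))" by auto
  moreover have "\<delta> (\<lambda>x. (f x + g x) * h x) = \<delta> (\<lambda>x. f x * h x) + \<delta> (\<lambda>x. g x * h x)" if "h \<in> coord_ring B" for h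
    using add.prems add.hyps that by (simp add: momentless_def distrib_right coord_mult)
  ultimately show ?case by (rule momentless_sum)
next
  case (mult f g)
  then have "momentless (\<lambda>h. \<delta> (\<lambda>x. f x * h x))" by auto
  then have "momentless (\<lambda>h. \<delta> (\<lambda>x. f x * (g x * h x)))" by (rule mult.IH(2))
  then show ?case by (simp add: mult.assoc)
qed

lemma moment_eqI:
  assumes \<mu>: "\<mu> \<in> carrier (dist_frob_kernel B)" and \<nu>: "\<nu> \<in> carrier (dist_frob_kernel B)"
    and eq: "\<And>i m. moment \<mu> i m = moment \<nu> i m"
  shows "\<mu> = \<nu>"
proof (rule dual_eqI[OF B.dist_dual[OF \<mu>] B.dist_dual[OF \<nu>]])
  fix f assume f: "f \<in> coord_ring B"
  have "momentless (\<lambda>f. \<mu> f - \<nu> f)"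
    using dual_add[OF B.dist_dual[OF \<mu>]] dual_add[OF B.dist_dual[OF \<nu>]]
      dual_scale[OF B.dist_dual[OF \<mu>]] dual_scale[OF B.dist_dual[OF \<nu>]]
      B.dist_frobenius[OF \<mu>] B.dist_frobenius[OF \<nu>] eq
    by (simp add: momentless_def moment_def algebra_simps)
  from momentless_mult[OF f this] have "\<mu> (\<lambda>x. f x * mono 0 0 x) - \<nu> (\<lambda>x. f x * mono 0 0 x) = 0"
    by (simp add: momentless_def)
  moreover have "(\<lambda>x. f x * mono 0 0 x) = f"
    using coord_outside[OF f] by (auto simp: mono_def restr_def fun_eq_iff)
  ultimately show "\<mu> f = \<nu> f" by simp
qed

end

lemma (in frobenius_group) pairing_sum:
  assumes "\<mu> \<in> dual_space \<O>" "\<nu> \<in> dual_space \<O>" and "\<And>i. i \<in> I \<Longrightarrow> tensor H (F i)"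
  shows "pairing \<mu> \<nu> (\<lambda>x y. \<Sum>i\<in>I. F i x y) = (\<Sum>i\<in>I. pairing \<mu> \<nu> (F i))"
  using assms(3)
proof (induction I rule: infinite_finite_induct)
  case (insert i I)
  then show ?case
    using pairing_add[OF assms(1,2), of "F i" "\<lambda>x y. \<Sum>i\<in>I. F i x y"] by (simp add: tensor_sum)
qed (use dual_zero[OF assms(1)] dual_zero[OF assms(2)] in \<open>simp_all add: pairing_def\<close>)

section \<open>Identification of the distribution algebra with the path algebra\<close>

context borel_setup
begin

interpretation B: frobenius_group B by (rule B_group)

text \<open>Binomial expansion of the comultiplication (a a')^i (c a' + a^(-1) c')^n. With i = 2 u +
  n the negative powers of a are absorbed, and the exponents that appear are those of a path of
  length q from u and one of length n - q from u + q.\<close>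

lemma moment_mult:
  assumes \<mu>: "\<mu> \<in> carrier (dist_frob_kernel B)" and \<nu>: "\<nu> \<in> carrier (dist_frob_kernel B)"
  shows "moment (\<mu> \<otimes>\<^bsub>dist_frob_kernel B\<^esub> \<nu>) (2 * u + n) n =
    (\<Sum>q\<le>n. of_nat (n choose q) * moment \<mu> (2 * u + q) q * moment \<nu> (2 * u + n + q) (n - q))"
proof -
  note d = B.dist_dual[OF \<mu>] B.dist_dual[OF \<nu>]
  let ?F = "\<lambda>q x y. (of_nat (n choose q) * mono (2 * u + q) q x) * mono (2 * u + n + q) (n - q) y"
  have "(\<lambda>x y. if x \<in> B \<and> y \<in> B then mono (2 * u + n) n (x ** y) else 0) = (\<lambda>x y. \<Sum>q\<le>n. ?F q x y)"
  proof (intro ext)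
    fix x y
    show "(if x \<in> B \<and> y \<in> B then mono (2 * u + n) n (x ** y) else 0) = (\<Sum>q\<le>n. ?F q x y)"
    proof (cases "x \<in> B \<and> y \<in> B")
      case False
      then have "?F q x y = 0" for q
        using coord_outside[OF mono_coord, of x] coord_outside[OF mono_coord, of y] by auto
      then have "(\<Sum>q\<le>n. ?F q x y) = 0" by (intro sum.neutral) blast
      then show ?thesis by (simp only: False if_False)
    next
      case True
      then obtain a c a' c' where x: "x = el a c" "a \<noteq> 0" and y: "y = el a' c'" "a' \<noteq> 0"
        by (auto simp: B_eq)
      have "mono (2 * u + n) n (x ** y) = (a * a') ^ (2 * u + n) * (c * a' + inverse a * c') ^ n"
        using x y by (simp add: el_mult mono_el)
      also have "\<dots> = (\<Sum>q\<le>n. (a * a') ^ (2 * u + n) * (of_nat (n choose q) * (c * a') ^ q * (inverse a * c') ^ (n - q)))"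
        by (simp add: binomial_ring sum_distrib_left)
      also have "\<dots> = (\<Sum>q\<le>n. ?F q x y)"
      proof (rule sum.cong[OF refl])
        fix q assume "q \<in> {..n}"
        then have "a ^ (2 * u + n) * inverse a ^ (n - q) = a ^ (2 * u + q) * (a ^ (n - q) * inverse a ^ (n - q))"
          by (simp only: mult.assoc[symmetric] power_add[symmetric]) simp
        also have "\<dots> = a ^ (2 * u + q)" using x by (simp add: power_mult_distrib[symmetric])
        finally have *: "a ^ (2 * u + n) * inverse a ^ (n - q) = a ^ (2 * u + q)" .
        have mxy: "mono (2 * u + q) q x = a ^ (2 * u + q) * c ^ q"
          "mono (2 * u + n + q) (n - q) y = a' ^ (2 * u + n + q) * c' ^ (n - q)"
          using x y by (simp_all add: mono_el)
        have "(a * a') ^ (2 * u + n) * (of_nat (n choose q) * (c * a') ^ q * (inverse a * c') ^ (n - q))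
          = of_nat (n choose q) * ((a ^ (2 * u + n) * inverse a ^ (n - q)) * c ^ q) * ((a' ^ (2 * u + n) * a' ^ q) * c' ^ (n - q))"
          by (simp only: power_mult_distrib mult_ac)
        then show "(a * a') ^ (2 * u + n) * (of_nat (n choose q) * (c * a') ^ q * (inverse a * c') ^ (n - q)) = ?F q x y"
          by (simp only: * mxy power_add[symmetric] mult.assoc)
      qed
      finally show ?thesis using True by simp
    qed
  qed
  then have "moment (\<mu> \<otimes>\<^bsub>dist_frob_kernel B\<^esub> \<nu>) (2 * u + n) n = B.pairing \<mu> \<nu> (\<lambda>x y. \<Sum>q\<le>n. ?F q x y)"
    by (simp add: moment_def B.dist_mult_pairing[OF d(2) mono_coord])
  also have "\<dots> = (\<Sum>q\<le>n. B.pairing \<mu> \<nu> (?F q))"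
    by (rule B.pairing_sum[OF d]) (intro tensor.pure coord_scale mono_coord)
  also have "\<dots> = (\<Sum>q\<le>n. of_nat (n choose q) * moment \<mu> (2 * u + q) q * moment \<nu> (2 * u + n + q) (n - q))"
    by (simp add: B.pairing_pure[OF d] coord_scale mono_coord dual_scale[OF d(1)] moment_def)
  finally show ?thesis .
qed

lemma moment_mod:
  assumes "\<mu> \<in> carrier (dist_frob_kernel B)" and "i mod p = i' mod p"
  shows "moment \<mu> i m = moment \<mu> i' m"
proof -
  have "moment \<mu> (i + p * k) m = moment \<mu> i m" for i k
  proof (induction k)
    case (Suc k)
    have "i + p * Suc k = (i + p * k) + p" by simp
    then show ?case by (simp only: moment_periodic[OF assms(1)] Suc)
  qed simp
  then have "moment \<mu> i m = moment \<mu> (i mod p) m" for i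
    by (metis mod_mult_div_eq)
  then show ?thesis using assms(2) by metis
qed

text \<open>The functional dual to \<open>a\<^sup>i c\<^sup>j\<close>, times \<open>j!\<close>, is a path of length \<open>j\<close> from the idempotent of
  weight \<open>i - j\<close> to that of weight \<open>i + j\<close>. As \<open>p\<close> is odd, the weights can be numbered as \<open>2 u\<close>.\<close>

definition model :: "(('k ^ 2 ^ 2 \<Rightarrow> 'k) \<Rightarrow> 'k) \<Rightarrow> 'k path_alg" where
  "model \<mu> = mk_path (\<lambda>u j. moment \<mu> (2 * u + j) j / of_nat (fact j))"

lemma fact_nonzero: "j < p \<Longrightarrow> of_nat (fact j) \<noteq> (0 :: 'k)"
  using prime_p by (simp add: of_nat_eq_0_iff_char_dvd p_eq[symmetric] prime_dvd_fact_iff)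

lemma pcoef_model: "u < p \<Longrightarrow> j < p \<Longrightarrow> pcoef (model \<mu>) u j = moment \<mu> (2 * u + j) j / of_nat (fact j)"
  by (simp add: model_def pcoef_mk_path p_eq)

text \<open>The factorials absorb the binomial coefficients, and 2 u + n + q = 2 (u + q) + (n - q)
  says that the second path starts where the first one ends.\<close>

lemma model_mult:
  assumes \<mu>: "\<mu> \<in> carrier (dist_frob_kernel B)" and \<nu>: "\<nu> \<in> carrier (dist_frob_kernel B)"
  shows "model (\<mu> \<otimes>\<^bsub>dist_frob_kernel B\<^esub> \<nu>) = model \<mu> * model \<nu>"
proof (rule path_alg_eqI)
  fix u n assume "u < CHAR('k)" "n < CHAR('k)"
  then have un: "u < p" "n < p" by (simp_all add: p_eq)
  have "pcoef (model (\<mu> \<otimes>\<^bsub>dist_frob_kernel B\<^esub> \<nu>)) u n =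
    (\<Sum>q\<le>n. of_nat (n choose q) * moment \<mu> (2 * u + q) q * moment \<nu> (2 * u + n + q) (n - q) / of_nat (fact n))"
    using un by (simp add: pcoef_model moment_mult[OF \<mu> \<nu>] sum_divide_distrib)
  also have "\<dots> = (\<Sum>q\<le>n. pcoef (model \<mu>) u q * pcoef (model \<nu>) ((u + q) mod p) (n - q))"
  proof (rule sum.cong[OF refl])
    fix q assume "q \<in> {..n}"
    then have q: "q \<le> n" by simp
    have "(2 * ((u + q) mod p) + (n - q)) mod p = (2 * (u + q) + (n - q)) mod p"
      by (metis mod_add_left_eq mod_mult_right_eq)
    also have "2 * (u + q) + (n - q) = 2 * u + n + q" using q by simp
    finally have m: "moment \<nu> (2 * ((u + q) mod p) + (n - q)) (n - q) = moment \<nu> (2 * u + n + q) (n - q)"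
      by (rule moment_mod[OF \<nu>])
    have "of_nat (fact q) * of_nat (fact (n - q)) * of_nat (n choose q) = (of_nat (fact n) :: 'k)"
      using binomial_fact_lemma[OF q] by (metis of_nat_mult)
    moreover have "of_nat (fact q) \<noteq> (0 :: 'k)" "of_nat (fact (n - q)) \<noteq> (0 :: 'k)" "of_nat (fact n) \<noteq> (0 :: 'k)"
      using un q by (auto intro!: fact_nonzero)
    ultimately have "of_nat (n choose q) / of_nat (fact n) = 1 / (of_nat (fact q) * of_nat (fact (n - q)) :: 'k)"
      by (simp add: field_simps)
    then have "of_nat (n choose q) * X * Y / of_nat (fact n) = X / of_nat (fact q) * (Y / of_nat (fact (n - q)))" for X Y :: 'k
      by (metis (no_types, lifting) mult.assoc mult.commute times_divide_eq_left times_divide_times_eq mult_1)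
    moreover have "pcoef (model \<mu>) u q = moment \<mu> (2 * u + q) q / of_nat (fact q)"
      by (rule pcoef_model) (use un q in auto)
    moreover have "pcoef (model \<nu>) ((u + q) mod p) (n - q)
        = moment \<nu> (2 * ((u + q) mod p) + (n - q)) (n - q) / of_nat (fact (n - q))"
      by (rule pcoef_model) (use un q in auto)
    ultimately show "of_nat (n choose q) * moment \<mu> (2 * u + q) q * moment \<nu> (2 * u + n + q) (n - q) / of_nat (fact n)
      = pcoef (model \<mu>) u q * pcoef (model \<nu>) ((u + q) mod p) (n - q)"
      by (simp only: m)
  qed
  also have "\<dots> = pcoef (model \<mu> * model \<nu>) u n"
    using un by (simp add: pcoef_mult p_eq)
  finally show "pcoef (model (\<mu> \<otimes>\<^bsub>dist_frob_kernel B\<^esub> \<nu>)) u n = pcoef (model \<mu> * model \<nu>) u n" .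
qed

text \<open>The solution u of 2 u + m = i modulo p, for \<open>m < p\<close>: here
  \<open>p - m\<close> stands for -m, and (p + 1) / 2 is the inverse of 2 modulo the odd number
  p.\<close>

definition vertex :: "nat \<Rightarrow> nat \<Rightarrow> nat" where
  "vertex i m = ((i + (p - m)) * ((p + 1) div 2)) mod p"

lemma two_half: "2 * ((p + 1) div 2) = p + 1"
  using odd_p by simp

lemma vertex_periodic: "vertex (i + p) m = vertex i m"
proof -
  have "(i + p + (p - m)) * ((p + 1) div 2) = (i + (p - m)) * ((p + 1) div 2) + p * ((p + 1) div 2)"
    by (simp add: algebra_simps)
  then show ?thesis by (simp only: vertex_def mod_mult_self2)
qed

lemma vertex_path: "m < p \<Longrightarrow> vertex (2 * u + m) m = u mod p"
proof -
  assume "m < p"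
  then have "(2 * u + m + (p - m)) * ((p + 1) div 2) = u * (2 * ((p + 1) div 2)) + p * ((p + 1) div 2)"
    by (simp add: algebra_simps del: two_half)
  also have "\<dots> = u + p * (u + (p + 1) div 2)"
    unfolding two_half by (simp add: algebra_simps)
  finally show ?thesis by (simp only: vertex_def mod_mult_self2)
qed

lemma vertex_mod: "m < p \<Longrightarrow> (2 * vertex i m + m) mod p = i mod p"
proof -
  assume m: "m < p"
  have "(2 * vertex i m + m) mod p = (2 * ((i + (p - m)) * ((p + 1) div 2)) + m) mod p"
    unfolding vertex_def by (metis mod_add_left_eq mod_mult_right_eq)
  also have "2 * ((i + (p - m)) * ((p + 1) div 2)) + m = (i + (p - m)) * (p + 1) + m"
    by (metis two_half mult.left_commute)
  also have "\<dots> = i + p * (i + (p - m) + 1)"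
  proof -
    define r where "r = p - m"
    have "r + m = p" using m by (simp add: r_def)
    then have "(i + r) * (p + 1) + m = (i + r) * p + i + p" by simp
    then show ?thesis by (simp add: r_def[symmetric] algebra_simps)
  qed
  finally show ?thesis by (simp only: mod_mult_self2)
qed

lemma vertex_less: "vertex i m < p"
  using p_ge_3 by (simp add: vertex_def)

lemma moment_model:
  assumes "\<mu> \<in> carrier (dist_frob_kernel B)" and "m < p"
  shows "moment \<mu> i m = of_nat (fact m) * pcoef (model \<mu>) (vertex i m) m"
  using moment_mod[OF assms(1), of i "2 * vertex i m + m" m] assms(2) vertex_mod[of m i]
    fact_nonzero[of m] by (simp add: pcoef_model vertex_less)

lemma model_inj: "inj_on model (carrier (dist_frob_kernel B))"
proof (rule inj_onI)
  fix \<mu> \<nu> assume \<mu>: "\<mu> \<in> carrier (dist_frob_kernel B)" and \<nu>: "\<nu> \<in> carrier (dist_frob_kernel B)"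
    and eq: "model \<mu> = model \<nu>"
  show "\<mu> = \<nu>"
  proof (rule moment_eqI[OF \<mu> \<nu>])
    fix i m show "moment \<mu> i m = moment \<nu> i m"
      using moment_model[OF \<mu>] moment_model[OF \<nu>] moment_vanish[OF \<mu>] moment_vanish[OF \<nu>] eq
      by (cases "m < p") auto
  qed
qed

text \<open>The coefficients of \<open>x\<close> prescribe moments, with \<open>vertex\<close>
  recovering the starting point from the exponent. They are periodic and vanish from
  \<open>p\<close> on, so \<open>functional_dist\<close> realises them.\<close>

lemma model_surj: "\<exists>\<mu>\<in>carrier (dist_frob_kernel B). model \<mu> = x"
proof -
  define v where "v i m = (if m < p then of_nat (fact m) * pcoef x (vertex i m) m else 0)" for i m
  have per: "v (i + p) m = v i m" for i m by (simp add: v_def vertex_periodic)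
  have mem: "functional v \<in> carrier (dist_frob_kernel B)"
    by (rule functional_dist[of v, OF per]) (simp add: v_def)
  have "model (functional v) = x"
  proof (rule path_alg_eqI)
    fix u j assume "u < CHAR('k)" "j < CHAR('k)"
    then have uj: "u < p" "j < p" by (simp_all add: p_eq)
    then show "pcoef (model (functional v)) u j = pcoef x u j"
      using fact_nonzero[of j] by (simp add: pcoef_model moment_def functional_mono[of v, OF per])
        (simp add: v_def vertex_path)
  qed
  then show ?thesis using mem by blast
qed

lemma dist_record [simp]:
  "\<zero>\<^bsub>dist_frob_kernel B\<^esub> = (\<lambda>f. 0)" "\<mu> \<oplus>\<^bsub>dist_frob_kernel B\<^esub> \<nu> = (\<lambda>f. \<mu> f + \<nu> f)"
  "c \<odot>\<^bsub>dist_frob_kernel B\<^esub> \<mu> = (\<lambda>f. c * \<mu> f)"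
  by (simp_all add: dist_frob_kernel_def)

lemma dist_zero_closed: "(\<lambda>f. 0) \<in> carrier (dist_frob_kernel B)"
  and dist_add_closed: "\<mu> \<in> carrier (dist_frob_kernel B) \<Longrightarrow> \<nu> \<in> carrier (dist_frob_kernel B) \<Longrightarrow>
    (\<lambda>f. \<mu> f + \<nu> f) \<in> carrier (dist_frob_kernel B)"
  and dist_smult_closed: "\<mu> \<in> carrier (dist_frob_kernel B) \<Longrightarrow> (\<lambda>f. c * \<mu> f) \<in> carrier (dist_frob_kernel B)"
  by (auto simp: dist_frob_kernel_def dual_space_def algebra_simps)

lemma model_one: "model \<one>\<^bsub>dist_frob_kernel B\<^esub> = 1"
proof (rule path_alg_eqI)
  fix u j assume "u < CHAR('k)" "j < CHAR('k)"
  moreover have "moment \<one>\<^bsub>dist_frob_kernel B\<^esub> i m = (if m = 0 then 1 else 0)" for i m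
  proof -
    have "\<one>\<^bsub>dist_frob_kernel B\<^esub> (mono i m) = mono i m (el 1 0)"
      by (simp add: dist_frob_kernel_def restr_def mono_coord el_one)
    then show ?thesis by (simp add: moment_def mono_el power_0_left)
  qed
  ultimately show "pcoef (model \<one>\<^bsub>dist_frob_kernel B\<^esub>) u j = pcoef 1 u j"
    by (simp add: pcoef_model p_eq one_path_alg_def pcoef_mk_path)
qed

lemma algebra_model_dist: "algebra_model psc (dist_frob_kernel B) model"
proof -
  interpret scaled_ring "psc :: 'k \<Rightarrow> _" by (rule scaled_ring_path_alg)
  show ?thesis
  proof
    show "bij_betw model (carrier (dist_frob_kernel B)) UNIV"
      unfolding bij_betw_def
    proof (intro conjI model_inj equalityI subsetI UNIV_I)
      show "x \<in> model ` carrier (dist_frob_kernel B)" for x using model_surj[of x] by auto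
    qed
    show "model \<zero>\<^bsub>dist_frob_kernel B\<^esub> = 0"
      by (rule path_alg_eqI) (simp add: model_def pcoef_mk_path moment_def pcoef_zero)
    show "model (\<mu> \<oplus>\<^bsub>dist_frob_kernel B\<^esub> \<nu>) = model \<mu> + model \<nu>" for \<mu> \<nu>
      by (rule path_alg_eqI) (simp add: model_def pcoef_mk_path moment_def pcoef_add add_divide_distrib)
    show "model (c \<odot>\<^bsub>dist_frob_kernel B\<^esub> \<mu>) = psc c (model \<mu>)" for c \<mu>
      by (rule path_alg_eqI) (simp add: model_def pcoef_mk_path moment_def pcoef_psc)
  qed (simp_all add: dist_zero_closed dist_add_closed dist_smult_closed model_one model_mult
      B.dist_one_closed B.dist_mult_closed)
qed

lemma adjoint_el_closed:
  assumes "s \<noteq> 0" and "\<mu> \<in> carrier (dist_frob_kernel B)"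
  shows "adjoint_action B (el s 0) \<mu> \<in> carrier (dist_frob_kernel B)"
  using assms by (intro B.adjoint_action_closed) (simp_all add: matrix_inv_el el_in_B el_mult el_one)

lemma moment_adjoint:
  assumes "s \<noteq> 0" and \<mu>: "\<mu> \<in> carrier (dist_frob_kernel B)"
  shows "moment (adjoint_action B (el s 0) \<mu>) i m = (inverse s ^ 2) ^ m * moment \<mu> i m"
proof -
  have "restr B (\<lambda>x. mono i m (el s 0 ** x ** matrix_inv (el s 0))) = (\<lambda>x. (inverse s ^ 2) ^ m * mono i m x)"
  proof (rule B_eqI)
    show "restr B (\<lambda>x. mono i m (el s 0 ** x ** matrix_inv (el s 0))) \<in> coord_ring B"
    proof (rule coord_two_sided[OF mono_coord])
      fix x assume "x \<in> B"
      then obtain a c where "x = el a c" "a \<noteq> 0" by (auto simp: B_eq)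
      then show "el s 0 ** x ** matrix_inv (el s 0) \<in> B"
        using assms by (simp add: el_conj el_in_B)
    qed
    show "restr B (\<lambda>x. mono i m (el s 0 ** x ** matrix_inv (el s 0))) (el a c) = (inverse s ^ 2) ^ m * mono i m (el a c)"
      if "a \<noteq> 0" for a c
      using that assms by (simp add: restr_def el_in_B el_conj mono_el power_mult_distrib mult_ac)
  qed (intro coord_scale mono_coord)
  then show ?thesis
    by (simp add: moment_def adjoint_action_def restr_def[of "coord_ring B"] mono_coord
        dual_scale[OF B.dist_dual[OF \<mu>]])
qed

end

section \<open>The Lie algebra of the unipotent radical\<close>

context borel_setup
begin

interpretation B: frobenius_group B by (rule B_group)
interpretation T: frobenius_group T by (rule T_group)

lemma el_in_U: "el 1 c \<in> U"
  by (auto simp: U_eq)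

lemma upoly_exists: "f \<in> coord_ring U \<Longrightarrow> \<exists>q. \<forall>c. f (el 1 c) = poly q c"
proof (induction rule: coord_induct)
  case (const c)
  then show ?case by (intro exI[of _ "[:c:]"]) (simp add: restr_def el_in_U)
next
  case (entry i j)
  obtain \<alpha> \<beta> \<gamma> where "\<And>a c. el a c $ i $ j = \<alpha> * a + \<beta> * c + \<gamma> * inverse a"
    using entry_el[of i j] by metis
  then show ?case by (intro exI[of _ "[:\<alpha> + \<gamma>, \<beta>:]"]) (simp add: restr_def el_in_U algebra_simps)
next
  case (add f g)
  then obtain q r where "\<forall>c. f (el 1 c) = poly q c" "\<forall>c. g (el 1 c) = poly r c" by blast
  then show ?case by (intro exI[of _ "q + r"]) simp
next
  case (mult f g)
  then obtain q r where "\<forall>c. f (el 1 c) = poly q c" "\<forall>c. g (el 1 c) = poly r c" by blast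
  then show ?case by (intro exI[of _ "q * r"]) simp
qed

definition upoly :: "('k ^ 2 ^ 2 \<Rightarrow> 'k) \<Rightarrow> 'k poly" where
  "upoly f = (SOME q. \<forall>c. f (el 1 c) = poly q c)"

lemma poly_upoly:
  assumes "f \<in> coord_ring U" shows "poly (upoly f) c = f (el 1 c)"
proof -
  have "\<forall>c. f (el 1 c) = poly (upoly f) c"
    unfolding upoly_def by (rule someI_ex[OF upoly_exists[OF assms]])
  then show ?thesis by metis
qed

lemma poly_eqI_all:
  fixes q r :: "'k poly"
  assumes "\<And>c. poly q c = poly r c"
  shows "q = r"
  using poly_eq_0_nonzero_roots[of "q - r"] assms by simp

lemma upoly_eqI: "f \<in> coord_ring U \<Longrightarrow> (\<And>c. f (el 1 c) = poly q c) \<Longrightarrow> upoly f = q"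
  by (rule poly_eqI_all) (simp add: poly_upoly)

lemma coord_cc_U: "restr U cc \<in> coord_ring U"
  by (rule coords_coord)

definition tangent :: "'k \<Rightarrow> ('k ^ 2 ^ 2 \<Rightarrow> 'k) \<Rightarrow> 'k" where
  "tangent \<xi> = restr (coord_ring U) (\<lambda>f. \<xi> * coeff (upoly f) 1)"

lemma tangent_coord: "f \<in> coord_ring U \<Longrightarrow> tangent \<xi> f = \<xi> * coeff (upoly f) 1"
  by (simp add: tangent_def restr_def)

lemma upoly_add: "f \<in> coord_ring U \<Longrightarrow> h \<in> coord_ring U \<Longrightarrow> upoly (\<lambda>x. f x + h x) = upoly f + upoly h"
  and upoly_mult: "f \<in> coord_ring U \<Longrightarrow> h \<in> coord_ring U \<Longrightarrow> upoly (\<lambda>x. f x * h x) = upoly f * upoly h"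
  and upoly_scale: "f \<in> coord_ring U \<Longrightarrow> upoly (\<lambda>x. c * f x) = Polynomial.smult c (upoly f)"
  by (intro upoly_eqI; simp add: coord_add coord_mult coord_scale poly_upoly)+

lemma tangent_dual: "tangent \<xi> \<in> dual_space (coord_ring U)"
  unfolding dual_space_def
  by (auto simp: tangent_coord coord_add coord_scale upoly_add upoly_scale algebra_simps)
    (simp add: tangent_def restr_def)

lemma tangent_lie: "tangent \<xi> \<in> lie_algebra U"
proof -
  have "tangent \<xi> (\<lambda>x. f x * h x) = tangent \<xi> f * h (mat 1) + f (mat 1) * tangent \<xi> h"
    if "f \<in> coord_ring U" "h \<in> coord_ring U" for f h
  proof -
    have "coeff (upoly f) 0 = f (mat 1)" "coeff (upoly h) 0 = h (mat 1)"
      using that poly_upoly[of _ 0] by (simp_all add: poly_0_coeff_0 el_one)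
    moreover have "coeff (upoly f * upoly h) 1
        = coeff (upoly f) 0 * coeff (upoly h) 1 + coeff (upoly f) 1 * coeff (upoly h) 0"
      by (simp add: coeff_mult)
    ultimately show ?thesis
      using that by (simp add: tangent_coord coord_mult upoly_mult algebra_simps)
  qed
  then show ?thesis using tangent_dual by (simp add: lie_algebra_def)
qed

text \<open>A derivation at 1 kills constants and is determined by its value on c, since every entry
  restricted to U is affine in c and the Leibniz rule covers products.\<close>

lemma lie_eq_tangent:
  assumes \<delta>: "\<delta> \<in> lie_algebra U"
  shows "\<delta> = tangent (\<delta> (restr U cc))"
proof -
  let ?one = "restr U (\<lambda>_. 1)"
  have dual: "\<delta> \<in> dual_space (coord_ring U)" using \<delta> by (simp add: lie_algebra_def)
  have leib: "\<delta> (\<lambda>x. f x * h x) = \<delta> f * h (mat 1) + f (mat 1) * \<delta> h"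
    if "f \<in> coord_ring U" "h \<in> coord_ring U" for f h
    using \<delta> that by (simp add: lie_algebra_def)
  have one_mem: "mat 1 \<in> U" using el_in_U[of 0] by (simp add: el_one)
  have eq: "(\<lambda>x. ?one x * ?one x) = ?one" by (auto simp: restr_def)
  have one1: "?one (mat 1) = 1" using one_mem by (simp add: restr_def)
  \<comment> \<open>The Leibniz rule for 1 = 1 * 1.\<close>
  have "\<delta> ?one = \<delta> ?one + \<delta> ?one"
    using leib[OF coord_const coord_const, of 1 1] by (simp only: eq one1 mult_1 mult_1_right)
  then have "\<delta> ?one + 0 = \<delta> ?one + \<delta> ?one" by (simp only: add_0_right)
  then have one: "\<delta> ?one = 0" by (simp only: add_left_cancel)
  show ?thesis
  proof (rule dual_eqI[OF dual tangent_dual])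
    fix f assume "f \<in> coord_ring U"
    then have "\<delta> f = \<delta> (restr U cc) * coeff (upoly f) 1"
    proof (induction rule: coord_induct)
      case (const c)
      have "restr U (\<lambda>_. c) = (\<lambda>x. c * ?one x)" by (auto simp: restr_def)
      then have "\<delta> (restr U (\<lambda>_. c)) = 0" using dual_scale[OF dual coord_const, of c 1] one by simp
      moreover have "upoly (restr U (\<lambda>_. c)) = [:c:]"
        by (rule upoly_eqI[OF coord_const]) (simp add: restr_def el_in_U)
      ultimately show ?case by simp
    next
      case (entry i j)
      obtain \<alpha> \<beta> \<gamma> where e: "\<And>a c. el a c $ i $ j = \<alpha> * a + \<beta> * c + \<gamma> * inverse a"
        using entry_el[of i j] by metis
      have "restr U (\<lambda>x. x $ i $ j) = (\<lambda>x. (\<alpha> + \<gamma>) * ?one x + \<beta> * restr U cc x)"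
        by (auto simp: restr_def fun_eq_iff U_eq e)
      then have "\<delta> (restr U (\<lambda>x. x $ i $ j)) = \<delta> (\<lambda>x. (\<alpha> + \<gamma>) * ?one x) + \<delta> (\<lambda>x. \<beta> * restr U cc x)"
        using dual_add[OF dual coord_scale[OF coord_const] coord_scale[OF coord_cc_U]] by simp
      then have "\<delta> (restr U (\<lambda>x. x $ i $ j)) = \<beta> * \<delta> (restr U cc)"
        using dual_scale[OF dual coord_const, of "\<alpha> + \<gamma>" 1] dual_scale[OF dual coord_cc_U, of \<beta>] one by simp
      moreover have "upoly (restr U (\<lambda>x. x $ i $ j)) = [:\<alpha> + \<gamma>, \<beta>:]"
        by (rule upoly_eqI[OF coord_entry]) (simp add: restr_def el_in_U e)
      ultimately show ?case by simp
    next
      case (add f g)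
      then show ?case by (simp add: dual_add[OF dual] upoly_add algebra_simps)
    next
      case (mult f g)
      have "coeff (upoly f) 0 = f (mat 1)" "coeff (upoly g) 0 = g (mat 1)"
        using mult.hyps poly_upoly[of _ 0] by (simp_all add: poly_0_coeff_0 el_one)
      then show ?case
        using mult by (simp add: leib upoly_mult coeff_mult algebra_simps)
    qed
    then show "\<delta> f = tangent (\<delta> (restr U cc)) f" using \<open>f \<in> coord_ring U\<close> by (simp add: tangent_coord)
  qed
qed

lemma lie_algebra_eq: "lie_algebra U = range tangent"
  using tangent_lie lie_eq_tangent by auto

section \<open>Polynomial functions on the Lie algebra\<close>

definition slope :: "(('k ^ 2 ^ 2 \<Rightarrow> 'k) \<Rightarrow> 'k) \<Rightarrow> 'k" where
  "slope X = X (restr U cc)"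

lemma slope_tangent [simp]: "slope (tangent \<xi>) = \<xi>"
proof -
  have "upoly (restr U cc) = [:0, 1:]"
    by (rule upoly_eqI[OF coord_cc_U]) (simp add: restr_def el_in_U)
  then show ?thesis by (simp add: slope_def tangent_coord coord_cc_U)
qed

lemma tangent_linear: "(\<lambda>f. tangent \<xi> f + tangent \<eta> f) = tangent (\<xi> + \<eta>)"
  "(\<lambda>f. c * tangent \<xi> f) = tangent (c * \<xi>)"
  by (auto simp: tangent_def restr_def algebra_simps)

definition polyfun :: "'k poly \<Rightarrow> (('k ^ 2 ^ 2 \<Rightarrow> 'k) \<Rightarrow> 'k) \<Rightarrow> 'k" where
  "polyfun q = restr (lie_algebra U) (\<lambda>X. poly q (slope X))"

lemma polyfun_tangent [simp]: "polyfun q (tangent \<xi>) = poly q \<xi>"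
  by (simp add: polyfun_def restr_def tangent_lie)

lemma polyfun_inject: "polyfun q = polyfun r \<longleftrightarrow> q = r"
  by (metis poly_eqI_all polyfun_tangent)

lemma polyfun_add: "(\<lambda>X. polyfun q X + polyfun r X) = polyfun (q + r)"
  and polyfun_mult: "(\<lambda>X. polyfun q X * polyfun r X) = polyfun (q * r)"
  and polyfun_scale: "(\<lambda>X. c * polyfun q X) = polyfun (Polynomial.smult c q)"
  and polyfun_zero: "(\<lambda>X. 0) = polyfun 0"
  and polyfun_const: "restr (lie_algebra U) (\<lambda>_. c) = polyfun [:c:]"
  by (auto simp: polyfun_def restr_def)

text \<open>The Lie algebra is a line with coordinate \<open>slope\<close>, so its dual is spanned
  by \<open>slope\<close> and the polynomial functions are the polynomials in it.\<close>

lemma sym_dual_eq: "sym_dual (lie_algebra U) = range polyfun"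
proof (intro equalityI subsetI)
  fix P assume "P \<in> sym_dual (lie_algebra U)"
  then show "P \<in> range polyfun"
    unfolding sym_dual_def
  proof (induction rule: function_algebra.induct)
    case (gen \<l>)
    define a where "a = \<l> (tangent 1)"
    have hom: "\<l> (tangent \<xi>) = \<xi> * a" for \<xi>
      using dual_scale[OF gen tangent_lie, of \<xi> 1] by (simp add: tangent_linear a_def)
    have "restr (lie_algebra U) \<l> X = polyfun [:0, a:] X" for X
    proof (cases "X \<in> lie_algebra U")
      case True
      then obtain \<xi> where "X = tangent \<xi>" by (auto simp: lie_algebra_eq)
      then show ?thesis by (simp add: restr_def tangent_lie hom)
    qed (simp add: restr_def polyfun_def)
    then have "restr (lie_algebra U) \<l> = polyfun [:0, a:]" ..
    then show ?case by simp
  qed (auto simp: polyfun_const polyfun_add polyfun_mult)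
next
  let ?V = "lie_algebra U"
  have lin: "restr ?V slope \<in> dual_space ?V"
    unfolding dual_space_def
    by (auto simp: lie_algebra_eq restr_def tangent_linear)
  fix P assume "P \<in> range polyfun"
  then obtain q where "P = polyfun q" by blast
  moreover have "polyfun q \<in> sym_dual ?V"
    unfolding sym_dual_def
  proof (induction q)
    case 0
    show ?case using function_algebra.const[of ?V "0 :: 'k"] by (simp add: polyfun_const)
  next
    case (pCons a q)
    have "polyfun (pCons a q) = (\<lambda>X. restr ?V (\<lambda>_. a) X + restr ?V (restr ?V slope) X * polyfun q X)"
      by (auto simp: polyfun_def restr_def)
    then show ?case
      by (simp only:) (intro function_algebra.add function_algebra.mult function_algebra.const
          function_algebra.gen lin pCons.IH)
  qed
  ultimately show "P \<in> sym_dual ?V" by simp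
qed

lemma sym_dual_degree_eq: "sym_dual_degree (lie_algebra U) n = (\<lambda>c. polyfun (monom c n)) ` UNIV"
proof (intro equalityI subsetI)
  fix P assume P: "P \<in> sym_dual_degree (lie_algebra U) n"
  then obtain q where q: "P = polyfun q" by (auto simp: sym_dual_degree_def sym_dual_eq)
  define a where "a = poly q 1"
  have "poly q c = c ^ n * a" for c
  proof -
    have "P (\<lambda>d. c * tangent 1 d) = c ^ n * P (tangent 1)"
      using P tangent_lie by (simp add: sym_dual_degree_def)
    then show ?thesis by (simp only: q tangent_linear polyfun_tangent mult_1_right a_def)
  qed
  then have "q = monom a n" by (intro poly_eqI_all) (simp add: poly_monom)
  then show "P \<in> (\<lambda>c. polyfun (monom c n)) ` UNIV" using q by auto
next
  fix P assume "P \<in> (\<lambda>c. polyfun (monom c n)) ` UNIV"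
  then obtain a where P: "P = polyfun (monom a n)" by blast
  have "P \<in> sym_dual (lie_algebra U)" unfolding P sym_dual_eq by (rule rangeI)
  moreover have "P (\<lambda>d. c * X d) = c ^ n * P X" if X: "X \<in> lie_algebra U" for c X
  proof -
    obtain \<xi> where "X = tangent \<xi>" using X by (auto simp: lie_algebra_eq)
    then show ?thesis
      by (simp add: P tangent_linear poly_monom power_mult_distrib)
  qed
  ultimately show "P \<in> sym_dual_degree (lie_algebra U) n" by (simp add: sym_dual_degree_def)
qed

lemma adjoint_tangent:
  assumes "s \<noteq> 0"
  shows "adjoint_action U (el s 0) (tangent \<xi>) = tangent (inverse s ^ 2 * \<xi>)"
proof
  fix f
  show "adjoint_action U (el s 0) (tangent \<xi>) f = tangent (inverse s ^ 2 * \<xi>) f"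
  proof (cases "f \<in> coord_ring U")
    case True
    let ?h = "restr U (\<lambda>x. f (el s 0 ** x ** matrix_inv (el s 0)))"
    have h: "?h \<in> coord_ring U"
      by (rule coord_two_sided[OF True]) (use assms in \<open>auto simp: U_eq el_conj\<close>)
    have "upoly ?h = pcompose (upoly f) [:0, inverse s ^ 2:]"
      using assms True
      by (intro upoly_eqI[OF h]) (simp add: restr_def el_in_U el_conj poly_pcompose poly_upoly)
    then have "coeff (upoly ?h) 1 = inverse s ^ 2 * coeff (upoly f) 1"
      by (simp add: coeff_pcompose_linear)
    then show ?thesis
      using True h by (simp add: adjoint_action_def restr_def[of "coord_ring U"] tangent_coord)
  qed (simp add: adjoint_action_def tangent_def restr_def)
qed

lemma frobenius_T: "frobenius (el s 0) = el (s ^ p) 0"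
  using p_ge_3 by (simp add: frob_el power_0_left)

text \<open>The inverse of F(t), with parameter s^(-p), scales the Lie algebra, of weight -2, by
  s^(2p). On polynomials in the slope this is a substitution.\<close>

lemma sym_ext_action_polyfun:
  assumes "s \<noteq> 0"
  shows "sym_ext_action U (frobenius (el s 0)) (polyfun q, polyfun r)
    = (polyfun (pcompose q [:0, (s ^ 2) ^ p:]), polyfun (pcompose r [:0, (s ^ 2) ^ p:]))"
proof -
  have "adjoint_action U (matrix_inv (frobenius (el s 0))) (tangent \<xi>) = tangent ((s ^ 2) ^ p * \<xi>)" for \<xi>
    using assms adjoint_tangent[of "inverse (s ^ p)" \<xi>]
    by (simp add: frobenius_T matrix_inv_el power_mult[symmetric] mult.commute)
  then have "restr (lie_algebra U) (\<lambda>X. polyfun q (adjoint_action U (matrix_inv (frobenius (el s 0))) X))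
    = polyfun (pcompose q [:0, (s ^ 2) ^ p:])" for q
  proof (intro ext)
    fix X assume adj: "\<And>\<xi>. adjoint_action U (matrix_inv (frobenius (el s 0))) (tangent \<xi>) = tangent ((s ^ 2) ^ p * \<xi>)"
    show "restr (lie_algebra U) (\<lambda>X. polyfun q (adjoint_action U (matrix_inv (frobenius (el s 0))) X)) X
      = polyfun (pcompose q [:0, (s ^ 2) ^ p:]) X"
    proof (cases "X \<in> lie_algebra U")
      case True
      then obtain \<xi> where "X = tangent \<xi>" by (auto simp: lie_algebra_eq)
      then show ?thesis by (simp add: restr_def tangent_lie adj poly_pcompose mult.commute)
    qed (simp add: restr_def polyfun_def)
  qed
  then show ?thesis by (simp add: sym_ext_action_def)
qed

section \<open>Transfer to the Hochschild cohomology of B_1\<close>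

interpretation cyc: cyclic_path_algebra "psc :: 'k \<Rightarrow> _" p path pcoef
  using cyclic_path_algebra_path_alg[where 'k = 'k] p_ge_3 by (simp add: p_eq)

interpretation am: algebra_model psc "dist_frob_kernel B" model
  by (rule algebra_model_dist)

lemma model_adjoint:
  assumes "s \<noteq> 0" and \<mu>: "\<mu> \<in> carrier (dist_frob_kernel B)"
  shows "model (adjoint_action B (el s 0) \<mu>) = cyc.act (inverse s ^ 2) (model \<mu>)"
proof (rule path_alg_eqI)
  fix u j assume "u < CHAR('k)" "j < CHAR('k)"
  then have uj: "u < p" "j < p" by (simp_all add: p_eq)
  then show "pcoef (model (adjoint_action B (el s 0) \<mu>)) u j = pcoef (cyc.act (inverse s ^ 2) (model \<mu>)) u j"
    by (simp add: cyc.co_act pcoef_model moment_adjoint[OF assms])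
qed

text \<open>Under \<open>model\<close> the adjoint action of the torus becomes the action by path
  length with r = s^(-2), on the arguments through the inverse of t and on the value through
  t.\<close>

lemma cochain_action_lift:
  assumes "s \<noteq> 0"
  shows "cochain_action B (el s 0) (am.lift f) = am.lift (cyc.conj_action (inverse s ^ 2) f)"
proof
  fix as
  let ?A = "dist_frob_kernel B" and ?\<beta> = "adjoint_action B (matrix_inv (el s 0))"
  have inv: "matrix_inv (el s 0) = el (inverse s) 0" using assms by (simp add: matrix_inv_el)
  show "cochain_action B (el s 0) (am.lift f) as = am.lift (cyc.conj_action (inverse s ^ 2) f) as"
  proof (cases "set as \<subseteq> carrier ?A")
    case True
    have "map model (map ?\<beta> as) = map (cyc.act (inverse (inverse s ^ 2))) (map model as)"
      using True assms model_adjoint[of "inverse s"] by (auto simp: inv power_inverse)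
    moreover have "set (map ?\<beta> as) \<subseteq> carrier ?A"
      using True assms adjoint_el_closed[of "inverse s"] by (auto simp: inv)
    ultimately have "am.lift f (map ?\<beta> as) = am.unmodel (f (map (cyc.act (inverse (inverse s ^ 2))) (map model as)))"
      unfolding am.lift_def by (simp only: if_True)
    moreover have "adjoint_action B (el s 0) (am.unmodel x) = am.unmodel (cyc.act (inverse s ^ 2) x)" for x
      using assms by (intro am.unmodel_eqI[symmetric] adjoint_el_closed) (simp_all add: model_adjoint)
    ultimately show ?thesis
      using True by (simp add: cochain_action_def hoch_conj_def am.lift_def[of "cyc.conj_action _ f"] cyc.conj_action_def)
  next
    case False
    then show ?thesis by (simp add: cochain_action_def hoch_conj_def am.lift_def)
  qed
qed

definition class_pair :: "('k path_alg list \<Rightarrow> 'k path_alg) \<Rightarrow>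
    ((('k ^ 2 ^ 2 \<Rightarrow> 'k) \<Rightarrow> 'k) \<Rightarrow> 'k) \<times> ((('k ^ 2 ^ 2 \<Rightarrow> 'k) \<Rightarrow> 'k) \<Rightarrow> 'k)" where
  "class_pair z = (polyfun (cyc.even_class z), polyfun (cyc.odd_class z))"

lemma class_pair_kernel:
  assumes "cyc.cocycle f" and "cyc.cocycle h"
  shows "class_pair f = class_pair h \<longleftrightarrow> cyc.coboundary (\<lambda>l. f l - h l)"
proof -
  have c: "cyc.cochain f" "cyc.cochain h" "cyc.cochain (\<lambda>l. psc (- 1) (h l))"
    using assms by (auto simp: cyc.cocycle_def cyc.cochain_scale)
  have eq: "(\<lambda>l. f l - h l) = (\<lambda>l. f l + psc (- 1) (h l))"
    by (simp add: cyc.sc_minus_left)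
  have "cyc.even_class (\<lambda>l. f l - h l) = cyc.even_class f - cyc.even_class h"
       "cyc.odd_class (\<lambda>l. f l - h l) = cyc.odd_class f - cyc.odd_class h"
    unfolding eq using c by (simp_all add: cyc.even_class_add cyc.odd_class_add cyc.even_class_scale cyc.odd_class_scale)
  then show ?thesis
    using cyc.coboundary_iff[OF cyc.cocycle_minus[OF assms]] by (auto simp: class_pair_def polyfun_inject)
qed

lemma class_pair_iso:
  "am.class_map class_pair \<in> algebra_iso (HH (dist_frob_kernel B)) (sym_ext (lie_algebra U))"
proof (rule am.class_map_algebra_iso)
  have coch: "cyc.cochain f" if "cyc.cocycle f" for f using that by (simp add: cyc.cocycle_def)
  note rec = sym_ext_def
  show "class_pair ` {f. cyc.cocycle f} = carrier (sym_ext (lie_algebra U))"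
  proof (intro equalityI subsetI)
    fix x assume "x \<in> carrier (sym_ext (lie_algebra U))"
    then obtain q r where x: "x = (polyfun q, polyfun r)" by (auto simp: rec sym_dual_eq)
    then have "x = class_pair (cyc.standard_cocycle q r)"
      by (simp add: class_pair_def cyc.standard_cocycle)
    then show "x \<in> class_pair ` {f. cyc.cocycle f}" using cyc.standard_cocycle(1) by blast
  qed (auto simp: rec sym_dual_eq class_pair_def)
  have unit: "(\<lambda>l. if l = [] then 1 else 0) = cyc.unit_cochain"
    by (auto simp: cyc.unit_cochain_def)
  show "cyc.cocycle (\<lambda>l. if l = [] then 1 else 0)"
    unfolding unit by (rule cyc.cocycle_unit)
  show "class_pair (\<lambda>l. if l = [] then 1 else 0) = \<one>\<^bsub>sym_ext (lie_algebra U)\<^esub>"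
    unfolding unit
    by (simp add: rec class_pair_def cyc.even_class_unit cyc.odd_class_unit polyfun_const polyfun_zero one_pCons)
  fix f g c
  show "cyc.cocycle f \<Longrightarrow> cyc.cocycle g \<Longrightarrow> class_pair f = class_pair g \<longleftrightarrow> cyc.coboundary (\<lambda>l. f l - g l)"
    by (rule class_pair_kernel)
  show "cyc.cocycle f \<Longrightarrow> cyc.cocycle g \<Longrightarrow> class_pair (\<lambda>l. f l + g l) = class_pair f \<oplus>\<^bsub>sym_ext (lie_algebra U)\<^esub> class_pair g"
    by (simp add: rec class_pair_def cyc.even_class_add cyc.odd_class_add coch polyfun_add)
  show "cyc.cocycle f \<Longrightarrow> cyc.cocycle g \<Longrightarrow> class_pair (cup f g) = class_pair f \<otimes>\<^bsub>sym_ext (lie_algebra U)\<^esub> class_pair g"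
    by (simp add: rec class_pair_def cyc.class_cup flip: polyfun_mult polyfun_add)
  show "cyc.cocycle f \<Longrightarrow> class_pair (\<lambda>l. psc c (f l)) = c \<odot>\<^bsub>sym_ext (lie_algebra U)\<^esub> class_pair f"
    by (simp add: rec class_pair_def cyc.even_class_scale cyc.odd_class_scale coch polyfun_scale)
qed

lemma class_map_cls: "cyc.cocycle f \<Longrightarrow> am.class_map class_pair (am.cls f) = class_pair f"
  by (rule am.class_map_cls) (simp_all add: class_pair_kernel)

text \<open>A homogeneous cocycle of degree n can have only one nonzero coefficient, at
  \<open>n div 2\<close> in the polynomial singled out by the parity of n. Conversely, multiples of
  the powers of w, with or without x, realise every such coefficient.\<close>

lemma class_pair_degree:
  "am.class_map class_pair ` HH_degree (dist_frob_kernel B) n = sym_ext_degree (lie_algebra U) n"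
proof -
  let ?H = "{f. cyc.cocycle f \<and> (\<forall>l. length l \<noteq> n \<longrightarrow> f l = 0)}"
  have "am.class_map class_pair ` HH_degree (dist_frob_kernel B) n = class_pair ` ?H"
    by (auto simp: am.HH_degree_eq image_image class_map_cls intro!: image_cong)
  also have "\<dots> = sym_ext_degree (lie_algebra U) n"
  proof (intro equalityI subsetI)
    fix x assume "x \<in> class_pair ` ?H"
    then obtain f where f: "cyc.cocycle f" "\<And>l. length l \<noteq> n \<Longrightarrow> f l = 0" and x: "x = class_pair f" by auto
    have c: "cyc.cochain f" using f by (simp add: cyc.cocycle_def)
    have deg: "\<And>m. coeff (cyc.even_class f) m \<noteq> 0 \<Longrightarrow> n = 2 * m" "\<And>m. coeff (cyc.odd_class f) m \<noteq> 0 \<Longrightarrow> n = 2 * m + 1"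
      using cyc.class_homogeneous[of f n] c f(2) by auto
    show "x \<in> sym_ext_degree (lie_algebra U) n"
    proof (cases "even n")
      case True
      have "coeff (cyc.odd_class f) m = 0" for m
        using deg(2)[of m] True by (cases "coeff (cyc.odd_class f) m = 0") auto
      then have "cyc.odd_class f = 0" by (intro poly_eqI) simp
      moreover have "coeff (cyc.even_class f) m = 0" if "m \<noteq> n div 2" for m
        using deg(1)[of m] that by (cases "coeff (cyc.even_class f) m = 0") auto
      then have "cyc.even_class f = monom (coeff (cyc.even_class f) (n div 2)) (n div 2)"
        by (intro poly_eqI) auto
      ultimately show ?thesis
        using True by (simp add: x class_pair_def sym_ext_degree_def sym_dual_degree_eq polyfun_zero) (metis rangeI)
    next
      case False
      have "coeff (cyc.even_class f) m = 0" for m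
        using deg(1)[of m] False by (cases "coeff (cyc.even_class f) m = 0") auto
      then have "cyc.even_class f = 0" by (intro poly_eqI) simp
      moreover have "coeff (cyc.odd_class f) m = 0" if "m \<noteq> n div 2" for m
        using deg(2)[of m] that by (cases "coeff (cyc.odd_class f) m = 0") auto
      then have "cyc.odd_class f = monom (coeff (cyc.odd_class f) (n div 2)) (n div 2)"
        by (intro poly_eqI) auto
      ultimately show ?thesis
        using False by (simp add: x class_pair_def sym_ext_degree_def sym_dual_degree_eq polyfun_zero) (metis rangeI)
    qed
  next
    fix x assume x: "x \<in> sym_ext_degree (lie_algebra U) n"
    let ?k = "n div 2"
    show "x \<in> class_pair ` ?H"
    proof (cases "even n")
      case True
      then obtain c where x: "x = (polyfun (monom c ?k), polyfun 0)"
        using x by (auto simp: sym_ext_degree_def sym_dual_degree_eq polyfun_zero)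
      have pair: "class_pair (\<lambda>l. psc c (cyc.wpow ?k l)) = (polyfun (monom c ?k), polyfun 0)"
        using cyc.class_wpow[of ?k] cyc.cocycle_wpow[of ?k]
        by (simp add: class_pair_def cyc.even_class_scale cyc.odd_class_scale cyc.cocycle_def smult_monom)
      have "(\<lambda>l. psc c (cyc.wpow ?k l)) \<in> ?H"
        using True cyc.cocycle_wpow[of ?k] by (auto intro: cyc.cocycle_scale simp: cyc.wpow_length)
      then show ?thesis unfolding x pair[symmetric] by (rule imageI)
    next
      case False
      then obtain c where x: "x = (polyfun 0, polyfun (monom c ?k))"
        using x by (auto simp: sym_ext_degree_def sym_dual_degree_eq polyfun_zero)
      have pair: "class_pair (\<lambda>l. psc c (cyc.xwpow ?k l)) = (polyfun 0, polyfun (monom c ?k))"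
        using cyc.class_xwpow[of ?k] cyc.cocycle_xwpow[of ?k]
        by (simp add: class_pair_def cyc.even_class_scale cyc.odd_class_scale cyc.cocycle_def smult_monom)
      have "(\<lambda>l. psc c (cyc.xwpow ?k l)) \<in> ?H"
        using False cyc.cocycle_xwpow[of ?k] by (auto intro: cyc.cocycle_scale simp: cyc.xwpow_length)
      then show ?thesis unfolding x pair[symmetric] by (rule imageI)
    qed
  qed
  finally show ?thesis .
qed

lemma class_pair_action:
  assumes "t \<in> T" and "\<xi> \<in> carrier (HH (dist_frob_kernel B))"
  shows "am.class_map class_pair (HH_action B t \<xi>) = sym_ext_action U (frobenius t) (am.class_map class_pair \<xi>)"
proof -
  obtain s where s: "s \<noteq> 0" and t: "t = el s 0" using assms(1) by (auto simp: T_eq)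
  obtain f where f: "cyc.cocycle f" and \<xi>: "\<xi> = am.cls f" using assms(2) by (auto simp: am.carrier_HH)
  \<comment> \<open>Each w contributes the factor r^(-p) = s^(2p), which is the scalar of
    \<open>sym_ext_action_polyfun\<close>.\<close>
  define r where "r = inverse s ^ 2"
  have r: "r \<noteq> 0" "inverse r = s ^ 2" using s by (simp_all add: r_def power_inverse)
  have cf: "cyc.cochain f" using f by (simp add: cyc.cocycle_def)
  have "HH_action B t \<xi> = am.cls (cyc.conj_action r f)"
    unfolding HH_action_def \<xi>
  proof (rule am.hoch_induced_cls[OF f])
    fix f' assume f': "cyc.cocycle f'" "cyc.coboundary (\<lambda>l. f' l - f l)"
    then obtain b where b: "cyc.cochain b" "(\<lambda>l. f' l - f l) = bar_diff b" by (auto simp: cyc.coboundary_def)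
    have "cyc.conj_action r f' l - cyc.conj_action r f l = cyc.conj_action r (bar_diff b) l" for l
      by (simp add: cyc.conj_action_def b(2)[symmetric] cyc.act_diff)
    then have "(\<lambda>l. cyc.conj_action r f' l - cyc.conj_action r f l) = bar_diff (cyc.conj_action r b)"
      using cyc.bar_diff_conj_action[OF r(1)] by auto
    then show "hoch_class (dist_frob_kernel B) (cochain_action B t (am.lift f')) = am.cls (cyc.conj_action r f)"
      using b(1) by (simp add: t cochain_action_lift[OF s] r_def[symmetric] am.hoch_class_lift am.cls_eq_iff
          cyc.coboundary_bar_diff cyc.cochain_conj_action)
  qed
  then have "am.class_map class_pair (HH_action B t \<xi>) = class_pair (cyc.conj_action r f)"
    using class_map_cls[OF cyc.cocycle_conj_action[OF r(1) f]] by simp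
  also have "\<dots> = (polyfun (pcompose (cyc.even_class f) [:0, (s ^ 2) ^ p:]), polyfun (pcompose (cyc.odd_class f) [:0, (s ^ 2) ^ p:]))"
  proof -
    have "cyc.even_class (cyc.conj_action r f) = pcompose (cyc.even_class f) [:0, (s ^ 2) ^ p:]"
      "cyc.odd_class (cyc.conj_action r f) = pcompose (cyc.odd_class f) [:0, (s ^ 2) ^ p:]"
      by (rule poly_eqI; simp add: cyc.coeff_class_conj_action[OF r(1) cf] coeff_pcompose_linear r(2))+
    then show ?thesis by (simp add: class_pair_def)
  qed
  also have "\<dots> = sym_ext_action U (frobenius t) (am.class_map class_pair \<xi>)"
    using s by (simp add: t \<xi> class_map_cls[OF f] class_pair_def sym_ext_action_polyfun)
  finally show ?thesis .
qed

section \<open>The action of the Frobenius kernel of the torus\<close>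

definition weight :: "'k ^ 2 ^ 2 \<Rightarrow> 'k" where
  "weight x = inverse (ca x) ^ 2"

lemma weight_coord: "restr T (\<lambda>x. weight x powi n) \<in> coord_ring T"
proof (cases "n \<ge> 0")
  case True
  then obtain m where n: "n = int m" by (metis nonneg_int_cases)
  have "restr T (\<lambda>x. (cb x ^ 2) ^ m) \<in> coord_ring T"
    by (intro coord_intros coords_coord)
  moreover have "restr T (\<lambda>x. (cb x ^ 2) ^ m) = restr T (\<lambda>x. weight x powi n)"
    by (auto simp: restr_def fun_eq_iff T_eq weight_def n)
  ultimately show ?thesis by simp
next
  case False
  then obtain m where n: "n = - int m" by (metis nle_le minus_minus neg_0_le_iff_le nonneg_int_cases)
  have "restr T (\<lambda>x. (ca x ^ 2) ^ m) \<in> coord_ring T"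
    by (intro coord_intros coords_coord)
  moreover have "restr T (\<lambda>x. (ca x ^ 2) ^ m) = restr T (\<lambda>x. weight x powi n)"
    by (auto simp: restr_def fun_eq_iff T_eq weight_def n power_int_minus power_inverse)
  ultimately show ?thesis by simp
qed

text \<open>The interpretation of \<open>averages\<close>: elements of the algebra are functions,
  and their values at \<phi> provide the matrix coefficients to which \<tau> is applied. On T the
  weight is never zero, which justifies the rule \<open>cong_nonzero\<close>.\<close>

lemma averages_dual:
  assumes \<tau>: "\<tau> \<in> dual_space (coord_ring T)"
    and "cyc.averages (\<lambda>n. \<tau> (restr T (\<lambda>x. weight x powi n))) X x"
  shows "restr T (\<lambda>y. am.unmodel (X (weight y)) \<phi>) \<in> coord_ring T \<and>
    \<tau> (restr T (\<lambda>y. am.unmodel (X (weight y)) \<phi>)) = am.unmodel x \<phi>"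
  using assms(2)
proof (induction rule: cyc.averages.induct)
  case (monomial n x)
  have "restr T (\<lambda>y. am.unmodel (psc (weight y powi n) x) \<phi>)
    = (\<lambda>y. am.unmodel x \<phi> * restr T (\<lambda>y. weight y powi n) y)"
    by (auto simp: restr_def am.unmodel_sc)
  then show ?case
    by (simp add: coord_scale weight_coord dual_scale[OF \<tau>] am.unmodel_sc)
next
  case (plus X x Y y)
  have "restr T (\<lambda>z. am.unmodel (X (weight z) + Y (weight z)) \<phi>)
    = restr T (\<lambda>z. am.unmodel (X (weight z)) \<phi> + am.unmodel (Y (weight z)) \<phi>)"
    by (simp add: am.unmodel_add)
  then show ?case
    using plus by (simp add: coord_restr_add dual_restr_add[OF \<tau>] am.unmodel_add)
next
  case (cong_nonzero X x Y)
  have "restr T (\<lambda>y. am.unmodel (X (weight y)) \<phi>) = restr T (\<lambda>y. am.unmodel (Y (weight y)) \<phi>)"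
    using cong_nonzero(2) by (auto simp: restr_def fun_eq_iff T_eq weight_def)
  then show ?case using cong_nonzero by simp
qed

text \<open>The values of \<tau> on the characters r^n meet the condition of
  \<open>averages_cocycle\<close>, so \<tau> acts on each representative as \<tau>(1) up to a
  coboundary.\<close>

lemma T1_acts_trivially: "frob_kernel_acts_trivially T B"
  unfolding frob_kernel_acts_trivially_def
proof (intro ballI)
  fix \<tau> \<xi> assume \<tau>: "\<tau> \<in> carrier (dist_frob_kernel T)" and "\<xi> \<in> carrier (HH (dist_frob_kernel B))"
  then obtain f where f: "cyc.cocycle f" and \<xi>: "\<xi> = am.cls f" by (auto simp: am.carrier_HH)
  let ?A = "dist_frob_kernel B"
  define t0 where "t0 = \<tau> (restr T (\<lambda>_. 1))"
  define t where "t n = \<tau> (restr T (\<lambda>x. weight x powi n))" for n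
  note dual = T.dist_dual[OF \<tau>]
  \<comment> \<open>The character with exponent -p m is a^(2 p m), that is, a^(2 m) composed with F;
    a distribution on T_1 treats it as the constant 1.\<close>
  have tp: "t (- int (p * m)) = t0" for m
  proof -
    let ?u = "restr T (\<lambda>x. ca x ^ (2 * m))"
    have u: "?u \<in> coord_ring T" by (intro coord_intros coords_coord)
    have "restr T (\<lambda>x. weight x powi (- int (p * m))) = (\<lambda>x. restr T (\<lambda>_. 1) x * ?u (frobenius x))"
    proof
      fix x
      show "restr T (\<lambda>x. weight x powi (- int (p * m))) x = restr T (\<lambda>_. 1) x * ?u (frobenius x)"
      proof (cases "x \<in> T")
        case True
        then obtain a where x: "x = el a 0" "a \<noteq> 0" by (auto simp: T_eq)
        have "(inverse a ^ 2) powi (- int (p * m)) = (a ^ p) ^ (2 * m)"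
          using x by (simp only: power_int_minus power_int_of_nat power_inverse power_mult[symmetric]
              inverse_inverse_eq mult_ac)
        then show ?thesis
          using x True T.frobenius_mem[OF True] by (simp add: restr_def weight_def frobenius_T)
      qed (simp add: restr_def)
    qed
    then have "t (- int (p * m)) = ?u (mat 1) * t0"
      using T.dist_frobenius[OF \<tau> coord_const u, of 1] by (simp add: t_def t0_def)
    moreover have "?u (mat 1) = 1" using T.one_mem by (simp add: restr_def flip: el_one)
    ultimately show ?thesis by simp
  qed
  have "hoch_induced ?A (cochain_dist_action T B \<tau>) (am.cls f) = am.cls (\<lambda>l. psc t0 (f l))"
  proof (rule am.hoch_induced_cls[OF f])
    fix f' assume f': "cyc.cocycle f'" and cob: "cyc.coboundary (\<lambda>l. f' l - f l)"
    obtain g where g: "cyc.coboundary g"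
      and av: "\<And>l. cyc.averages t (\<lambda>r. cyc.conj_action r f' l) (psc t0 (f' l) + g l)"
      using cyc.averages_cocycle[OF f', of t t0] tp by metis
    have "cochain_dist_action T B \<tau> (am.lift f') = am.lift (\<lambda>l. psc t0 (f' l) + g l)"
    proof (intro ext)
      fix as \<phi>
      show "cochain_dist_action T B \<tau> (am.lift f') as \<phi> = am.lift (\<lambda>l. psc t0 (f' l) + g l) as \<phi>"
      proof (cases "set as \<subseteq> carrier ?A")
        case True
        have "restr T (\<lambda>y. cochain_action B y (am.lift f') as \<phi>)
          = restr T (\<lambda>y. am.unmodel (cyc.conj_action (weight y) f' (map model as)) \<phi>)"
          using True by (auto simp: restr_def fun_eq_iff T_eq cochain_action_lift weight_def am.lift_def)
        then show ?thesis
          using averages_dual[OF dual av[unfolded t_def], of "map model as" \<phi>] True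
          by (simp add: cochain_dist_action_def am.lift_def)
      next
        case False
        have "restr T (\<lambda>y. cochain_action B y (am.lift f') as \<phi>) = (\<lambda>x. 0)"
          using False by (auto simp: restr_def cochain_action_def hoch_conj_def)
        then show ?thesis
          using False dual_zero[OF dual] by (simp add: cochain_dist_action_def am.lift_def)
      qed
    qed
    moreover have "cyc.coboundary (\<lambda>l. psc t0 (f' l) + g l - psc t0 (f l))"
      using cyc.coboundary_plus[OF cyc.coboundary_scale[OF cob, of t0] g]
      by (simp add: cyc.sc_diff_right algebra_simps)
    ultimately show "hoch_class ?A (cochain_dist_action T B \<tau> (am.lift f')) = am.cls (\<lambda>l. psc t0 (f l))"
      by (simp add: am.hoch_class_lift am.cls_eq_iff)
  qed
  then show "hoch_induced ?A (cochain_dist_action T B \<tau>) \<xi> = \<tau> (restr T (\<lambda>_. 1)) \<odot>\<^bsub>HH ?A\<^esub> \<xi>"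
    using am.HH_smult[OF f, of t0] by (simp add: \<xi> t0_def)
qed

theorem HH_borel:
  "frob_kernel_acts_trivially T B \<and>
    (\<exists>\<phi> \<in> algebra_iso (HH (dist_frob_kernel B)) (sym_ext (lie_algebra U)).
       (\<forall>n. \<phi> ` HH_degree (dist_frob_kernel B) n = sym_ext_degree (lie_algebra U) n) \<and>
       (\<forall>t\<in>T. \<forall>\<xi>\<in>carrier (HH (dist_frob_kernel B)).
          \<phi> (HH_action B t \<xi>) = sym_ext_action U (frobenius t) (\<phi> \<xi>)))"
  using T1_acts_trivially class_pair_iso class_pair_degree class_pair_action by blast

end

theorem theorem3p2p1:
  fixes T U B :: "('k::alg_closed_field ^ 2 ^ 2) set" and p :: nat
  assumes "CHAR('k) = p" and "p \<ge> 3"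
    and "borel_triple T U B"
    and "frobenius ` T \<subseteq> T" and "frobenius ` B \<subseteq> B"
  shows "frob_kernel_acts_trivially T B \<and>
    (\<exists>\<phi> \<in> algebra_iso (HH (dist_frob_kernel B)) (sym_ext (lie_algebra U)).
       (\<forall>n. \<phi> ` HH_degree (dist_frob_kernel B) n = sym_ext_degree (lie_algebra U) n) \<and>
       (\<forall>t\<in>T. \<forall>\<xi>\<in>carrier (HH (dist_frob_kernel B)).
          \<phi> (HH_action B t \<xi>) = sym_ext_action U (frobenius t) (\<phi> \<xi>)))"
proof -
  obtain g where "borel_setup g T U B p"
    using assms unfolding borel_triple_def borel_setup_def by auto
  then show ?thesis by (rule borel_setup.HH_borel)
qed

end
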